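(* Let $\varphi_h^{n-1}\in Q_h$ and $\boldsymbol u_h^{n-1}\in\boldsymbol V_h$ be given. Solving the discrete problem (P) is equivalent to solving the minimization problem (M), i.e. $(\varphi_h^n,\boldsymbol u_h^n)$ solves (M) if and only if there is $\mu_h^n\in Q_h$ such that $(\varphi_h^n,\mu_h^n,\boldsymbol u_h^n)$ solves (P), where: (P) Find $\varphi_h^n,\mu_h^n\in Q_h$ and $\boldsymbol u_h^n\in\boldsymbol V_h$ such that $$\left(\frac{\varphi_h^n-\varphi_h^{n-1}}{\tau},q_h^\varphi\right)+(m\nabla\mu_h^n,\nabla q_h^\varphi)-(R^n,q_h^\varphi)=0,$$ $$(\mu_h^n,q_h^\mu)-\gamma\ell(\nabla\varphi_h^n,\nabla q_h^\mu)-\frac{\gamma}{\ell}\left(\Psi_c'(\varphi_h^n)-\Psi_e'(\varphi_h^{n-1}),q_h^\mu\right)-\left(\mathcal E_{\mathrm e,\varphi}^{\mathrm{si}}(\varphi_h^n,\boldsymbol u_h^n;\varphi_h^{n-1},\boldsymbol u_h^{n-1}),q_h^\mu\right)=0,$$ $$\left(\mathbb C(\varphi_h^{n-1})(\boldsymbol\varepsilon(\boldsymbol u_h^n)-\xi\varphi_h^n\boldsymbol I);\boldsymbol\varepsilon(\boldsymbol v_h)\right)-(\boldsymbol f^n,\boldsymbol v_h)=0$$ for all $(q_h^\varphi,q_h^\mu,\boldsymbol v_h)\in Q_h\times Q_h\times\boldsymbol V_h$, where $$\mathcal E_{\mathrm e,\varphi}^{\mathrm{si}}(\varphi_h^n,\boldsymbol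 u_h^n;\varphi_h^{n-1},\boldsymbol u_h^{n-1}):=\mathcal E_e^e(\varphi_h^{n-1},\boldsymbol u_h^{n-1})-\xi\boldsymbol I:\mathbb C(\varphi_h^{n-1})\left(\boldsymbol\varepsilon(\boldsymbol u_h^n)-\xi\varphi_h^n\boldsymbol I\right),$$ $$\mathcal E_e^e(\varphi_h^{n-1},\boldsymbol u_h^{n-1}):=\frac12\left(\boldsymbol\varepsilon(\boldsymbol u_h^{n-1})-\xi\varphi_h^{n-1}\boldsymbol I\right):\mathbb C'(\varphi_h^{n-1})\left(\boldsymbol\varepsilon(\boldsymbol u_h^{n-1})-\xi\varphi_h^{n-1}\boldsymbol I\right).$$ (M) Find $$(\varphi_h^n,\boldsymbol u_h^n)=\arg\min_{s_h\in\bar Q_h^n,\ \boldsymbol w_h\in\boldsymbol V_h}\mathcal F_\tau^n(s_h,\boldsymbol w_h),$$ where $\bar Q_h^n:=\{s_h\in Q_h:\int_\Omega\frac{s_h-\varphi_h^{n-1}}{\tau}dx=\int_\Omega R^n\,dx\}$ and $$\mathcal F_\tau^n(s_h,\boldsymbol w_h):=\frac{\|s_h-\varphi_h^{n-1}-\tau R^n\|_{Q_{h,m}^*}^2}{2\tau}+\mathcal E_c^c(s_h,\boldsymbol w_h,\varphi_h^{n-1})+\left(\mathcal E_e^e(\varphi_h^{n-1},\boldsymbol u_h^{n-1}),s_h\right)-\frac{\gamma}{\ell}\left(\Psi_e'(\varphi_h^{n-1}),s_h\right)-(\boldsymbol f^n,\boldsymbol w_h),$$ $$\mathcal E_c^c(s_h,\boldsymbol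 w_h,\varphi_h^{n-1}):=\int_\Omega\frac{\gamma}{\ell}\Psi_c(s_h)+\gamma\ell\frac{|\nabla s_h|^2}{2}+\frac12\left(\boldsymbol\varepsilon(\boldsymbol w_h)-\xi s_h\boldsymbol I\right):\mathbb C(\varphi_h^{n-1})\left(\boldsymbol\varepsilon(\boldsymbol w_h)-\xi s_h\boldsymbol I\right)dx.$$
   Context: Domain and spaces: $\Omega\subset\mathbb R^d$ is a bounded (connected) domain with Lipschitz boundary. $Q_h\subseteq H^1(\Omega)$ and $\boldsymbol V_h\subseteq (H^1_0(\Omega))^d$ are conforming finite element spaces (finite-dimensional spaces of piecewise polynomial functions; $Q_h$ contains the constants). $(\cdot,\cdot)$ is the $L^2(\Omega)$ inner product of scalar or vector functions, $(\cdot;\cdot)$ the $L^2(\Omega)$ inner product of second-order tensor functions, $:$ the pointwise contraction of second-order tensors. $\boldsymbol I$ is the identity tensor in $\mathbb R^{d\times d}$ and $\boldsymbol\varepsilon(\boldsymbol u)=\frac12(\nabla\boldsymbol u+\nabla\boldsymbol u^\top)$. Parameters and data: constants $\gamma,\ell,\tau,m>0$, $\xi\in\mathbb R$; $R^n\in L^2(\Omega)$, $\boldsymbol f^n\in L^2(\Omega)^d$. Dual norm: $Q_{h,0}:=\{q_h\in Q_h:\int_\Omega q_h\,dx=0\}$ with norm $\|q_h\|_{h,m}:=\|m^{1/2}\nabla q_h\|_{L^2(\Omega)}$; its dual space is $Q_{h,m}^*$, with norm $\|s\|_{Q_{h,m}^*}:=\sup_{0\neq q_h\in Q_{h,0}}\langle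 s,q_h\rangle/\|q_h\|_{h,m}$. An $L^2(\Omega)$ function $s$ is identified with the functional $q_h\mapsto(s,q_h)$. Assumption on the double-well potential: $\Psi=\Psi_c-\Psi_e$ with $\Psi_c,\Psi_e:\mathbb R\to\mathbb R$ convex and differentiable, and $(\Psi_c'(a)-\Psi_c'(b))(a-b)\le L_{\Psi_c}(a-b)^2$ for all $a,b\in\mathbb R$, for a constant $L_{\Psi_c}$. Elasticity tensor: $\mathbb C(\varphi)=\mathbb C_{-1}+\pi(\varphi)(\mathbb C_1-\mathbb C_{-1})$ with constant fourth-order tensors $\mathbb C_{\pm1}$ and a $C^1$ interpolation function $\pi:\mathbb R\to\mathbb R$; $\mathbb C'(\varphi)=\pi'(\varphi)(\mathbb C_1-\mathbb C_{-1})$. There are constants $c_{\mathbb C},C_{\mathbb C}>0$ with $c_{\mathbb C}\|\boldsymbol e\|_{L^2(\Omega)}^2\le(\mathbb C(s)\boldsymbol e;\boldsymbol e)\le C_{\mathbb C}\|\boldsymbol e\|_{L^2(\Omega)}^2$ for all symmetric second-order tensor functions $\boldsymbol e\in L^2(\Omega)$ and scalar functions $s\in L^\infty(\Omega)$, and $(\boldsymbol e,\boldsymbol w)\mapsto(\mathbb C(s)\boldsymbol e;\boldsymbol w)$ is an inner product (in particular symmetric). *)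

theory Defs
  imports "HOL-Analysis.Analysis"
begin

section \<open>Lipschitz domains\<close>

text \<open>Near every boundary point \<open>\<Omega>\<close> is, in direction of some unit vector \<open>\<nu>\<close>, the strict epigraph of a
  Lipschitz function \<open>g\<close> on the hyperplane orthogonal to \<open>\<nu>\<close>; this hyperplane takes the role of
  the space of the first \<open>d - 1\<close> rotated coordinates.\<close>

definition lipschitz_boundary :: "'a::euclidean_space set \<Rightarrow> bool" where
  "lipschitz_boundary \<Omega> \<longleftrightarrow>
     (\<forall>x\<in>frontier \<Omega>. \<exists>r>0. \<exists>\<nu> g L. norm \<nu> = 1 \<and> L-lipschitz_on {y. y \<bullet> \<nu> = 0} g \<and>
        \<Omega> \<inter> ball x r = {y \<in> ball x r. g (y - (y \<bullet> \<nu>) *\<^sub>R \<nu>) < y \<bullet> \<nu>})"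

definition bounded_lipschitz_domain :: "'a::euclidean_space set \<Rightarrow> bool" where
  "bounded_lipschitz_domain \<Omega> \<longleftrightarrow>
     \<Omega> \<noteq> {} \<and> open \<Omega> \<and> connected \<Omega> \<and> bounded \<Omega> \<and> lipschitz_boundary \<Omega>"


section \<open>Lebesgue spaces\<close>

text \<open>Elements of function spaces are represented by functions on the whole space; only their
  values almost everywhere in \<open>\<Omega>\<close> are relevant.\<close>

definition L2_space :: "'a::euclidean_space set \<Rightarrow> ('a \<Rightarrow> 'b::euclidean_space) set" where
  "L2_space \<Omega> = {f. f \<in> borel_measurable (lebesgue_on \<Omega>) \<and>
                     integrable (lebesgue_on \<Omega>) (\<lambda>x. (norm (f x))\<^sup>2)}"

definition Linf_space :: "'a::euclidean_space set \<Rightarrow> ('a \<Rightarrow> real) set" where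
  "Linf_space \<Omega> = {f. f \<in> borel_measurable (lebesgue_on \<Omega>) \<and>
                       (\<exists>M. AE x in lebesgue_on \<Omega>. \<bar>f x\<bar> \<le> M)}"

text \<open>On \<open>real\<close> the inner product is multiplication, on \<open>real ^ 'd ^ 'd\<close> it is the
  contraction \<open>A : B\<close>, and the norm on the latter type is the Frobenius norm.\<close>

definition l2_inner ::
  "'a::euclidean_space set \<Rightarrow> ('a \<Rightarrow> 'b::euclidean_space) \<Rightarrow> ('a \<Rightarrow> 'b) \<Rightarrow> real" where
  "l2_inner \<Omega> f g = (\<integral>x. f x \<bullet> g x \<partial>lebesgue_on \<Omega>)"

definition l2_norm :: "'a::euclidean_space set \<Rightarrow> ('a \<Rightarrow> 'b::euclidean_space) \<Rightarrow> real" where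
  "l2_norm \<Omega> f = sqrt (l2_inner \<Omega> f f)"


section \<open>Sobolev spaces\<close>

primrec Ck_function :: "nat \<Rightarrow> (real ^ 'd \<Rightarrow> real) \<Rightarrow> bool" where
  "Ck_function 0 f \<longleftrightarrow> continuous_on UNIV f"
| "Ck_function (Suc k) f \<longleftrightarrow>
     (\<exists>Df. (\<forall>x. GDERIV f x :> Df x) \<and> (\<forall>i. Ck_function k (\<lambda>x. Df x $ i)))"

definition test_function :: "(real ^ 'd) set \<Rightarrow> (real ^ 'd \<Rightarrow> real) \<Rightarrow> bool" where
  "test_function \<Omega> f \<longleftrightarrow>
     (\<forall>k. Ck_function k f) \<and> (\<exists>K. compact K \<and> K \<subseteq> \<Omega> \<and> (\<forall>x. x \<notin> K \<longrightarrow> f x = 0))"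

definition has_weak_gradient ::
  "(real ^ 'd) set \<Rightarrow> (real ^ 'd \<Rightarrow> real) \<Rightarrow> (real ^ 'd \<Rightarrow> real ^ 'd) \<Rightarrow> bool" where
  "has_weak_gradient \<Omega> f g \<longleftrightarrow> f \<in> L2_space \<Omega> \<and> g \<in> L2_space \<Omega> \<and>
     (\<forall>\<phi> D\<phi>. test_function \<Omega> \<phi> \<longrightarrow> (\<forall>x. GDERIV \<phi> x :> D\<phi> x) \<longrightarrow>
        (\<integral>x. f x *\<^sub>R D\<phi> x \<partial>lebesgue_on \<Omega>) = - (\<integral>x. \<phi> x *\<^sub>R g x \<partial>lebesgue_on \<Omega>))"

definition H1_space :: "(real ^ 'd) set \<Rightarrow> (real ^ 'd \<Rightarrow> real) set" where
  "H1_space \<Omega> = {f. \<exists>g. has_weak_gradient \<Omega> f g}"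

text \<open>The choice is unique up to null sets in \<open>\<Omega>\<close>.\<close>

definition weak_grad :: "(real ^ 'd) set \<Rightarrow> (real ^ 'd \<Rightarrow> real) \<Rightarrow> real ^ 'd \<Rightarrow> real ^ 'd" where
  "weak_grad \<Omega> f = (SOME g. has_weak_gradient \<Omega> f g)"

definition h1_norm :: "(real ^ 'd) set \<Rightarrow> (real ^ 'd \<Rightarrow> real) \<Rightarrow> real" where
  "h1_norm \<Omega> f = sqrt ((l2_norm \<Omega> f)\<^sup>2 + (l2_norm \<Omega> (weak_grad \<Omega> f))\<^sup>2)"

definition H1_0_space :: "(real ^ 'd) set \<Rightarrow> (real ^ 'd \<Rightarrow> real) set" where
  "H1_0_space \<Omega> = {f \<in> H1_space \<Omega>. \<exists>\<phi>. (\<forall>k. test_function \<Omega> (\<phi> k)) \<and>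
                     (\<lambda>k::nat. h1_norm \<Omega> (\<lambda>x. f x - \<phi> k x)) \<longlonglongrightarrow> 0}"

definition H1_0_fields :: "(real ^ 'd) set \<Rightarrow> (real ^ 'd \<Rightarrow> real ^ 'd) set" where
  "H1_0_fields \<Omega> = {u. \<forall>i. (\<lambda>x. u x $ i) \<in> H1_0_space \<Omega>}"

definition weak_jacobian ::
  "(real ^ 'd) set \<Rightarrow> (real ^ 'd \<Rightarrow> real ^ 'd) \<Rightarrow> real ^ 'd \<Rightarrow> real ^ 'd ^ 'd" where
  "weak_jacobian \<Omega> u x = (\<chi> i. weak_grad \<Omega> (\<lambda>y. u y $ i) x)"

definition sym_grad ::
  "(real ^ 'd) set \<Rightarrow> (real ^ 'd \<Rightarrow> real ^ 'd) \<Rightarrow> real ^ 'd \<Rightarrow> real ^ 'd ^ 'd" where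
  "sym_grad \<Omega> u x = (1/2) *\<^sub>R (weak_jacobian \<Omega> u x + transpose (weak_jacobian \<Omega> u x))"


section \<open>Finite element spaces\<close>

text \<open>Cells are open and need not be simplices, so that all usual types of meshes are covered.\<close>

definition mesh :: "'a::euclidean_space set \<Rightarrow> 'a set set \<Rightarrow> bool" where
  "mesh \<Omega> \<T> \<longleftrightarrow> finite \<T> \<and> pairwise disjnt \<T> \<and> (\<forall>K\<in>\<T>. open K \<and> K \<noteq> {} \<and> K \<subseteq> \<Omega>) \<and>
     negligible (\<Omega> - \<Union>\<T>)"

definition piecewise_polynomial ::
  "'a::euclidean_space set set \<Rightarrow> ('a \<Rightarrow> 'b::euclidean_space) \<Rightarrow> bool" where
  "piecewise_polynomial \<T> f \<longleftrightarrow>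
     (\<forall>K\<in>\<T>. \<exists>p. polynomial_function p \<and> (\<forall>x\<in>K. f x = p x))"

definition finite_element_space ::
  "'a::euclidean_space set \<Rightarrow> ('a \<Rightarrow> 'b::euclidean_space) set \<Rightarrow> bool" where
  "finite_element_space \<Omega> X \<longleftrightarrow>
     (\<exists>B. finite B \<and> X = {\<lambda>x. \<Sum>b\<in>B. c b *\<^sub>R b x | c. True}) \<and>
     (\<exists>\<T>. mesh \<Omega> \<T> \<and> (\<forall>f\<in>X. piecewise_polynomial \<T> f))"

definition mean_zero_subspace ::
  "(real ^ 'd) set \<Rightarrow> (real ^ 'd \<Rightarrow> real) set \<Rightarrow> (real ^ 'd \<Rightarrow> real) set" where
  "mean_zero_subspace \<Omega> Q = {q \<in> Q. (\<integral>x. q x \<partial>lebesgue_on \<Omega>) = 0}"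

definition hm_norm :: "(real ^ 'd) set \<Rightarrow> real \<Rightarrow> (real ^ 'd \<Rightarrow> real) \<Rightarrow> real" where
  "hm_norm \<Omega> m q = l2_norm \<Omega> (\<lambda>x. sqrt m *\<^sub>R weak_grad \<Omega> q x)"

text \<open>Here \<open>q \<noteq> 0\<close> is meant in \<open>L\<^sup>2(\<Omega>)\<close>. The element \<open>0\<close> only matters if the mean-zero subspace
  is trivial, where the supremum of the empty set is read as \<open>0\<close>.\<close>

definition dual_norm ::
  "(real ^ 'd) set \<Rightarrow> (real ^ 'd \<Rightarrow> real) set \<Rightarrow> real \<Rightarrow> ((real ^ 'd \<Rightarrow> real) \<Rightarrow> real) \<Rightarrow> real" where
  "dual_norm \<Omega> Q m F = Sup (insert 0 {F q / hm_norm \<Omega> m q | q.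
      q \<in> mean_zero_subspace \<Omega> Q \<and> \<not> (AE x in lebesgue_on \<Omega>. q x = 0)})"


section \<open>Elasticity\<close>

text \<open>A fourth-order tensor is a linear map on second-order tensors.\<close>

type_synonym 'd tensor4 = "(real ^ 'd ^ 'd) \<Rightarrow>\<^sub>L (real ^ 'd ^ 'd)"

definition elasticity_tensor ::
  "'d::finite tensor4 \<Rightarrow> 'd tensor4 \<Rightarrow> (real \<Rightarrow> real) \<Rightarrow> real \<Rightarrow> 'd tensor4" where
  "elasticity_tensor Cm Cp \<pi> s = Cm + \<pi> s *\<^sub>R (Cp - Cm)"

definition elasticity_tensor_deriv ::
  "'d::finite tensor4 \<Rightarrow> 'd tensor4 \<Rightarrow> (real \<Rightarrow> real) \<Rightarrow> real \<Rightarrow> 'd tensor4" where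
  "elasticity_tensor_deriv Cm Cp \<pi> s = deriv \<pi> s *\<^sub>R (Cp - Cm)"

definition L2_sym_tensors :: "(real ^ 'd) set \<Rightarrow> (real ^ 'd \<Rightarrow> real ^ 'd ^ 'd) set" where
  "L2_sym_tensors \<Omega> = {e \<in> L2_space \<Omega>. \<forall>x\<in>\<Omega>. transpose (e x) = e x}"

definition inner_product_L2_sym ::
  "(real ^ 'd) set \<Rightarrow> ((real ^ 'd \<Rightarrow> real ^ 'd ^ 'd) \<Rightarrow> (real ^ 'd \<Rightarrow> real ^ 'd ^ 'd) \<Rightarrow> real) \<Rightarrow> bool" where
  "inner_product_L2_sym \<Omega> B \<longleftrightarrow>
     (\<forall>e\<in>L2_sym_tensors \<Omega>. \<forall>w\<in>L2_sym_tensors \<Omega>. B e w = B w e) \<and>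
     (\<forall>e\<in>L2_sym_tensors \<Omega>. \<forall>e'\<in>L2_sym_tensors \<Omega>. \<forall>w\<in>L2_sym_tensors \<Omega>.
        B (\<lambda>x. e x + e' x) w = B e w + B e' w) \<and>
     (\<forall>a. \<forall>e\<in>L2_sym_tensors \<Omega>. \<forall>w\<in>L2_sym_tensors \<Omega>. B (\<lambda>x. a *\<^sub>R e x) w = a * B e w) \<and>
     (\<forall>e\<in>L2_sym_tensors \<Omega>. 0 \<le> B e e \<and> (B e e = 0 \<longleftrightarrow> (AE x in lebesgue_on \<Omega>. e x = 0)))"

definition elastic_strain ::
  "(real ^ 'd) set \<Rightarrow> real \<Rightarrow> (real ^ 'd \<Rightarrow> real) \<Rightarrow> (real ^ 'd \<Rightarrow> real ^ 'd) \<Rightarrow> real ^ 'd \<Rightarrow> real ^ 'd ^ 'd"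
  where "elastic_strain \<Omega> \<xi> \<phi> u x = sym_grad \<Omega> u x - (\<xi> * \<phi> x) *\<^sub>R mat 1"

definition elastic_expl ::
  "(real ^ 'd) set \<Rightarrow> real \<Rightarrow> 'd::finite tensor4 \<Rightarrow> 'd tensor4 \<Rightarrow> (real \<Rightarrow> real) \<Rightarrow>
   (real ^ 'd \<Rightarrow> real) \<Rightarrow> (real ^ 'd \<Rightarrow> real ^ 'd) \<Rightarrow> real ^ 'd \<Rightarrow> real" where
  "elastic_expl \<Omega> \<xi> Cm Cp \<pi> \<phi> u x =
     1/2 * (elastic_strain \<Omega> \<xi> \<phi> u x \<bullet>
              blinfun_apply (elasticity_tensor_deriv Cm Cp \<pi> (\<phi> x)) (elastic_strain \<Omega> \<xi> \<phi> u x))"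

text \<open>The arguments \<open>\<phi>\<^sub>0\<close>, \<open>u\<^sub>0\<close> below are those of the previous time step.\<close>

definition elastic_semi_impl ::
  "(real ^ 'd) set \<Rightarrow> real \<Rightarrow> 'd::finite tensor4 \<Rightarrow> 'd tensor4 \<Rightarrow> (real \<Rightarrow> real) \<Rightarrow>
   (real ^ 'd \<Rightarrow> real) \<Rightarrow> (real ^ 'd \<Rightarrow> real ^ 'd) \<Rightarrow>
   (real ^ 'd \<Rightarrow> real) \<Rightarrow> (real ^ 'd \<Rightarrow> real ^ 'd) \<Rightarrow> real ^ 'd \<Rightarrow> real" where
  "elastic_semi_impl \<Omega> \<xi> Cm Cp \<pi> \<phi> u \<phi>\<^sub>0 u\<^sub>0 x =
     elastic_expl \<Omega> \<xi> Cm Cp \<pi> \<phi>\<^sub>0 u\<^sub>0 x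
     - (\<xi> *\<^sub>R mat 1) \<bullet>
         blinfun_apply (elasticity_tensor Cm Cp \<pi> (\<phi>\<^sub>0 x)) (elastic_strain \<Omega> \<xi> \<phi> u x)"


section \<open>The minimization problem\<close>

definition convex_energy ::
  "(real ^ 'd) set \<Rightarrow> real \<Rightarrow> real \<Rightarrow> real \<Rightarrow> (real \<Rightarrow> real) \<Rightarrow>
   'd::finite tensor4 \<Rightarrow> 'd tensor4 \<Rightarrow> (real \<Rightarrow> real) \<Rightarrow>
   (real ^ 'd \<Rightarrow> real) \<Rightarrow> (real ^ 'd \<Rightarrow> real ^ 'd) \<Rightarrow> (real ^ 'd \<Rightarrow> real) \<Rightarrow> real" where
  "convex_energy \<Omega> \<gamma> l \<xi> \<Psi>\<^sub>c Cm Cp \<pi> s w \<phi>\<^sub>0 =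
     (\<integral>x. \<gamma> / l * \<Psi>\<^sub>c (s x) + \<gamma> * l * ((norm (weak_grad \<Omega> s x))\<^sup>2 / 2)
          + 1/2 * (elastic_strain \<Omega> \<xi> s w x \<bullet>
              blinfun_apply (elasticity_tensor Cm Cp \<pi> (\<phi>\<^sub>0 x)) (elastic_strain \<Omega> \<xi> s w x))
        \<partial>lebesgue_on \<Omega>)"

definition step_functional ::
  "(real ^ 'd) set \<Rightarrow> (real ^ 'd \<Rightarrow> real) set \<Rightarrow> real \<Rightarrow> real \<Rightarrow> real \<Rightarrow> real \<Rightarrow> real \<Rightarrow>
   (real \<Rightarrow> real) \<Rightarrow> (real \<Rightarrow> real) \<Rightarrow>
   'd::finite tensor4 \<Rightarrow> 'd tensor4 \<Rightarrow> (real \<Rightarrow> real) \<Rightarrow>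
   (real ^ 'd \<Rightarrow> real) \<Rightarrow> (real ^ 'd \<Rightarrow> real ^ 'd) \<Rightarrow>
   (real ^ 'd \<Rightarrow> real) \<Rightarrow> (real ^ 'd \<Rightarrow> real ^ 'd) \<Rightarrow>
   (real ^ 'd \<Rightarrow> real) \<Rightarrow> (real ^ 'd \<Rightarrow> real ^ 'd) \<Rightarrow> real" where
  "step_functional \<Omega> Q \<gamma> l \<tau> m \<xi> \<Psi>\<^sub>c \<Psi>\<^sub>e Cm Cp \<pi> R f \<phi>\<^sub>0 u\<^sub>0 s w =
     (dual_norm \<Omega> Q m (l2_inner \<Omega> (\<lambda>x. s x - \<phi>\<^sub>0 x - \<tau> * R x)))\<^sup>2 / (2 * \<tau>)
     + convex_energy \<Omega> \<gamma> l \<xi> \<Psi>\<^sub>c Cm Cp \<pi> s w \<phi>\<^sub>0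
     + l2_inner \<Omega> (elastic_expl \<Omega> \<xi> Cm Cp \<pi> \<phi>\<^sub>0 u\<^sub>0) s
     - \<gamma> / l * l2_inner \<Omega> (\<lambda>x. deriv \<Psi>\<^sub>e (\<phi>\<^sub>0 x)) s
     - l2_inner \<Omega> f w"

definition admissible_phases ::
  "(real ^ 'd) set \<Rightarrow> (real ^ 'd \<Rightarrow> real) set \<Rightarrow> real \<Rightarrow> (real ^ 'd \<Rightarrow> real) \<Rightarrow> (real ^ 'd \<Rightarrow> real) \<Rightarrow>
   (real ^ 'd \<Rightarrow> real) set" where
  "admissible_phases \<Omega> Q \<tau> R \<phi>\<^sub>0 =
     {s \<in> Q. (\<integral>x. (s x - \<phi>\<^sub>0 x) / \<tau> \<partial>lebesgue_on \<Omega>) = (\<integral>x. R x \<partial>lebesgue_on \<Omega>)}"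

end

theory Submission
  imports Defs
begin

text \<open>
  Both problems characterise stationary points of one convex functional on the finite-dimensional
  affine space of pairs \<open>(s, w)\<close> with prescribed total mass, so the theorem is an instance of
  ``stationary if and only if minimal''. The two ingredients are a first variation of
  \<open>step_functional\<close> and the translation of its vanishing into the discrete equations.

  On \<open>Q\<close> the form \<open>(m \<nabla>p, \<nabla>q)\<close> is symmetric and positive semidefinite. As
  \<open>\<Omega>\<close> is connected, its kernel consists of the (almost everywhere) constant functions
  (lemma \<open>mobility_form_kernel_constant\<close>), so every mean-zero source \<open>g\<close> has a Riesz representative
  \<open>\<nu> \<in> Q\<close> with \<open>(m \<nabla>\<nu>, \<nabla>q) = (g, q)\<close> for all \<open>q \<in> Q\<close> (lemma \<open>discrete_inverse_laplacian\<close>),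
  and the squared dual norm of \<open>g\<close> is \<open>(m \<nabla>\<nu>, \<nabla>\<nu>)\<close> (lemma \<open>dual_norm_eq\<close>). Hence the first term
  of the functional is quadratic in \<open>s\<close>, and its derivative in a mean-zero direction \<open>q\<close> is
  \<open>(\<nu>, q) / \<tau>\<close>. The first discrete equation says exactly that \<open>- \<tau> \<mu>\<close> is such a representative of
  \<open>\<phi> - \<phi>\<^sub>0 - \<tau> R\<close>; tested with the constant \<open>1\<close> it is the mass constraint.

  The other terms are linear or quadratic in \<open>(s, w)\<close>, except for the integral of
  \<open>\<Psi>\<^sub>c\<close>. Since \<open>\<Psi>\<^sub>c'\<close> is monotone and one-sided Lipschitz, \<open>\<Psi>\<^sub>c b - \<Psi>\<^sub>c a - \<Psi>\<^sub>c' a (b - a)\<close> lies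
  between \<open>0\<close> and \<open>\<bar>L\<bar> (b - a)\<^sup>2\<close>. This gives lemma \<open>energy_expansion\<close>: along each admissible line the
  increment of the functional is at least \<open>t D\<close> and at most \<open>t D + t\<^sup>2 K\<close>, where \<open>D\<close> is the sum of
  \<open>(\<nu>, q) / \<tau>\<close> and the residuals of the second and third equation. The lower bound turns solutions
  into minimizers, the upper bound forces \<open>D = 0\<close> at a minimizer. Only mean-zero \<open>q\<close> are admissible
  directions, so this determines \<open>\<mu> = - \<nu> / \<tau>\<close> up to a constant, and the constant is fixed by the
  second equation with test function \<open>1\<close>.

  Linearity of \<open>weak_grad\<close>, its vanishing on constants and the kernel
  statement above are needed up to null sets. Uniqueness of weak gradients is the fundamental
  lemma of the calculus of variations, derived from smooth bumps that converge to the indicator of a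
  box and from Lebesgue's differentiation theorem. The same bumps, moved along a segment, show
  that a function with zero weak gradient has the same average over translated small boxes, and is
  therefore locally constant.
\<close>

section \<open>Smooth bump functions on boxes\<close>

lemma Ck_function_const: "Ck_function n (\<lambda>x::real^'d. c)"
proof (induction n arbitrary: c)
  case (Suc n)
  have "Ck_function n (\<lambda>x::real^'d. (0::real^'d) $ i)" for i
    using Suc[of 0] by simp
  then show ?case
    using GDERIV_const by (auto intro!: exI[of _ "\<lambda>x. 0"])
qed simp

lemma Ck_function_SucD: "Ck_function (Suc n) f \<Longrightarrow> Ck_function n f"
proof (induction n arbitrary: f)
  case 0
  then obtain Df where "\<And>x. GDERIV f x :> Df x" by auto
  then show ?case
    by (auto simp: gderiv_def intro: continuous_at_imp_continuous_on has_derivative_continuous)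
next
  case (Suc n)
  from Suc.prems obtain Df where Df: "\<And>x. GDERIV f x :> Df x" "\<And>i. Ck_function (Suc n) (\<lambda>x. Df x $ i)"
    by (subst (asm) Ck_function.simps(2)) blast
  then show ?case using Suc.IH[OF Df(2)] by auto
qed

lemma Ck_function_add: "Ck_function n f \<Longrightarrow> Ck_function n g \<Longrightarrow> Ck_function n (\<lambda>x. f x + g x)"
proof (induction n arbitrary: f g)
  case 0 then show ?case by (auto intro: continuous_intros)
next
  case (Suc n)
  then obtain Df Dg where D: "\<And>x. GDERIV f x :> Df x" "\<And>i. Ck_function n (\<lambda>x. Df x $ i)"
     "\<And>x. GDERIV g x :> Dg x" "\<And>i. Ck_function n (\<lambda>x. Dg x $ i)" by auto
  have "GDERIV (\<lambda>x. f x + g x) x :> Df x + Dg x" for x using D by (auto intro: GDERIV_add)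
  moreover have "Ck_function n (\<lambda>x. (Df x + Dg x) $ i)" for i
    using Suc.IH[OF D(2,4)[of i]] by simp
  ultimately show ?case by (auto intro!: exI[of _ "\<lambda>x. Df x + Dg x"])
qed

lemma Ck_function_mult: "Ck_function n f \<Longrightarrow> Ck_function n g \<Longrightarrow> Ck_function n (\<lambda>x. f x * g x)"
proof (induction n arbitrary: f g)
  case 0 then show ?case by (auto intro: continuous_intros)
next
  case (Suc n)
  then obtain Df Dg where D: "\<And>x. GDERIV f x :> Df x" "\<And>i. Ck_function n (\<lambda>x. Df x $ i)"
     "\<And>x. GDERIV g x :> Dg x" "\<And>i. Ck_function n (\<lambda>x. Dg x $ i)" by auto
  have fg: "Ck_function n f" "Ck_function n g" using Suc.prems by (blast dest: Ck_function_SucD)+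
  have "GDERIV (\<lambda>x. f x * g x) x :> f x *\<^sub>R Dg x + g x *\<^sub>R Df x" for x
    using D by (auto intro: GDERIV_mult)
  moreover have "Ck_function n (\<lambda>x. (f x *\<^sub>R Dg x + g x *\<^sub>R Df x) $ i)" for i
    using Ck_function_add[OF Suc.IH[OF fg(1) D(4)[of i]] Suc.IH[OF fg(2) D(2)[of i]]] by simp
  ultimately show ?case by (auto intro!: exI[of _ "\<lambda>x. f x *\<^sub>R Dg x + g x *\<^sub>R Df x"])
qed

lemma Ck_function_prod:
  "finite I \<Longrightarrow> (\<And>i. i \<in> I \<Longrightarrow> Ck_function n (f i)) \<Longrightarrow> Ck_function n (\<lambda>x. \<Prod>i\<in>I. f i x)"
  by (induction rule: finite_induct) (auto intro: Ck_function_mult Ck_function_const)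

text \<open>The powers of \<open>1 / t\<close> are included because they make the family closed under
  differentiation, up to linear combinations.\<close>

definition flat_exp :: "nat \<Rightarrow> real \<Rightarrow> real" where
  "flat_exp k t = (if t \<le> 0 then 0 else exp (- (1 / t)) / t ^ k)"

text \<open>In the variable \<open>y = 1 / t\<close> this is the limit of \<open>y ^ k / exp y\<close> at infinity.\<close>

lemma flat_exp_tendsto_0: "(flat_exp k \<longlongrightarrow> 0) (at 0)"
proof -
  have "((\<lambda>y. y ^ k / exp y) \<longlongrightarrow> 0) (at_top :: real filter)"
    by (rule tendsto_power_div_exp_0)
  then have "((\<lambda>t::real. inverse t ^ k / exp (inverse t)) \<longlongrightarrow> 0) (at_right 0)"
    by (rule filterlim_compose) (rule filterlim_inverse_at_top_right)
  then have r: "(flat_exp k \<longlongrightarrow> 0) (at_right 0)"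
  proof (rule Lim_transform_eventually)
    show "\<forall>\<^sub>F t in at_right 0. inverse t ^ k / exp (inverse t) = flat_exp k t"
      using eventually_at_right_less[of "0::real"]
      by eventually_elim (auto simp: flat_exp_def exp_minus field_simps power_inverse)
  qed
  have "((\<lambda>_. 0) \<longlongrightarrow> 0) (at_left (0::real))" by simp
  then have l: "(flat_exp k \<longlongrightarrow> 0) (at_left 0)"
  proof (rule Lim_transform_eventually)
    show "\<forall>\<^sub>F t in at_left 0. 0 = flat_exp k t"
      using eventually_at_left_real[of "-1" "0::real"]
      by (auto elim!: eventually_mono simp: flat_exp_def)
  qed
  show ?thesis using l r by (simp add: filterlim_at_split)
qed

text \<open>At \<open>t = 0\<close> the difference quotient of \<open>flat_exp k\<close> is \<open>flat_exp (Suc k)\<close>, which tends to \<open>0\<close>.\<close>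

lemma flat_exp_DERIV: "DERIV (flat_exp k) t :> flat_exp (k + 2) t - k * flat_exp (k + 1) t"
proof -
  consider "t < 0" | "t = 0" | "t > 0" by linarith
  then show ?thesis
  proof cases
    case 1
    have "DERIV (\<lambda>_. 0::real) t :> 0" by simp
    then have "DERIV (flat_exp k) t :> 0"
      by (rule DERIV_cong_ev[THEN iffD1, rotated -1])
         (use 1 in \<open>auto simp: flat_exp_def intro!: eventually_nhds[THEN iffD2] exI[of _ "{..<0}"]\<close>)
    with 1 show ?thesis by (simp add: flat_exp_def)
  next
    case 2
    have "((\<lambda>h. (flat_exp k (0 + h) - flat_exp k 0) / h) \<longlongrightarrow> 0) (at 0)"
    proof (rule Lim_transform_eventually[OF flat_exp_tendsto_0[of "Suc k"]])
      show "\<forall>\<^sub>F h in at 0. flat_exp (Suc k) h = (flat_exp k (0 + h) - flat_exp k 0) / h"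
        by (auto simp: flat_exp_def eventually_at_filter)
    qed
    then show ?thesis using 2 by (simp add: DERIV_def flat_exp_def)
  next
    case 3
    have "DERIV (\<lambda>t. exp (- (1 / t)) / t ^ k) t :>
        (exp (- (1 / t)) * (1 / t\<^sup>2) * t ^ k - exp (- (1 / t)) * (k * t ^ (k - 1))) / (t ^ k * t ^ k)"
      using 3 by (auto intro!: derivative_eq_intros simp: power2_eq_square)
    also have "(exp (- (1 / t)) * (1 / t\<^sup>2) * t ^ k - exp (- (1 / t)) * (k * t ^ (k - 1))) / (t ^ k * t ^ k)
        = flat_exp (k + 2) t - k * flat_exp (k + 1) t"
      using 3 by (cases k) (auto simp: flat_exp_def field_simps power2_eq_square)
    finally have "DERIV (\<lambda>t. exp (- (1 / t)) / t ^ k) t :> flat_exp (k + 2) t - k * flat_exp (k + 1) t" .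
    then show ?thesis
      by (rule DERIV_cong_ev[THEN iffD1, rotated -1])
         (use 3 in \<open>auto simp: flat_exp_def intro!: eventually_nhds[THEN iffD2] exI[of _ "{0<..}"]\<close>)
  qed
qed

lemma Ck_function_flat: "Ck_function n (\<lambda>x. flat_exp k (c * x $ i + d))"
proof (induction n arbitrary: k)
  case 0
  have "continuous_on UNIV (flat_exp k)"
    using flat_exp_DERIV by (intro DERIV_continuous_on) (auto intro: has_field_derivative_at_within)
  then have "continuous_on UNIV (flat_exp k \<circ> (\<lambda>x. c * x $ i + d))"
    by (intro continuous_on_compose continuous_intros) (auto elim: continuous_on_subset)
  then show ?case by (simp add: o_def)
next
  case (Suc n)
  let ?g = "\<lambda>x. flat_exp (k + 2) (c * x $ i + d) + (- real k) * flat_exp (k + 1) (c * x $ i + d)"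
  have "GDERIV (\<lambda>x. flat_exp k (c * x $ i + d)) x :> ?g x *\<^sub>R (c *\<^sub>R axis i 1)" for x
  proof (rule GDERIV_DERIV_compose[where f = "\<lambda>x. c * x $ i + d" and g = "flat_exp k"])
    show "GDERIV (\<lambda>x. c * x $ i + d) x :> c *\<^sub>R axis i 1"
      unfolding gderiv_def
      by (auto intro!: derivative_eq_intros bounded_linear.has_derivative[OF bounded_linear_vec_nth]
            simp: inner_axis)
    show "DERIV (flat_exp k) (c * x $ i + d) :> ?g x"
      using flat_exp_DERIV[of k "c * x $ i + d"] by simp
  qed
  moreover have "Ck_function n (\<lambda>x. (?g x *\<^sub>R (c *\<^sub>R axis i 1)) $ j)" for j
  proof -
    have "Ck_function n (\<lambda>x. ?g x * (c * axis i 1 $ j))"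
      by (intro Ck_function_mult Ck_function_add Ck_function_const Suc)
    then show ?thesis by (simp add: mult.assoc)
  qed
  ultimately show ?case
    by (auto intro!: exI[of _ "\<lambda>x. ?g x *\<^sub>R (c *\<^sub>R axis i 1)"])
qed

text \<open>For \<open>n > 0\<close> a smooth function, positive exactly on the open box. Increasing \<open>n\<close> steepens all factors
  \<open>exp (- 1 / (n t))\<close>, which tend to \<open>1\<close> for each \<open>t > 0\<close>, so the bumps approximate the indicator
  of the box.\<close>

definition bump :: "real ^ 'd \<Rightarrow> real ^ 'd \<Rightarrow> nat \<Rightarrow> real ^ 'd \<Rightarrow> real" where
  "bump a b n x = (\<Prod>i\<in>UNIV. flat_exp 0 (real n * (x $ i - a $ i)) * flat_exp 0 (real n * (b $ i - x $ i)))"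

lemma flat_exp_0_bounds: "0 \<le> flat_exp 0 t" "flat_exp 0 t \<le> 1"
  by (auto simp: flat_exp_def)

lemma bump_bounds: "0 \<le> bump a b n x" "bump a b n x \<le> 1"
  unfolding bump_def
  by (auto intro!: prod_nonneg prod_le_1 mult_le_one mult_nonneg_nonneg simp: flat_exp_0_bounds)

lemma bump_eq_0: "x \<notin> box a b \<Longrightarrow> bump a b n x = 0"
  unfolding bump_def mem_box_cart
  by (auto simp: flat_exp_def mult_le_0_iff not_less)

lemma bump_translate: "bump a b n (x - y) = bump (a + y) (b + y) n x"
  by (simp add: bump_def algebra_simps)

text \<open>The index is shifted since \<open>bump a b 0\<close> vanishes identically.\<close>

lemma bump_tendsto: "(\<lambda>n. bump a b (Suc n) x) \<longlonglongrightarrow> indicator (box a b) x"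
proof (cases "x \<in> box a b")
  case True
  have *: "(\<lambda>n. flat_exp 0 (real (Suc n) * t)) \<longlonglongrightarrow> 1" if "t > 0" for t
  proof -
    have "(\<lambda>n. exp (- (inverse (real (Suc n)) * (1 / t)))) \<longlonglongrightarrow> exp (- (0 * (1 / t)))"
      by (intro tendsto_intros LIMSEQ_inverse_real_of_nat)
    moreover have "flat_exp 0 (real (Suc n) * t) = exp (- (inverse (real (Suc n)) * (1 / t)))" for n
      using that zero_less_mult_iff[of "real (Suc n)" t]
      by (auto simp: flat_exp_def field_simps)
    ultimately show ?thesis by simp
  qed
  have "(\<lambda>n. bump a b (Suc n) x) \<longlonglongrightarrow> (\<Prod>i\<in>(UNIV::'a set). 1 * 1)"
    unfolding bump_def
    by (intro tendsto_prod tendsto_mult *) (use True in \<open>auto simp: mem_box_cart\<close>)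
  with True show ?thesis by simp
next
  case False
  then show ?thesis by (simp add: bump_eq_0)
qed

lemma test_function_bump:
  assumes "cbox a b \<subseteq> \<Omega>" shows "test_function \<Omega> (bump a b n)"
proof -
  have "Ck_function k (bump a b n)" for k
  proof -
    have "Ck_function k (\<lambda>x. flat_exp 0 (real n * (x $ i - a $ i)))" for i
      using Ck_function_flat[of k 0 "real n" i "- real n * a $ i"] by (simp add: algebra_simps)
    moreover have "Ck_function k (\<lambda>x. flat_exp 0 (real n * (b $ i - x $ i)))" for i
      using Ck_function_flat[of k 0 "- real n" i "real n * b $ i"] by (simp add: algebra_simps)
    ultimately show ?thesis
      unfolding bump_def by (intro Ck_function_prod Ck_function_mult) auto
  qed
  then show ?thesis
    unfolding test_function_def using assms box_subset_cbox[of a b]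
    by (auto intro!: exI[of _ "cbox a b"] bump_eq_0)
qed

lemma GDERIV_unique:
  fixes f :: "'a::real_inner \<Rightarrow> real"
  assumes "GDERIV f x :> D" "GDERIV f x :> D'" shows "D = D'"
proof -
  have "(\<lambda>h. h \<bullet> D) = (\<lambda>h. h \<bullet> D')"
    using assms has_derivative_unique unfolding gderiv_def by blast
  then show ?thesis by (metis inner_commute vector_eq_rdot vector_eq_ldot)
qed

lemma test_function_has_gradient:
  assumes "test_function \<Omega> \<phi>"
  obtains D where "\<And>x. GDERIV \<phi> x :> D x"
proof -
  from assms have "Ck_function (Suc 0) \<phi>" by (auto simp: test_function_def)
  then show thesis using that by auto
qed

text \<open>Outside the compact support the function vanishes on an open set, hence so does its gradient.\<close>

lemma test_function_gradient_continuous_bounded: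
  assumes \<phi>: "test_function \<Omega> \<phi>" and D: "\<And>x. GDERIV \<phi> x :> D x"
  shows "continuous_on UNIV D" and "\<exists>M. \<forall>x. norm (D x) \<le> M"
proof -
  from \<phi> have "Ck_function (Suc 0) \<phi>" by (auto simp: test_function_def)
  then obtain D' where D': "\<And>x. GDERIV \<phi> x :> D' x" "\<And>i. continuous_on UNIV (\<lambda>x. D' x $ i)" by auto
  have "D' = D" using GDERIV_unique[OF D'(1) D] by auto
  then show cD: "continuous_on UNIV D"
    using continuous_on_vec_lambda[of UNIV "\<lambda>i x. D x $ i"] D'(2) by simp
  from \<phi> obtain K where K: "compact K" "\<And>x. x \<notin> K \<Longrightarrow> \<phi> x = 0"
    by (auto simp: test_function_def)
  have D0: "D x = 0" if "x \<notin> K" for x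
  proof -
    have "open (- K)" using K(1) by (simp add: compact_imp_closed open_Compl)
    then have ev: "\<forall>\<^sub>F y in nhds x. \<phi> y = 0"
      using that K(2) by (auto simp: eventually_nhds intro!: exI[of _ "- K"])
    have "(\<phi> has_derivative (\<lambda>_. 0)) (at x)"
      by (rule has_derivative_transform_eventually[of "\<lambda>_. 0"])
         (use ev K(2)[OF that] in \<open>auto simp: eventually_at_filter elim: eventually_mono\<close>)
    then have "GDERIV \<phi> x :> 0" by (simp add: gderiv_def)
    then show ?thesis by (rule GDERIV_unique[OF D])
  qed
  have "compact (D ` K)"
    using K(1) cD by (intro compact_continuous_image) (auto elim: continuous_on_subset)
  then obtain M where "\<And>x. x \<in> K \<Longrightarrow> norm (D x) \<le> M"
    using compact_imp_bounded bounded_iff by (metis (no_types, lifting) imageI)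
  then have "norm (D x) \<le> max M 0" for x
    by (cases "x \<in> K") (auto simp: D0 le_max_iff_disj)
  then show "\<exists>M. \<forall>x. norm (D x) \<le> M" by blast
qed

section \<open>The fundamental lemma of the calculus of variations\<close>

lemma bump_measurable [measurable]: "bump a b n \<in> borel_measurable borel"
  using test_function_bump[of a b UNIV n]
  by (auto simp: test_function_def intro!: borel_measurable_continuous_onI dest: spec[of _ 0])

lemma borel_measurable_lebesgue_on:
  "g \<in> borel_measurable borel \<Longrightarrow> g \<in> borel_measurable (lebesgue_on S)"
  by (metis borel_measurable_if_I measurable_completion measurable_lborel2 measurable_restrict_space1)

lemma integrable_bounded_mult:
  fixes f g :: "'a \<Rightarrow> real"
  assumes "integrable M f" "g \<in> borel_measurable M" "AE x in M. \<bar>g x\<bar> \<le> B"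
  shows "integrable M (\<lambda>x. f x * g x)"
proof (rule Bochner_Integration.integrable_bound)
  show "integrable M (\<lambda>x. B * f x)" using assms(1) by simp
  show "(\<lambda>x. f x * g x) \<in> borel_measurable M"
    using assms by (intro borel_measurable_times) auto
  show "AE x in M. norm (f x * g x) \<le> norm (B * f x)"
    using assms(3)
  proof eventually_elim
    case (elim x)
    then have "\<bar>g x\<bar> * \<bar>f x\<bar> \<le> \<bar>B\<bar> * \<bar>f x\<bar>"
      by (intro mult_right_mono) auto
    then show ?case by (simp add: abs_mult mult.commute)
  qed
qed

lemma bump_integral_tendsto:
  assumes f: "integrable (lebesgue_on S) f"
  shows "(\<lambda>n. \<integral>x. bump a b (Suc n) x * f x \<partial>lebesgue_on S)
           \<longlonglongrightarrow> (\<integral>x. indicator (box a b) x * f x \<partial>lebesgue_on S)"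
proof (rule integral_dominated_convergence[where w = "\<lambda>x. \<bar>f x\<bar>"])
  have [measurable]: "f \<in> borel_measurable (lebesgue_on S)" using f by auto
  have [measurable]: "bump a b n \<in> borel_measurable (lebesgue_on S)" for n
    by (intro borel_measurable_lebesgue_on) measurable
  have [measurable]: "indicat_real (box a b) \<in> borel_measurable (lebesgue_on S)"
    by (intro borel_measurable_lebesgue_on) measurable
  show "(\<lambda>x. indicator (box a b) x * f x) \<in> borel_measurable (lebesgue_on S)" by measurable
  show "(\<lambda>x. bump a b (Suc n) x * f x) \<in> borel_measurable (lebesgue_on S)" for n by measurable
  show "integrable (lebesgue_on S) (\<lambda>x. \<bar>f x\<bar>)" using f by simp
  show "AE x in lebesgue_on S. (\<lambda>n. bump a b (Suc n) x * f x) \<longlonglongrightarrow> indicator (box a b) x * f x"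
    by (intro AE_I2 tendsto_mult bump_tendsto tendsto_const)
  have "\<bar>bump a b n x\<bar> * \<bar>f x\<bar> \<le> 1 * \<bar>f x\<bar>" for n x
    using bump_bounds[of a b n x] by (intro mult_right_mono) auto
  then show "AE x in lebesgue_on S. norm (bump a b (Suc n) x * f x) \<le> \<bar>f x\<bar>" for n
    by (simp add: abs_mult)
qed

text \<open>Lebesgue's differentiation theorem for cubes with corner \<open>x\<close>. It is stated with the integral of an
  indicator over \<open>S\<close>, the form in which limits of integrals against bumps appear.\<close>

lemma lebesgue_points:
  fixes f :: "real ^ 'd \<Rightarrow> real"
  assumes S: "S \<in> sets lebesgue" and f: "integrable (lebesgue_on S) f"
  shows "\<exists>N. negligible N \<and> (\<forall>x\<in>S - N.
     ((\<lambda>h. (\<integral>y. indicator (box x (x + h *\<^sub>R One)) y * f y \<partial>lebesgue_on S) / h ^ CARD('d)) \<longlongrightarrow> f x) (at_right 0))"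
proof -
  define F where "F x = (if x \<in> S then f x else 0)" for x
  have F: "integrable lebesgue F"
  proof -
    have "F = (\<lambda>x. indicator S x *\<^sub>R f x)" by (auto simp: F_def indicator_def)
    then show ?thesis using f S by (simp add: integrable_restrict_space)
  qed
  have "F integrable_on UNIV"
    using F integrable_on_lebesgue by auto
  then have Fi: "F integrable_on cbox a b" for a b
    using F integrable_on_subcbox[of F UNIV]
    by (meson integrable_on_subcbox subset_UNIV)
  from integrable_ccontinuous_explicit[of F, OF Fi] obtain N where N: "negligible N"
    "\<And>x e. \<lbrakk>x \<notin> N; 0 < e\<rbrakk> \<Longrightarrow> \<exists>d>0. \<forall>h. 0 < h \<and> h < d \<longrightarrow>
       norm (integral (cbox x (x + h *\<^sub>R One)) F /\<^sub>R h ^ DIM(real^'d) - F x) < e" by metis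
  have box: "(\<integral>y. indicator (box a b) y * f y \<partial>lebesgue_on S) = integral (cbox a b) F" for a b
  proof -
    have B: "integrable (lebesgue_on (box a b)) F"
      using integrable_mult_indicator[OF _ F, of "box a b"] by (simp add: integrable_restrict_space)
    have "(\<integral>y. indicator (box a b) y * f y \<partial>lebesgue_on S)
        = (\<integral>y. indicator (box a b) y *\<^sub>R F y \<partial>lebesgue)"
      using S by (subst integral_restrict_space)
        (auto simp: F_def indicator_def intro!: Bochner_Integration.integral_cong)
    also have "\<dots> = (\<integral>y. F y \<partial>lebesgue_on (box a b))"
      by (subst integral_restrict_space) auto
    also have "\<dots> = integral (box a b) F"
      using has_integral_integral_lebesgue_on[OF B] by (auto simp: integral_unique)
    finally show ?thesis by (simp add: integral_open_interval)
  qed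
  have "((\<lambda>h. (\<integral>y. indicator (box x (x + h *\<^sub>R One)) y * f y \<partial>lebesgue_on S) / h ^ CARD('d)) \<longlongrightarrow> f x)
      (at_right 0)" if x: "x \<in> S - N" for x
    unfolding box
  proof (rule tendstoI)
    fix e :: real assume "e > 0"
    with N(2)[of x e] x obtain d where d: "d > 0" "\<And>h. 0 < h \<and> h < d \<Longrightarrow>
       norm (integral (cbox x (x + h *\<^sub>R One)) F /\<^sub>R h ^ DIM(real^'d) - F x) < e" by blast
    show "\<forall>\<^sub>F h in at_right 0. dist (integral (cbox x (x + h *\<^sub>R One)) F / h ^ CARD('d)) (f x) < e"
      using eventually_at_right_real[OF d(1)]
    proof eventually_elim
      case (elim h)
      then show ?case using d(2)[of h] x by (simp add: F_def dist_real_def divide_inverse mult.commute)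
    qed
  qed
  with N(1) show ?thesis by blast
qed

lemma test_function_bounded_measurable:
  assumes "test_function \<Omega> \<phi>"
  obtains B where "\<phi> \<in> borel_measurable borel" "\<And>x. \<bar>\<phi> x\<bar> \<le> B"
proof -
  from assms have c: "continuous_on UNIV \<phi>" by (auto simp: test_function_def dest: spec[of _ 0])
  from assms obtain K where K: "compact K" "\<And>x. x \<notin> K \<Longrightarrow> \<phi> x = 0"
    by (auto simp: test_function_def)
  have "compact (\<phi> ` K)"
    using K(1) c by (intro compact_continuous_image) (auto elim: continuous_on_subset)
  then obtain B where "\<And>x. x \<in> K \<Longrightarrow> norm (\<phi> x) \<le> B"
    using compact_imp_bounded bounded_iff by (metis (no_types, lifting) imageI)
  then have "\<bar>\<phi> x\<bar> \<le> max B 0" for x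
    by (cases "x \<in> K") (auto simp: K(2) le_max_iff_disj)
  with c that show thesis by (blast intro: borel_measurable_continuous_onI)
qed

lemma small_box_in_open:
  fixes x :: "real ^ 'd"
  assumes "open U" "x \<in> U"
  shows "\<forall>\<^sub>F h in at_right 0. cbox x (x + h *\<^sub>R One) \<subseteq> U"
proof -
  from assms obtain r where r: "r > 0" "ball x r \<subseteq> U" by (meson open_contains_ball)
  have "r / real CARD('d) > 0" using r by simp
  from eventually_at_right_real[OF this] show ?thesis
  proof (rule eventually_mono, intro subsetI)
    fix h y assume h: "h \<in> {0<..<r / real CARD('d)}" and y: "y \<in> cbox x (x + h *\<^sub>R One)"
    have "norm (y - x) \<le> (\<Sum>b\<in>Basis. \<bar>(y - x) \<bullet> b\<bar>)" by (rule norm_le_l1)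
    also have "\<dots> \<le> (\<Sum>b\<in>(Basis::(real^'d) set). h)"
      using y by (intro sum_mono) (auto simp: mem_box inner_diff_left inner_add_left)
    also have "\<dots> < r" using h by (simp add: field_simps)
    finally show "y \<in> U" using r(2) by (auto simp: dist_norm norm_minus_commute)
  qed
qed

lemma AE_lebesgue_on_negligible:
  assumes "S \<in> sets lebesgue" "negligible N" "\<And>x. x \<in> S - N \<Longrightarrow> P x"
  shows "AE x in lebesgue_on S. P x"
  using assms by (auto simp: AE_restrict_space_iff eventually_ae_filter_negligible)

text \<open>Test functions detect the integral over every box in \<open>\<Omega>\<close>, because the bumps tend boundedly to
  its indicator; at Lebesgue points these integrals determine \<open>f\<close>.\<close>

lemma fundamental_lemma_variations:
  fixes f :: "real ^ 'd \<Rightarrow> real"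
  assumes \<Omega>: "open \<Omega>" and f: "integrable (lebesgue_on \<Omega>) f"
    and zero: "\<And>\<phi>. test_function \<Omega> \<phi> \<Longrightarrow> (\<integral>x. \<phi> x * f x \<partial>lebesgue_on \<Omega>) = 0"
  shows "AE x in lebesgue_on \<Omega>. f x = 0"
proof -
  have S: "\<Omega> \<in> sets lebesgue" using \<Omega> by simp
  from lebesgue_points[OF S f] obtain N where N: "negligible N" and
    lim: "\<forall>x\<in>\<Omega> - N.
     ((\<lambda>h. (\<integral>y. indicator (box x (x + h *\<^sub>R One)) y * f y \<partial>lebesgue_on \<Omega>) / h ^ CARD('d)) \<longlongrightarrow> f x) (at_right 0)"
    by blast
  show ?thesis
  proof (rule AE_lebesgue_on_negligible[OF S N])
    fix x assume x: "x \<in> \<Omega> - N"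
    have "\<forall>\<^sub>F h in at_right 0. 0 =
        (\<integral>y. indicator (box x (x + h *\<^sub>R One)) y * f y \<partial>lebesgue_on \<Omega>) / h ^ CARD('d)"
    proof (rule eventually_mono)
      show "\<forall>\<^sub>F h in at_right 0. cbox x (x + h *\<^sub>R One) \<subseteq> \<Omega>"
        using small_box_in_open[OF \<Omega>] x by blast
      fix h assume h: "cbox x (x + h *\<^sub>R One) \<subseteq> \<Omega>"
      show "0 = (\<integral>y. indicator (box x (x + h *\<^sub>R One)) y * f y \<partial>lebesgue_on \<Omega>) / h ^ CARD('d)"
        using bump_integral_tendsto[OF f, of x "x + h *\<^sub>R One"] zero[OF test_function_bump[OF h]]
        by (simp add: LIMSEQ_const_iff)
    qed
    then have "((\<lambda>h. (\<integral>y. indicator (box x (x + h *\<^sub>R One)) y * f y \<partial>lebesgue_on \<Omega>) / h ^ CARD('d)) \<longlongrightarrow> 0) (at_right 0)"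
      by (rule Lim_transform_eventually[OF tendsto_const])
    then show "f x = 0"
      using lim x tendsto_unique[OF trivial_limit_at_right_real] by blast
  qed
qed

text \<open>Differentiation under the integral sign. The difference quotients of \<open>\<phi>\<close> are bounded by the
  supremum of its gradient, so dominated convergence applies for any integrable \<open>f\<close>.\<close>

lemma integral_translate_DERIV:
  fixes f :: "real ^ 'd \<Rightarrow> real" and \<phi> :: "real ^ 'd \<Rightarrow> real"
  assumes f: "integrable (lebesgue_on S) f" and test: "test_function UNIV \<phi>"
    and D: "\<And>x. GDERIV \<phi> x :> D x"
  shows "DERIV (\<lambda>t. \<integral>x. f x * \<phi> (x - t *\<^sub>R e) \<partial>lebesgue_on S) t :>
           - (\<integral>x. f x * (D (x - t *\<^sub>R e) \<bullet> e) \<partial>lebesgue_on S)"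
proof -
  have cD: "continuous_on UNIV D"
    by (rule test_function_gradient_continuous_bounded(1)[OF test D])
  obtain M where M: "\<And>x. norm (D x) \<le> M"
    using test_function_gradient_continuous_bounded(2)[OF test D] by blast
  from test_function_bounded_measurable[OF test] obtain B
    where \<phi>[measurable]: "\<phi> \<in> borel_measurable borel" and B: "\<And>x. \<bar>\<phi> x\<bar> \<le> B" by metis
  have fm[measurable]: "f \<in> borel_measurable (lebesgue_on S)" using f by auto
  have \<phi>m[measurable]: "(\<lambda>x. \<phi> (x - y)) \<in> borel_measurable (lebesgue_on S)" for y
    by (intro borel_measurable_lebesgue_on) measurable
  have [measurable]: "D \<in> borel_measurable borel"
    using cD by (rule borel_measurable_continuous_onI)
  have [measurable]: "(\<lambda>x. D (x - y) \<bullet> e) \<in> borel_measurable (lebesgue_on S)" for y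
    by (intro borel_measurable_lebesgue_on) measurable
  have int: "integrable (lebesgue_on S) (\<lambda>x. f x * \<phi> (x - y))" for y
    by (rule integrable_bounded_mult[OF f]) (use B in auto)
  have lip: "\<bar>\<phi> y - \<phi> x\<bar> \<le> M * norm (y - x)" for x y
  proof -
    have "norm (\<phi> y - \<phi> x) \<le> M * norm (y - x)"
    proof (rule differentiable_bound[of UNIV \<phi> "\<lambda>x h. h \<bullet> D x"])
      show "(\<phi> has_derivative (\<lambda>h. h \<bullet> D x)) (at x)" for x
        using D by (simp add: gderiv_def)
      show "onorm (\<lambda>h. h \<bullet> D x) \<le> M" for x
      proof (rule onorm_bound)
        show "0 \<le> M" using norm_ge_zero M by (rule order.trans)
        show "norm (h \<bullet> D x) \<le> M * norm h" for h
          using Cauchy_Schwarz_ineq2[of h "D x"] mult_left_mono[OF M[of x], of "norm h"]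
          by (simp add: mult.commute)
      qed
    qed auto
    then show ?thesis by simp
  qed
  show ?thesis
    unfolding DERIV_def
  proof (subst tendsto_at_iff_sequentially, intro allI impI)
    fix X :: "nat \<Rightarrow> real"
    assume X: "\<forall>i. X i \<in> UNIV - {0}" "X \<longlonglongrightarrow> 0"
    let ?s = "\<lambda>n x. f x * ((\<phi> (x - (t + X n) *\<^sub>R e) - \<phi> (x - t *\<^sub>R e)) / X n)"
    have "(\<lambda>n. \<integral>x. ?s n x \<partial>lebesgue_on S) \<longlonglongrightarrow> (\<integral>x. f x * (- (D (x - t *\<^sub>R e) \<bullet> e)) \<partial>lebesgue_on S)"
    proof (rule integral_dominated_convergence[where w = "\<lambda>x. \<bar>f x\<bar> * (M * norm e)"])
      show "(\<lambda>x. f x * (- (D (x - t *\<^sub>R e) \<bullet> e))) \<in> borel_measurable (lebesgue_on S)" by measurable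
      show "?s n \<in> borel_measurable (lebesgue_on S)" for n by measurable
      show "integrable (lebesgue_on S) (\<lambda>x. \<bar>f x\<bar> * (M * norm e))" using f by simp
      show "AE x in lebesgue_on S. (\<lambda>n. ?s n x) \<longlonglongrightarrow> f x * (- (D (x - t *\<^sub>R e) \<bullet> e))"
      proof (intro AE_I2 tendsto_mult tendsto_const)
        fix x
        have "DERIV (\<lambda>r. \<phi> (x - r *\<^sub>R e)) t :> - (D (x - t *\<^sub>R e) \<bullet> e)"
        proof -
          have "((\<lambda>r. \<phi> (x - r *\<^sub>R e)) has_derivative (\<lambda>h. (- (h *\<^sub>R e)) \<bullet> D (x - t *\<^sub>R e))) (at t)"
            using D[of "x - t *\<^sub>R e"] unfolding gderiv_def
            by (rule has_derivative_compose[rotated]) (auto intro!: derivative_eq_intros)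
          then show ?thesis
            unfolding has_field_derivative_def
            by (rule has_derivative_eq_rhs) (auto simp: inner_commute)
        qed
        then have "((\<lambda>h. (\<phi> (x - (t + h) *\<^sub>R e) - \<phi> (x - t *\<^sub>R e)) / h) \<longlongrightarrow> - (D (x - t *\<^sub>R e) \<bullet> e)) (at 0)"
          by (simp add: DERIV_def)
        then show "(\<lambda>n. (\<phi> (x - (t + X n) *\<^sub>R e) - \<phi> (x - t *\<^sub>R e)) / X n) \<longlonglongrightarrow> - (D (x - t *\<^sub>R e) \<bullet> e)"
          using X unfolding tendsto_at_iff_sequentially comp_def by simp
      qed
      show "AE x in lebesgue_on S. norm (?s n x) \<le> \<bar>f x\<bar> * (M * norm e)" for n
      proof (rule AE_I2)
        fix x
        have n: "X n \<noteq> 0" using X by auto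
        have "\<bar>\<phi> (x - (t + X n) *\<^sub>R e) - \<phi> (x - t *\<^sub>R e)\<bar> \<le> M * norm (- (X n *\<^sub>R e))"
          using lip[of "x - (t + X n) *\<^sub>R e" "x - t *\<^sub>R e"] by (simp add: algebra_simps)
        then have "\<bar>(\<phi> (x - (t + X n) *\<^sub>R e) - \<phi> (x - t *\<^sub>R e)) / X n\<bar> \<le> M * norm e"
          using n by (simp add: field_simps)
        then show "norm (?s n x) \<le> \<bar>f x\<bar> * (M * norm e)"
          by (simp only: real_norm_def abs_mult mult_left_mono abs_ge_zero)
      qed
    qed
    moreover have "(\<integral>x. ?s n x \<partial>lebesgue_on S) =
       ((\<integral>x. f x * \<phi> (x - (t + X n) *\<^sub>R e) \<partial>lebesgue_on S) - (\<integral>x. f x * \<phi> (x - t *\<^sub>R e) \<partial>lebesgue_on S)) / X n" for n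
    proof -
      have "(\<integral>x. ?s n x \<partial>lebesgue_on S) = (\<integral>x. (f x * \<phi> (x - (t + X n) *\<^sub>R e) - f x * \<phi> (x - t *\<^sub>R e)) / X n \<partial>lebesgue_on S)"
        by (simp add: algebra_simps)
      also have "\<dots> = (\<integral>x. (f x * \<phi> (x - (t + X n) *\<^sub>R e) - f x * \<phi> (x - t *\<^sub>R e)) \<partial>lebesgue_on S) / X n"
        by simp
      also have "\<dots> = ((\<integral>x. f x * \<phi> (x - (t + X n) *\<^sub>R e) \<partial>lebesgue_on S) - (\<integral>x. f x * \<phi> (x - t *\<^sub>R e) \<partial>lebesgue_on S)) / X n"
        by (simp only: Bochner_Integration.integral_diff[OF int int])
      finally show ?thesis .
    qed
    ultimately have "(\<lambda>n. ((\<integral>x. f x * \<phi> (x - (t + X n) *\<^sub>R e) \<partial>lebesgue_on S) - (\<integral>x. f x * \<phi> (x - t *\<^sub>R e) \<partial>lebesgue_on S)) / X n)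
        \<longlonglongrightarrow> (\<integral>x. f x * (- (D (x - t *\<^sub>R e) \<bullet> e)) \<partial>lebesgue_on S)"
      by (simp only:)
    then show "((\<lambda>h. ((\<integral>x. f x * \<phi> (x - (t + h) *\<^sub>R e) \<partial>lebesgue_on S)
          - (\<integral>x. f x * \<phi> (x - t *\<^sub>R e) \<partial>lebesgue_on S)) / h) \<circ> X)
        \<longlonglongrightarrow> - (\<integral>x. f x * (D (x - t *\<^sub>R e) \<bullet> e) \<partial>lebesgue_on S)"
      by (simp add: o_def)
  qed
qed

section \<open>Square-integrable functions\<close>

lemma L2_space_lincomb:
  assumes "f \<in> L2_space \<Omega>" "g \<in> L2_space \<Omega>"
  shows "(\<lambda>x. t *\<^sub>R f x + g x) \<in> L2_space \<Omega>"
proof -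
  let ?M = "lebesgue_on \<Omega>"
  have [measurable]: "f \<in> borel_measurable ?M" "g \<in> borel_measurable ?M"
    using assms by (auto simp: L2_space_def)
  have "integrable ?M (\<lambda>x. (norm (t *\<^sub>R f x + g x))\<^sup>2)"
  proof (rule Bochner_Integration.integrable_bound)
    show "integrable ?M (\<lambda>x. 2 * t\<^sup>2 * (norm (f x))\<^sup>2 + 2 * (norm (g x))\<^sup>2)"
      using assms by (auto simp: L2_space_def)
    show "AE x in ?M. norm ((norm (t *\<^sub>R f x + g x))\<^sup>2) \<le> norm (2 * t\<^sup>2 * (norm (f x))\<^sup>2 + 2 * (norm (g x))\<^sup>2)"
    proof (rule AE_I2)
      fix x
      have "(norm (t *\<^sub>R f x + g x))\<^sup>2 \<le> (\<bar>t\<bar> * norm (f x) + norm (g x))\<^sup>2"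
        using norm_triangle_ineq[of "t *\<^sub>R f x" "g x"] by (intro power_mono) auto
      also have "\<dots> \<le> 2 * (\<bar>t\<bar> * norm (f x))\<^sup>2 + 2 * (norm (g x))\<^sup>2"
        using sum_squares_bound[of "\<bar>t\<bar> * norm (f x)" "norm (g x)"] by (simp add: power2_sum)
      finally show "norm ((norm (t *\<^sub>R f x + g x))\<^sup>2) \<le> norm (2 * t\<^sup>2 * (norm (f x))\<^sup>2 + 2 * (norm (g x))\<^sup>2)"
        by (simp add: power_mult_distrib)
    qed
  qed measurable
  then show ?thesis by (auto simp: L2_space_def)
qed

lemma L2_inner_integrable:
  assumes "f \<in> L2_space \<Omega>" "g \<in> L2_space \<Omega>"
  shows "integrable (lebesgue_on \<Omega>) (\<lambda>x. f x \<bullet> g x)"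
proof (rule Bochner_Integration.integrable_bound)
  have [measurable]: "f \<in> borel_measurable (lebesgue_on \<Omega>)" "g \<in> borel_measurable (lebesgue_on \<Omega>)"
    using assms by (auto simp: L2_space_def)
  show "(\<lambda>x. f x \<bullet> g x) \<in> borel_measurable (lebesgue_on \<Omega>)" by measurable
  show "integrable (lebesgue_on \<Omega>) (\<lambda>x. (norm (f x))\<^sup>2 + (norm (g x))\<^sup>2)"
    using assms by (auto simp: L2_space_def)
  have "\<bar>a \<bullet> b\<bar> \<le> (norm a)\<^sup>2 + (norm b)\<^sup>2" for a b :: 'b
    using Cauchy_Schwarz_ineq2[of a b] sum_squares_bound[of "norm a" "norm b"]
      zero_le_power2[of "norm a"] zero_le_power2[of "norm b"] by linarith
  then show "AE x in lebesgue_on \<Omega>. norm (f x \<bullet> g x) \<le> norm ((norm (f x))\<^sup>2 + (norm (g x))\<^sup>2)"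
    by simp
qed

lemma l2_inner_commute: "l2_inner \<Omega> f g = l2_inner \<Omega> g f"
  by (simp add: l2_inner_def inner_commute)

lemma l2_inner_lincomb_left:
  assumes "f \<in> L2_space \<Omega>" "g \<in> L2_space \<Omega>" "h \<in> L2_space \<Omega>"
  shows "l2_inner \<Omega> (\<lambda>x. t *\<^sub>R f x + g x) h = t * l2_inner \<Omega> f h + l2_inner \<Omega> g h"
  using L2_inner_integrable[OF assms(1,3)] L2_inner_integrable[OF assms(2,3)]
  by (simp add: l2_inner_def inner_add_left)

lemma l2_inner_lincomb_right:
  assumes "f \<in> L2_space \<Omega>" "g \<in> L2_space \<Omega>" "h \<in> L2_space \<Omega>"
  shows "l2_inner \<Omega> h (\<lambda>x. t *\<^sub>R f x + g x) = t * l2_inner \<Omega> h f + l2_inner \<Omega> h g"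
  using l2_inner_lincomb_left[OF assms] by (simp add: l2_inner_commute)

lemma l2_inner_self_nonneg: "0 \<le> l2_inner \<Omega> f f"
  unfolding l2_inner_def by (rule integral_nonneg_AE) simp

lemma l2_inner_self_eq_0:
  assumes "f \<in> L2_space \<Omega>" "l2_inner \<Omega> f f = 0"
  shows "AE x in lebesgue_on \<Omega>. f x = 0"
  using assms integral_nonneg_eq_0_iff_AE[OF L2_inner_integrable[OF assms(1,1)]]
  by (simp add: l2_inner_def)

lemma l2_inner_cong_AE:
  assumes "f \<in> L2_space \<Omega>" "f' \<in> L2_space \<Omega>" "g \<in> L2_space \<Omega>" "g' \<in> L2_space \<Omega>"
    and "AE x in lebesgue_on \<Omega>. f x = f' x" "AE x in lebesgue_on \<Omega>. g x = g' x"
  shows "l2_inner \<Omega> f g = l2_inner \<Omega> f' g'"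
  unfolding l2_inner_def
proof (rule integral_cong_AE)
  show "AE x in lebesgue_on \<Omega>. f x \<bullet> g x = f' x \<bullet> g' x"
    using assms(5,6) by eventually_elim simp
qed (use assms L2_inner_integrable in blast)+

lemma L2_bounded_linear:
  assumes T: "bounded_linear T" and f: "f \<in> L2_space \<Omega>"
  shows "(\<lambda>x. T (f x)) \<in> L2_space \<Omega>"
proof -
  have fm[measurable]: "f \<in> borel_measurable (lebesgue_on \<Omega>)" using f by (simp add: L2_space_def)
  have [measurable]: "T \<in> borel_measurable borel"
    using T by (intro borel_measurable_continuous_onI linear_continuous_on)
  obtain K where K: "\<And>x. norm (T x) \<le> norm x * K" using bounded_linear.bounded[OF T] by metis
  have "integrable (lebesgue_on \<Omega>) (\<lambda>x. (norm (T (f x)))\<^sup>2)"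
  proof (rule Bochner_Integration.integrable_bound)
    show "integrable (lebesgue_on \<Omega>) (\<lambda>x. (norm (f x))\<^sup>2 * K\<^sup>2)" using f by (simp add: L2_space_def)
    show "AE x in lebesgue_on \<Omega>. norm ((norm (T (f x)))\<^sup>2) \<le> norm ((norm (f x))\<^sup>2 * K\<^sup>2)"
      using power_mono[OF K norm_ge_zero, of _ 2] by (simp flip: power_mult_distrib)
  qed measurable
  then show ?thesis by (simp add: L2_space_def)
qed

lemma L2_bounded_scaleR:
  assumes g: "g \<in> borel_measurable (lebesgue_on \<Omega>)" "AE x in lebesgue_on \<Omega>. \<bar>g x\<bar> \<le> B"
    and f: "f \<in> L2_space \<Omega>"
  shows "(\<lambda>x. g x *\<^sub>R f x) \<in> L2_space \<Omega>"
proof -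
  have [measurable]: "f \<in> borel_measurable (lebesgue_on \<Omega>)" using f by (simp add: L2_space_def)
  note g(1)[measurable]
  have "integrable (lebesgue_on \<Omega>) (\<lambda>x. (norm (g x *\<^sub>R f x))\<^sup>2)"
  proof (rule Bochner_Integration.integrable_bound)
    show "integrable (lebesgue_on \<Omega>) (\<lambda>x. B\<^sup>2 * (norm (f x))\<^sup>2)" using f by (simp add: L2_space_def)
    show "AE x in lebesgue_on \<Omega>. norm ((norm (g x *\<^sub>R f x))\<^sup>2) \<le> norm (B\<^sup>2 * (norm (f x))\<^sup>2)"
      using g(2)
    proof eventually_elim
      case (elim x)
      then have "(g x)\<^sup>2 \<le> B\<^sup>2" by (metis abs_ge_zero power2_abs power_mono)
      then show ?case by (simp add: power_mult_distrib mult_right_mono)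
    qed
  qed measurable
  then show ?thesis by (simp add: L2_space_def)
qed

lemma L2_vec:
  fixes f :: "'a::euclidean_space \<Rightarrow> 'b::euclidean_space ^ 'n"
  assumes f: "\<And>i. (\<lambda>x. f x $ i) \<in> L2_space \<Omega>"
  shows "f \<in> L2_space \<Omega>"
proof -
  have comp: "(\<lambda>x. f x $ i) \<in> borel_measurable (lebesgue_on \<Omega>)" for i
    using f by (simp add: L2_space_def)
  have "f \<in> borel_measurable (lebesgue_on \<Omega>)"
  proof (subst borel_measurable_euclidean_space, rule ballI)
    fix b :: "'b ^ 'n" assume "b \<in> Basis"
    then obtain i e where "b = axis i e" by (auto simp: Basis_vec_def)
    then have "(\<lambda>x. f x \<bullet> b) = (\<lambda>x. f x $ i \<bullet> e)" by (simp add: inner_axis)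
    then show "(\<lambda>x. f x \<bullet> b) \<in> borel_measurable (lebesgue_on \<Omega>)" using comp[of i] by simp
  qed
  moreover have "(norm (f x))\<^sup>2 = (\<Sum>i\<in>UNIV. (norm (f x $ i))\<^sup>2)" for x
    by (simp add: norm_vec_def L2_set_def sum_nonneg)
  then have "integrable (lebesgue_on \<Omega>) (\<lambda>x. (norm (f x))\<^sup>2)"
    using f by (simp add: L2_space_def)
  ultimately show ?thesis by (simp add: L2_space_def)
qed

lemma bounded_linear_transpose: "bounded_linear (transpose :: real ^ 'n ^ 'm \<Rightarrow> real ^ 'm ^ 'n)"
  by (rule linear_conv_bounded_linear[THEN iffD1], rule linearI)
     (auto simp: transpose_def vec_eq_iff)

lemma L2_imp_integrable:
  assumes "bounded \<Omega>" "open \<Omega>" "f \<in> L2_space \<Omega>"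
  shows "integrable (lebesgue_on \<Omega>) f"
proof (rule Bochner_Integration.integrable_bound)
  have "\<Omega> \<in> lmeasurable" using assms by (simp add: lmeasurable_open)
  then interpret finite_measure "lebesgue_on \<Omega>" by (rule finite_measure_lebesgue_on)
  show "integrable (lebesgue_on \<Omega>) (\<lambda>x. 1 + (norm (f x))\<^sup>2)"
    using assms by (auto simp: L2_space_def)
  show "f \<in> borel_measurable (lebesgue_on \<Omega>)" using assms by (simp add: L2_space_def)
  have "norm a \<le> 1 + (norm a)\<^sup>2" for a :: 'b
  proof -
    have "2 * norm a \<le> (norm a)\<^sup>2 + 1" using sum_squares_bound[of "norm a" 1] by simp
    then show ?thesis using norm_ge_zero[of a] by linarith
  qed
  then show "AE x in lebesgue_on \<Omega>. norm (f x) \<le> norm (1 + (norm (f x))\<^sup>2)" by simp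
qed

section \<open>Uniqueness and linearity of weak gradients\<close>

lemma test_function_mono: "test_function \<Omega> \<phi> \<Longrightarrow> \<Omega> \<subseteq> \<Omega>' \<Longrightarrow> test_function \<Omega>' \<phi>"
  unfolding test_function_def by blast

lemma integrable_test_function_scaleR:
  fixes g :: "real ^ 'd \<Rightarrow> 'b::euclidean_space"
  assumes "integrable (lebesgue_on \<Omega>) g" "test_function \<Omega>' \<phi>"
  shows "integrable (lebesgue_on \<Omega>) (\<lambda>x. \<phi> x *\<^sub>R g x)"
proof -
  obtain B where \<phi>: "\<phi> \<in> borel_measurable borel" and B: "\<And>x. \<bar>\<phi> x\<bar> \<le> B"
    using test_function_bounded_measurable[OF assms(2)] by metis
  show ?thesis
  proof (rule Bochner_Integration.integrable_bound)
  show "integrable (lebesgue_on \<Omega>) (\<lambda>x. B *\<^sub>R g x)" using assms(1) by simp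
  have [measurable]: "\<phi> \<in> borel_measurable (lebesgue_on \<Omega>)" "g \<in> borel_measurable (lebesgue_on \<Omega>)"
    using \<phi> assms(1) by (auto intro: borel_measurable_lebesgue_on)
  show "(\<lambda>x. \<phi> x *\<^sub>R g x) \<in> borel_measurable (lebesgue_on \<Omega>)" by measurable
  show "AE x in lebesgue_on \<Omega>. norm (\<phi> x *\<^sub>R g x) \<le> norm (B *\<^sub>R g x)"
    using order_trans[OF B abs_ge_self] by (auto intro!: AE_I2 mult_right_mono)
qed
qed

lemma integrable_scaleR_gradient:
  assumes "integrable (lebesgue_on \<Omega>) f" "test_function \<Omega>' \<phi>" "\<And>x. GDERIV \<phi> x :> D x"
  shows "integrable (lebesgue_on \<Omega>) (\<lambda>x. f x *\<^sub>R D x)"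
proof -
  have cD: "continuous_on UNIV D"
    by (rule test_function_gradient_continuous_bounded(1)[OF assms(2,3)])
  obtain M where M: "\<And>x. norm (D x) \<le> M"
    using test_function_gradient_continuous_bounded(2)[OF assms(2,3)] by blast
  have [measurable]: "f \<in> borel_measurable (lebesgue_on \<Omega>)" "D \<in> borel_measurable (lebesgue_on \<Omega>)"
    using assms(1) borel_measurable_continuous_onI[OF cD]
    by (auto intro: borel_measurable_lebesgue_on)
  show ?thesis
  proof (rule Bochner_Integration.integrable_bound)
    show "integrable (lebesgue_on \<Omega>) (\<lambda>x. M * f x)" using assms(1) by simp
    show "(\<lambda>x. f x *\<^sub>R D x) \<in> borel_measurable (lebesgue_on \<Omega>)" by measurable
    show "AE x in lebesgue_on \<Omega>. norm (f x *\<^sub>R D x) \<le> norm (M * f x)"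
      using order_trans[OF M abs_ge_self]
      by (auto intro!: AE_I2 mult_left_mono simp: abs_mult mult.commute[of "\<bar>M\<bar>"])
  qed
qed

text \<open>The difference of two weak gradients is orthogonal to all test functions.\<close>

lemma weak_gradient_unique:
  assumes \<Omega>: "open \<Omega>" "bounded \<Omega>" and g: "has_weak_gradient \<Omega> f g" "has_weak_gradient \<Omega> f g'"
  shows "AE x in lebesgue_on \<Omega>. g x = g' x"
proof -
  have ig: "integrable (lebesgue_on \<Omega>) g" "integrable (lebesgue_on \<Omega>) g'"
    using g L2_imp_integrable[OF \<Omega>(2,1)] by (auto simp: has_weak_gradient_def)
  have comp: "integrable (lebesgue_on \<Omega>) (\<lambda>x. (g x - g' x) $ i)" for i
    using integrable_bounded_linear[OF bounded_linear_vec_nth, of "lebesgue_on \<Omega>" "\<lambda>x. g x - g' x" i] ig by simp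
  have "AE x in lebesgue_on \<Omega>. (g x - g' x) $ i = 0" for i
  proof (rule fundamental_lemma_variations[OF \<Omega>(1) comp])
    fix \<phi> assume \<phi>: "test_function \<Omega> \<phi>"
    obtain D where D: "\<And>x. GDERIV \<phi> x :> D x" using test_function_has_gradient[OF \<phi>] by metis
    have "(\<integral>x. \<phi> x *\<^sub>R g x \<partial>lebesgue_on \<Omega>) = (\<integral>x. \<phi> x *\<^sub>R g' x \<partial>lebesgue_on \<Omega>)"
    proof -
      have "(\<integral>x. f x *\<^sub>R D x \<partial>lebesgue_on \<Omega>) = - (\<integral>x. \<phi> x *\<^sub>R g x \<partial>lebesgue_on \<Omega>)"
        "(\<integral>x. f x *\<^sub>R D x \<partial>lebesgue_on \<Omega>) = - (\<integral>x. \<phi> x *\<^sub>R g' x \<partial>lebesgue_on \<Omega>)"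
        using g \<phi> D by (auto simp: has_weak_gradient_def)
      then show ?thesis by simp
    qed
    moreover have I: "integrable (lebesgue_on \<Omega>) (\<lambda>x. \<phi> x *\<^sub>R g x)" "integrable (lebesgue_on \<Omega>) (\<lambda>x. \<phi> x *\<^sub>R g' x)"
      using ig \<phi> by (auto intro: integrable_test_function_scaleR)
    ultimately have "(\<integral>x. \<phi> x *\<^sub>R g x - \<phi> x *\<^sub>R g' x \<partial>lebesgue_on \<Omega>) = 0"
      by simp
    then have "(\<integral>x. (\<phi> x *\<^sub>R g x - \<phi> x *\<^sub>R g' x) $ i \<partial>lebesgue_on \<Omega>) = 0"
      using integral_bounded_linear[OF bounded_linear_vec_nth, of "lebesgue_on \<Omega>" "\<lambda>x. \<phi> x *\<^sub>R g x - \<phi> x *\<^sub>R g' x" i] I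
      by simp
    then show "(\<integral>x. \<phi> x * (g x - g' x) $ i \<partial>lebesgue_on \<Omega>) = 0"
      by (simp add: right_diff_distrib)
  qed
  then have "AE x in lebesgue_on \<Omega>. \<forall>i. (g x - g' x) $ i = 0"
    by (simp add: eventually_all_finite)
  then show ?thesis by eventually_elim (simp add: vec_eq_iff)
qed

lemma weak_grad_has_weak_gradient: "f \<in> H1_space \<Omega> \<Longrightarrow> has_weak_gradient \<Omega> f (weak_grad \<Omega> f)"
  using someI_ex[of "has_weak_gradient \<Omega> f"] unfolding H1_space_def weak_grad_def by simp

lemma H1_L2: "f \<in> H1_space \<Omega> \<Longrightarrow> f \<in> L2_space \<Omega>"
  and weak_grad_L2: "f \<in> H1_space \<Omega> \<Longrightarrow> weak_grad \<Omega> f \<in> L2_space \<Omega>"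
  using weak_grad_has_weak_gradient[of f \<Omega>] by (auto simp: has_weak_gradient_def)

lemma has_weak_gradient_lincomb:
  assumes \<Omega>: "open \<Omega>" "bounded \<Omega>" and g: "has_weak_gradient \<Omega> f g" "has_weak_gradient \<Omega> f' g'"
  shows "has_weak_gradient \<Omega> (\<lambda>x. t *\<^sub>R f x + f' x) (\<lambda>x. t *\<^sub>R g x + g' x)"
  unfolding has_weak_gradient_def
proof (intro conjI allI impI)
  have L2: "f \<in> L2_space \<Omega>" "g \<in> L2_space \<Omega>" "f' \<in> L2_space \<Omega>" "g' \<in> L2_space \<Omega>"
    using g by (auto simp: has_weak_gradient_def)
  show "(\<lambda>x. t *\<^sub>R f x + f' x) \<in> L2_space \<Omega>" "(\<lambda>x. t *\<^sub>R g x + g' x) \<in> L2_space \<Omega>"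
    using L2 L2_space_lincomb by blast+
  fix \<phi> D assume \<phi>: "test_function \<Omega> \<phi>" and D: "\<forall>x. GDERIV \<phi> x :> D x"
  note int = L2[THEN L2_imp_integrable[OF \<Omega>(2,1)]]
  note I = integrable_test_function_scaleR[OF int(2) \<phi>] integrable_test_function_scaleR[OF int(4) \<phi>]
    integrable_scaleR_gradient[OF int(1) \<phi> D[rule_format]] integrable_scaleR_gradient[OF int(3) \<phi> D[rule_format]]
  have "(\<integral>x. (t *\<^sub>R f x + f' x) *\<^sub>R D x \<partial>lebesgue_on \<Omega>)
      = (\<integral>x. t *\<^sub>R (f x *\<^sub>R D x) + f' x *\<^sub>R D x \<partial>lebesgue_on \<Omega>)"
    by (simp add: algebra_simps)
  also have "\<dots> = t *\<^sub>R (\<integral>x. f x *\<^sub>R D x \<partial>lebesgue_on \<Omega>) + (\<integral>x. f' x *\<^sub>R D x \<partial>lebesgue_on \<Omega>)"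
    using I by (simp del: scaleR_scaleR)
  also have "\<dots> = - (t *\<^sub>R (\<integral>x. \<phi> x *\<^sub>R g x \<partial>lebesgue_on \<Omega>) + (\<integral>x. \<phi> x *\<^sub>R g' x \<partial>lebesgue_on \<Omega>))"
    using g \<phi> D by (simp add: has_weak_gradient_def)
  also have "\<dots> = - (\<integral>x. t *\<^sub>R (\<phi> x *\<^sub>R g x) + \<phi> x *\<^sub>R g' x \<partial>lebesgue_on \<Omega>)"
    using I by (simp del: scaleR_scaleR)
  finally show "(\<integral>x. (t *\<^sub>R f x + f' x) *\<^sub>R D x \<partial>lebesgue_on \<Omega>) =
      - (\<integral>x. \<phi> x *\<^sub>R (t *\<^sub>R g x + g' x) \<partial>lebesgue_on \<Omega>)"
    by (simp add: algebra_simps)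
qed

lemma weak_grad_lincomb:
  assumes \<Omega>: "open \<Omega>" "bounded \<Omega>" and f: "f \<in> H1_space \<Omega>" "f' \<in> H1_space \<Omega>"
  shows "(\<lambda>x. t * f x + f' x) \<in> H1_space \<Omega>"
    and "AE x in lebesgue_on \<Omega>. weak_grad \<Omega> (\<lambda>x. t * f x + f' x) x = t *\<^sub>R weak_grad \<Omega> f x + weak_grad \<Omega> f' x"
proof -
  have *: "has_weak_gradient \<Omega> (\<lambda>x. t * f x + f' x) (\<lambda>x. t *\<^sub>R weak_grad \<Omega> f x + weak_grad \<Omega> f' x)"
    using has_weak_gradient_lincomb[OF \<Omega> f[THEN weak_grad_has_weak_gradient]] by simp
  then show H1: "(\<lambda>x. t * f x + f' x) \<in> H1_space \<Omega>" by (auto simp: H1_space_def)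
  show "AE x in lebesgue_on \<Omega>. weak_grad \<Omega> (\<lambda>x. t * f x + f' x) x = t *\<^sub>R weak_grad \<Omega> f x + weak_grad \<Omega> f' x"
    using weak_gradient_unique[OF \<Omega> weak_grad_has_weak_gradient[OF H1] *] .
qed

section \<open>Weak gradients and constant functions\<close>

text \<open>The integral of \<open>\<phi> (x - t e)\<close> over \<open>\<Omega>\<close> does not depend on \<open>t\<close> for small \<open>t\<close>: the support stays
  inside \<open>\<Omega>\<close>, and Lebesgue measure is translation invariant. Its derivative at \<open>t = 0\<close> is the
  integral of \<open>- D \<bullet> e\<close>.\<close>

lemma integral_gradient_test_function:
  fixes \<phi> :: "real ^ 'd \<Rightarrow> real"
  assumes \<Omega>: "open \<Omega>" "bounded \<Omega>" and \<phi>: "test_function \<Omega> \<phi>" and D: "\<And>x. GDERIV \<phi> x :> D x"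
  shows "(\<integral>x. D x \<partial>lebesgue_on \<Omega>) = 0"
proof (rule vector_eq_ldot[THEN iffD1], rule allI)
  fix e :: "real ^ 'd"
  obtain K where K: "compact K" "K \<subseteq> \<Omega>" "\<And>x. x \<notin> K \<Longrightarrow> \<phi> x = 0"
    using \<phi> by (auto simp: test_function_def)
  obtain B where [measurable]: "\<phi> \<in> borel_measurable borel"
    using test_function_bounded_measurable[OF \<phi>] by metis
  have "\<Omega> \<in> lmeasurable" using \<Omega> by (simp add: lmeasurable_open)
  then interpret finite_measure "lebesgue_on \<Omega>" by (rule finite_measure_lebesgue_on)
  have one: "integrable (lebesgue_on \<Omega>) (\<lambda>x. 1::real)" by simp
  let ?H = "\<lambda>t. \<integral>x. 1 * \<phi> (x - t *\<^sub>R e) \<partial>lebesgue_on \<Omega>"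
  have der: "DERIV ?H 0 :> - (\<integral>x. 1 * (D (x - 0 *\<^sub>R e) \<bullet> e) \<partial>lebesgue_on \<Omega>)"
    by (rule integral_translate_DERIV[OF one test_function_mono[OF \<phi>] D]) auto
  obtain r where r: "r > 0" "\<And>x y. x \<in> K \<Longrightarrow> norm y < r \<Longrightarrow> x + y \<in> \<Omega>"
  proof (cases "K = {}")
    case True then show thesis using that[of 1] by auto
  next
    case False
    obtain d where "d > 0" "(\<Union>x\<in>K. ball x d) \<subseteq> \<Omega>"
      using compact_subset_open_imp_ball_epsilon_subset[OF K(1) \<Omega>(1) K(2)] by blast
    then show thesis using that[of d] by (force simp: dist_norm)
  qed
  have H: "?H t = (\<integral>x. \<phi> x \<partial>lborel)" if t: "norm (t *\<^sub>R e) < r" for t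
  proof -
    have supp: "\<phi> (x - t *\<^sub>R e) = 0" if "x \<notin> \<Omega>" for x
      using r(2)[of "x - t *\<^sub>R e" "t *\<^sub>R e"] K(3)[of "x - t *\<^sub>R e"] t that by auto
    have "?H t = (\<integral>x. indicator \<Omega> x *\<^sub>R \<phi> (x - t *\<^sub>R e) \<partial>lebesgue)"
      using \<Omega> by (subst integral_restrict_space) auto
    also have "\<dots> = (\<integral>x. \<phi> (x - t *\<^sub>R e) \<partial>lebesgue)"
      by (rule Bochner_Integration.integral_cong) (auto simp: indicator_def supp)
    also have "\<dots> = (\<integral>x. \<phi> (- (t *\<^sub>R e) + x) \<partial>lborel)"
      by (subst integral_completion) auto
    also have "\<dots> = (\<integral>x. \<phi> x \<partial>distr lborel borel ((+) (- (t *\<^sub>R e))))"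
      by (subst integral_distr) auto
    finally show ?thesis by (simp only: lborel_distr_plus)
  qed
  have ev: "\<forall>\<^sub>F t in nhds 0. ?H t = (\<integral>x. \<phi> x \<partial>lborel)"
  proof -
    have "((\<lambda>t. norm (t *\<^sub>R e)) \<longlongrightarrow> norm (0 *\<^sub>R e)) (nhds 0)"
      by (intro tendsto_intros filterlim_ident)
    then have "\<forall>\<^sub>F t in nhds 0. norm (t *\<^sub>R e) < r"
      by (rule order_tendstoD) (use r in simp)
    then show ?thesis by eventually_elim (rule H)
  qed
  have "DERIV ?H 0 :> 0"
    by (subst DERIV_cong_ev[OF refl ev refl]) simp
  with der have "(\<integral>x. D x \<bullet> e \<partial>lebesgue_on \<Omega>) = 0"
    using DERIV_unique by fastforce
  moreover have "integrable (lebesgue_on \<Omega>) D"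
    using integrable_scaleR_gradient[OF one \<phi> D] by simp
  ultimately show "e \<bullet> (\<integral>x. D x \<partial>lebesgue_on \<Omega>) = e \<bullet> 0"
    by (simp add: inner_commute)
qed

text \<open>Integration by parts against a constant is the vanishing of the integral of \<open>D\<close>.\<close>

lemma has_weak_gradient_const:
  assumes \<Omega>: "open \<Omega>" "bounded \<Omega>" and f: "f \<in> L2_space \<Omega>" "AE x in lebesgue_on \<Omega>. f x = c"
  shows "has_weak_gradient \<Omega> f (\<lambda>_. 0)"
proof -
  have "\<Omega> \<in> lmeasurable" using \<Omega> by (simp add: lmeasurable_open)
  then interpret finite_measure "lebesgue_on \<Omega>" by (rule finite_measure_lebesgue_on)
  have "(\<integral>x. f x *\<^sub>R D x \<partial>lebesgue_on \<Omega>) = 0" if "test_function \<Omega> \<phi>" "\<forall>x. GDERIV \<phi> x :> D x" for \<phi> D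
  proof -
    have "(\<integral>x. f x *\<^sub>R D x \<partial>lebesgue_on \<Omega>) = (\<integral>x. c *\<^sub>R D x \<partial>lebesgue_on \<Omega>)"
    proof (rule integral_cong_AE)
      show "AE x in lebesgue_on \<Omega>. f x *\<^sub>R D x = c *\<^sub>R D x" using f(2) by eventually_elim simp
      show "(\<lambda>x. f x *\<^sub>R D x) \<in> borel_measurable (lebesgue_on \<Omega>)"
        by (rule borel_measurable_integrable)
           (rule integrable_scaleR_gradient[OF L2_imp_integrable[OF \<Omega>(2,1) f(1)] that(1) that(2)[rule_format]])
      show "(\<lambda>x. c *\<^sub>R D x) \<in> borel_measurable (lebesgue_on \<Omega>)"
        by (rule borel_measurable_integrable)
           (rule integrable_scaleR_gradient[of \<Omega> "\<lambda>_. c", OF _ that(1) that(2)[rule_format]], simp)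
    qed
    also have "\<dots> = 0"
      using integral_gradient_test_function[OF \<Omega> that(1)] that(2) by simp
    finally show ?thesis .
  qed
  with f(1) show ?thesis by (auto simp: has_weak_gradient_def L2_space_def)
qed

text \<open>Moving a bump from the first box to the second along a segment keeps its support in the convex set
  \<open>U\<close>. The derivative of the integral against \<open>f\<close> along this motion is an integral of \<open>f\<close> against the
  gradient of a test function, hence zero.\<close>

lemma zero_weak_gradient_box_integrals_eq:
  fixes f :: "real ^ 'd \<Rightarrow> real"
  assumes f: "integrable (lebesgue_on \<Omega>) f"
    and zero: "\<And>\<phi> D. test_function \<Omega> \<phi> \<Longrightarrow> (\<And>x. GDERIV \<phi> x :> D x) \<Longrightarrow>
       (\<integral>x. f x *\<^sub>R D x \<partial>lebesgue_on \<Omega>) = 0"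
    and U: "convex U" "U \<subseteq> \<Omega>" and box: "cbox x (x + w) \<subseteq> U" "cbox y (y + w) \<subseteq> U"
  shows "(\<integral>z. indicator (box x (x + w)) z * f z \<partial>lebesgue_on \<Omega>)
       = (\<integral>z. indicator (box y (y + w)) z * f z \<partial>lebesgue_on \<Omega>)"
proof -
  define e where "e = y - x"
  have sub: "cbox (x + t *\<^sub>R e) (x + w + t *\<^sub>R e) \<subseteq> \<Omega>" if t: "0 \<le> t" "t \<le> 1" for t
  proof
    fix z assume z: "z \<in> cbox (x + t *\<^sub>R e) (x + w + t *\<^sub>R e)"
    have "z - t *\<^sub>R e \<in> cbox x (x + w)" "z - t *\<^sub>R e + e \<in> cbox y (y + w)"
      using z unfolding e_def mem_box by (auto simp: algebra_simps)
    then have "(1 - t) *\<^sub>R (z - t *\<^sub>R e) + t *\<^sub>R (z - t *\<^sub>R e + e) \<in> U"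
      using box U(1) t by (intro convexD) auto
    moreover have "(1 - t) *\<^sub>R (z - t *\<^sub>R e) + t *\<^sub>R (z - t *\<^sub>R e + e) = z"
      by (simp add: algebra_simps)
    ultimately show "z \<in> \<Omega>" using U(2) by auto
  qed
  have "(\<integral>z. f z * bump x (x + w) n z \<partial>lebesgue_on \<Omega>) = (\<integral>z. f z * bump y (y + w) n z \<partial>lebesgue_on \<Omega>)" for n
  proof -
    let ?H = "\<lambda>t. \<integral>z. f z * bump x (x + w) n (z - t *\<^sub>R e) \<partial>lebesgue_on \<Omega>"
    have test: "test_function UNIV (bump x (x + w) n)" by (rule test_function_bump) simp
    obtain D where D: "\<And>z. GDERIV (bump x (x + w) n) z :> D z" using test_function_has_gradient[OF test] by metis
    have der: "DERIV ?H t :> 0" if t: "0 \<le> t" "t \<le> 1" for t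
    proof -
      have test': "test_function \<Omega> (bump (x + t *\<^sub>R e) (x + w + t *\<^sub>R e) n)"
        by (rule test_function_bump[OF sub[OF t]])
      have D': "GDERIV (bump (x + t *\<^sub>R e) (x + w + t *\<^sub>R e) n) z :> D (z - t *\<^sub>R e)" for z
      proof -
        have "((\<lambda>z. bump x (x + w) n (z - t *\<^sub>R e)) has_derivative (\<lambda>h. h \<bullet> D (z - t *\<^sub>R e))) (at z)"
          using D[of "z - t *\<^sub>R e"] unfolding gderiv_def
          by (rule has_derivative_compose[rotated]) (auto intro!: derivative_eq_intros)
        then show ?thesis by (simp add: gderiv_def bump_translate)
      qed
      have "(\<integral>z. f z * (D (z - t *\<^sub>R e) \<bullet> e) \<partial>lebesgue_on \<Omega>) = (\<integral>z. (f z *\<^sub>R D (z - t *\<^sub>R e)) \<bullet> e \<partial>lebesgue_on \<Omega>)"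
        by simp
      also have "\<dots> = (\<integral>z. f z *\<^sub>R D (z - t *\<^sub>R e) \<partial>lebesgue_on \<Omega>) \<bullet> e"
        by (rule integral_inner_left) (rule integrable_scaleR_gradient[OF f test' D'])
      also have "\<dots> = 0" using zero[OF test' D'] by simp
      finally show ?thesis using integral_translate_DERIV[OF f test D, of e t] by simp
    qed
    have "?H 1 = ?H 0"
    proof (rule DERIV_isconst_end[where f = ?H])
      show "continuous_on {0..1} ?H"
        using der by (intro DERIV_continuous_on) (auto intro: has_field_derivative_at_within)
    qed (use der in auto)
    then show ?thesis by (simp add: e_def bump_translate add.commute)
  qed
  then show ?thesis
    using bump_integral_tendsto[OF f, of x "x + w"] bump_integral_tendsto[OF f, of y "y + w"]
    by (simp add: mult.commute[of _ "f _"] LIMSEQ_unique)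
qed

text \<open>By the previous lemma the averages of \<open>f\<close> over small cubes agree at any two points of a ball in
  \<open>\<Omega>\<close>. So \<open>f\<close> agrees with a constant on the Lebesgue points of each ball, and connectedness of \<open>\<Omega>\<close>
  makes these constants equal.\<close>

lemma zero_weak_gradient_imp_constant:
  fixes f :: "real ^ 'd \<Rightarrow> real"
  assumes \<Omega>: "open \<Omega>" "connected \<Omega>" and f: "integrable (lebesgue_on \<Omega>) f"
    and zero: "\<And>\<phi> D. test_function \<Omega> \<phi> \<Longrightarrow> (\<And>x. GDERIV \<phi> x :> D x) \<Longrightarrow>
       (\<integral>x. f x *\<^sub>R D x \<partial>lebesgue_on \<Omega>) = 0"
  obtains c where "AE x in lebesgue_on \<Omega>. f x = c"
proof -
  have S: "\<Omega> \<in> sets lebesgue" using \<Omega> by simp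
  from lebesgue_points[OF S f] obtain N where N: "negligible N" and
    lim: "\<forall>x\<in>\<Omega> - N.
     ((\<lambda>h. (\<integral>y. indicator (box x (x + h *\<^sub>R One)) y * f y \<partial>lebesgue_on \<Omega>) / h ^ CARD('d)) \<longlongrightarrow> f x) (at_right 0)"
    by blast
  have eq: "f x = f y" if U: "convex U" "open U" "U \<subseteq> \<Omega>" and xy: "x \<in> U - N" "y \<in> U - N" for U x y
  proof -
    let ?a = "\<lambda>x h. (\<integral>y. indicator (box x (x + h *\<^sub>R One)) y * f y \<partial>lebesgue_on \<Omega>) / h ^ CARD('d)"
    have "\<forall>\<^sub>F h in at_right 0. cbox x (x + h *\<^sub>R One) \<subseteq> U \<and> cbox y (y + h *\<^sub>R One) \<subseteq> U"
      using small_box_in_open[OF U(2)] xy by (intro eventually_conj) blast+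
    then have "\<forall>\<^sub>F h in at_right 0. ?a x h = ?a y h"
    proof (rule eventually_mono)
      fix h assume "cbox x (x + h *\<^sub>R One) \<subseteq> U \<and> cbox y (y + h *\<^sub>R One) \<subseteq> U"
      then have "(\<integral>z. indicator (box x (x + h *\<^sub>R One)) z * f z \<partial>lebesgue_on \<Omega>)
         = (\<integral>z. indicator (box y (y + h *\<^sub>R One)) z * f z \<partial>lebesgue_on \<Omega>)"
        by (intro zero_weak_gradient_box_integrals_eq[OF f _ U(1,3)] zero) auto
      then show "?a x h = ?a y h" by simp
    qed
    moreover have "(?a x \<longlongrightarrow> f x) (at_right 0)" using lim xy U(3) by blast
    ultimately have "(?a y \<longlongrightarrow> f x) (at_right 0)" by (rule Lim_transform_eventually[rotated])
    moreover have "(?a y \<longlongrightarrow> f y) (at_right 0)" using lim xy U(3) by blast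
    ultimately show ?thesis by (rule tendsto_unique[OF trivial_limit_at_right_real])
  qed
  \<comment> \<open>The exceptional set contains no open set, so local constants at nearby points can be compared.\<close>
  have dense: "\<exists>y. y \<in> U - N" if "open U" "U \<noteq> {}" for U
    using open_not_negligible[OF that] N negligible_subset by blast
  define k where "k x = (SOME c. \<exists>r>0. ball x r \<subseteq> \<Omega> \<and> (\<forall>y\<in>ball x r - N. f y = c))" for x
  have k: "\<exists>r>0. ball x r \<subseteq> \<Omega> \<and> (\<forall>y\<in>ball x r - N. f y = k x)" if "x \<in> \<Omega>" for x
  proof -
    obtain r where r: "r > 0" "ball x r \<subseteq> \<Omega>" using \<Omega>(1) \<open>x \<in> \<Omega>\<close> open_contains_ball by blast
    obtain z where z: "z \<in> ball x r - N" using dense[of "ball x r"] r by auto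
    have "\<forall>y\<in>ball x r - N. f y = f z"
      using eq[OF convex_ball open_ball r(2) _ z] by blast
    with r have "\<exists>c. \<exists>r>0. ball x r \<subseteq> \<Omega> \<and> (\<forall>y\<in>ball x r - N. f y = c)" by blast
    then show ?thesis unfolding k_def by (rule someI_ex)
  qed
  have "k constant_on \<Omega>"
  proof (rule locally_constant_imp_constant[OF \<Omega>(2)])
    fix a assume a: "a \<in> \<Omega>"
    from k[OF a] obtain r where r: "r > 0" "ball a r \<subseteq> \<Omega>" "\<forall>y\<in>ball a r - N. f y = k a" by blast
    have "k x = k a" if x: "x \<in> ball a r" for x
    proof -
      from k[of x] x r obtain r' where r': "r' > 0" "\<forall>y\<in>ball x r' - N. f y = k x" by blast
      obtain z where "z \<in> ball a r \<inter> ball x r' - N"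
        using dense[of "ball a r \<inter> ball x r'"] x r'(1) open_Int[OF open_ball open_ball]
        by (metis IntI centre_in_ball empty_iff)
      then show ?thesis using r(3) r'(2) by (metis DiffD1 DiffD2 DiffI IntD1 IntD2)
    qed
    then show "\<exists>T. openin (top_of_set \<Omega>) T \<and> a \<in> T \<and> (\<forall>x\<in>T. k x = k a)"
      using open_subset[OF r(2) open_ball] r(1) centre_in_ball by metis
  qed
  then obtain c where c: "\<And>x. x \<in> \<Omega> \<Longrightarrow> k x = c" by (auto simp: constant_on_def)
  have "AE x in lebesgue_on \<Omega>. f x = c"
  proof (rule AE_lebesgue_on_negligible[OF S N])
    fix x assume x: "x \<in> \<Omega> - N"
    with k[of x] obtain r where "r > 0" "\<forall>y\<in>ball x r - N. f y = k x" by blast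
    with x have "f x = k x" by simp
    with x c show "f x = c" by simp
  qed
  then show thesis by (rule that)
qed

section \<open>Riesz representation on finite-dimensional function spaces\<close>

text \<open>Linear spans are formed with explicit coefficients, the shape in which
  \<open>finite_element_space\<close> presents its spaces.\<close>

definition lin_span :: "('x \<Rightarrow> 'b::real_vector) set \<Rightarrow> ('x \<Rightarrow> 'b) set" where
  "lin_span B = {\<lambda>x. \<Sum>b\<in>B. c b *\<^sub>R b x | c. True}"

lemma lin_spanI: "f = (\<lambda>x. \<Sum>b\<in>B. c b *\<^sub>R b x) \<Longrightarrow> f \<in> lin_span B"
  by (auto simp: lin_span_def)

lemma lin_span_insert:
  assumes "finite B" "b \<notin> B"
  shows "lin_span (insert b B) = {\<lambda>x. t *\<^sub>R b x + p x | t p. p \<in> lin_span B}"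
proof (intro equalityI subsetI)
  fix f assume "f \<in> lin_span (insert b B)"
  then obtain c where "f = (\<lambda>x. \<Sum>b\<in>insert b B. c b *\<^sub>R b x)" by (auto simp: lin_span_def)
  then have "f = (\<lambda>x. c b *\<^sub>R b x + (\<Sum>b\<in>B. c b *\<^sub>R b x))" using assms by simp
  then show "f \<in> {\<lambda>x. t *\<^sub>R b x + p x | t p. p \<in> lin_span B}"
    using lin_spanI[of _ c B, OF refl] by (intro CollectI exI conjI)
next
  fix f assume "f \<in> {\<lambda>x. t *\<^sub>R b x + p x | t p. p \<in> lin_span B}"
  then obtain t c where f: "f = (\<lambda>x. t *\<^sub>R b x + (\<Sum>b\<in>B. c b *\<^sub>R b x))" by (auto simp: lin_span_def)
  have "(\<Sum>b'\<in>B. (c(b := t)) b' *\<^sub>R b' x) = (\<Sum>b'\<in>B. c b' *\<^sub>R b' x)" for x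
    using assms(2) by (intro sum.cong) auto
  then have "f = (\<lambda>x. \<Sum>b'\<in>insert b B. (c(b := t)) b' *\<^sub>R b' x)" using assms by (simp add: f)
  then show "f \<in> lin_span (insert b B)" by (rule lin_spanI)
qed

lemma lin_span_lincomb:
  assumes "p \<in> lin_span B" "q \<in> lin_span B" shows "(\<lambda>x. t *\<^sub>R p x + q x) \<in> lin_span B"
proof -
  obtain c d where "p = (\<lambda>x. \<Sum>b\<in>B. c b *\<^sub>R b x)" "q = (\<lambda>x. \<Sum>b\<in>B. d b *\<^sub>R b x)"
    using assms by (auto simp: lin_span_def)
  then have "(\<lambda>x. t *\<^sub>R p x + q x) = (\<lambda>x. \<Sum>b\<in>B. (t * c b + d b) *\<^sub>R b x)"
    by (simp add: scaleR_sum_right sum.distrib scaleR_left_distrib)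
  then show ?thesis by (rule lin_spanI)
qed

lemma lin_span_superset:
  assumes "finite B" shows "B \<subseteq> lin_span B"
proof
  fix b assume "b \<in> B"
  then have "b = (\<lambda>x. \<Sum>b'\<in>B. (if b' = b then 1 else 0) *\<^sub>R b' x)"
    using assms by (auto simp: if_distrib[of "\<lambda>t. t *\<^sub>R _"] cong: if_cong)
  then show "b \<in> lin_span B" by (rule lin_spanI)
qed

text \<open>The form may be degenerate: functions enter only up to null sets, and the gradient form vanishes
  on constants.\<close>

locale semi_inner_space =
  fixes X :: "('x \<Rightarrow> 'b::real_vector) set" and a :: "('x \<Rightarrow> 'b) \<Rightarrow> ('x \<Rightarrow> 'b) \<Rightarrow> real"
  assumes zero: "(\<lambda>x. 0) \<in> X"
    and lincomb: "p \<in> X \<Longrightarrow> q \<in> X \<Longrightarrow> (\<lambda>x. t *\<^sub>R p x + q x) \<in> X"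
    and form_lincomb: "p \<in> X \<Longrightarrow> q \<in> X \<Longrightarrow> r \<in> X \<Longrightarrow> a (\<lambda>x. t *\<^sub>R p x + q x) r = t * a p r + a q r"
    and form_commute: "p \<in> X \<Longrightarrow> q \<in> X \<Longrightarrow> a p q = a q p"
    and form_nonneg: "p \<in> X \<Longrightarrow> 0 \<le> a p p"
begin

lemma form_lincomb_right:
  "p \<in> X \<Longrightarrow> q \<in> X \<Longrightarrow> r \<in> X \<Longrightarrow> a r (\<lambda>x. t *\<^sub>R p x + q x) = t * a r p + a r q"
  using form_lincomb[of p q r t] form_commute lincomb by metis

lemma form_lincomb_self:
  assumes "p \<in> X" "q \<in> X"
  shows "a (\<lambda>x. t *\<^sub>R p x + q x) (\<lambda>x. t *\<^sub>R p x + q x) = t\<^sup>2 * a p p + 2 * t * a p q + a q q"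
  using form_lincomb[OF assms lincomb[OF assms]] form_lincomb_right[OF assms] form_commute[OF assms] assms
  by (simp add: power2_eq_square algebra_simps)

lemma Cauchy_Schwarz:
  assumes p: "p \<in> X" and q: "q \<in> X" shows "(a p q)\<^sup>2 \<le> a p p * a q q"
proof (cases "a p p = 0")
  case True
  have nn: "0 \<le> 2 * t * a p q + a q q" for t
    using form_nonneg[OF lincomb[OF p q, of t]] form_lincomb_self[OF p q, of t] True by simp
  have "a p q = 0"
  proof (rule ccontr)
    assume "a p q \<noteq> 0"
    \<comment> \<open>The linear function \<open>2 t a p q + a q q\<close> takes the value \<open>- 1\<close> at this \<open>t\<close>.\<close>
    then show False using nn[of "- (a q q + 1) / (2 * a p q)"] by (simp add: field_simps)
  qed
  then show ?thesis using True by simp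
next
  case False
  then have pos: "a p p > 0" using form_nonneg[OF p] by simp
  have "0 \<le> (- (a p q / a p p))\<^sup>2 * a p p + 2 * (- (a p q / a p p)) * a p q + a q q"
    using form_nonneg[OF lincomb[OF p q]] form_lincomb_self[OF p q] by metis
  also have "\<dots> = a q q - (a p q)\<^sup>2 / a p p"
    using False by (simp add: field_simps power2_eq_square)
  finally show ?thesis using pos by (simp add: field_simps)
qed

lemma form_kernel: "p \<in> X \<Longrightarrow> q \<in> X \<Longrightarrow> a p p = 0 \<Longrightarrow> a p q = 0"
  using Cauchy_Schwarz[of p q] by simp

lemma lin_span_subset: "finite C \<Longrightarrow> C \<subseteq> X \<Longrightarrow> lin_span C \<subseteq> X"
proof (induction rule: finite_induct)
  case empty then show ?case using zero by (auto simp: lin_span_def)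
next
  case (insert b C)
  then show ?case by (auto simp: lin_span_insert intro: lincomb)
qed

text \<open>Induction on the generating set by a Gram-Schmidt step. The part \<open>d\<close> of a new generator that is
  orthogonal to the old span is obtained from the induction hypothesis itself, applied to the
  functional \<open>a b\<close>. If \<open>a d d = 0\<close>, then \<open>F d = 0\<close> as well, and the coefficient \<open>k\<close> is \<open>0\<close>
  by the convention for division by zero.\<close>

lemma riesz_representation:
  assumes "finite C" "C \<subseteq> X"
    and "\<And>p q t. p \<in> X \<Longrightarrow> q \<in> X \<Longrightarrow> F (\<lambda>x. t *\<^sub>R p x + q x) = t * F p + F q"
    and "\<And>p. p \<in> X \<Longrightarrow> a p p = 0 \<Longrightarrow> F p = 0"
  shows "\<exists>\<nu>\<in>lin_span C. \<forall>q\<in>lin_span C. a \<nu> q = F q"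
  using assms
proof (induction C arbitrary: F rule: finite_induct)
  case empty
  have "a (\<lambda>x. 0) (\<lambda>x. 0) = 0" using form_lincomb[OF zero zero zero, of 1] by simp
  then show ?case using empty(3)[OF zero] by (auto simp: lin_span_def)
next
  case (insert b C)
  have bX: "b \<in> X" and CX: "C \<subseteq> X" and SX: "lin_span C \<subseteq> X"
    using insert lin_span_subset by auto
  obtain \<nu> where \<nu>: "\<nu> \<in> lin_span C" "\<And>q. q \<in> lin_span C \<Longrightarrow> a \<nu> q = F q"
  proof -
    have "\<exists>\<nu>\<in>lin_span C. \<forall>q\<in>lin_span C. a \<nu> q = F q"
      by (rule insert.IH[OF CX]) (auto intro: insert.prems(2,3))
    then show thesis using that by blast
  qed
  \<comment> \<open>\<open>p\<close> is an orthogonal projection of \<open>b\<close> onto the span of \<open>C\<close>.\<close>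
  obtain p where p: "p \<in> lin_span C" "\<And>q. q \<in> lin_span C \<Longrightarrow> a p q = a b q"
  proof -
    have "\<exists>\<nu>\<in>lin_span C. \<forall>q\<in>lin_span C. a \<nu> q = a b q"
    proof (rule insert.IH[OF CX])
      show "a b q = 0" if "q \<in> X" "a q q = 0" for q
        using form_kernel[OF that(1) bX that(2)] form_commute[OF that(1) bX] by simp
    qed (auto intro: form_lincomb_right bX)
    then show thesis using that by blast
  qed
  define d where "d = (\<lambda>x. (-1) *\<^sub>R p x + b x)"
  have dX: "d \<in> X" unfolding d_def using p(1) SX bX by (intro lincomb) auto
  have b_eq: "b = (\<lambda>x. 1 *\<^sub>R p x + d x)" by (simp add: d_def)
  have orth: "a d q = 0" if "q \<in> lin_span C" for q
    using form_lincomb[of p b q "-1"] p that SX bX by (auto simp: d_def)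
  have dd: "a d b = a d d"
    using orth[OF p(1)] form_lincomb_right[of p d d 1] p(1) SX dX by (subst b_eq) auto
  have Fd: "F d = F b - a \<nu> b + a \<nu> d"
  proof -
    have "F b = F p + F d" using insert.prems(2)[of p d 1] p(1) SX dX by (subst b_eq) auto
    moreover have "a \<nu> b = a \<nu> p + a \<nu> d"
      using form_lincomb_right[of p d \<nu> 1] p(1) SX dX \<nu>(1) by (subst b_eq) auto
    ultimately show ?thesis using \<nu>(2)[OF p(1)] by simp
  qed
  have \<nu>d: "a \<nu> d = 0" using orth[OF \<nu>(1)] form_commute \<nu>(1) SX dX by auto
  define k where "k = F d / a d d"
  have k: "k * a d d = F d" using insert.prems(3)[OF dX] by (auto simp: k_def)
  define \<eta> where "\<eta> = (\<lambda>x. k *\<^sub>R d x + \<nu> x)"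
  have "\<eta> \<in> lin_span (insert b C)"
  proof -
    have "(\<lambda>x. (-k) *\<^sub>R p x + \<nu> x) \<in> lin_span C" using lin_span_lincomb p(1) \<nu>(1) by blast
    moreover have "\<eta> = (\<lambda>x. k *\<^sub>R b x + ((-k) *\<^sub>R p x + \<nu> x))"
      by (simp add: \<eta>_def d_def algebra_simps)
    ultimately show ?thesis unfolding lin_span_insert[OF insert(1,2)] by (intro CollectI exI conjI)
  qed
  moreover have "a \<eta> q = F q" if "q \<in> lin_span (insert b C)" for q
  proof -
    have "\<exists>t r. q = (\<lambda>x. t *\<^sub>R b x + r x) \<and> r \<in> lin_span C"
      using that by (simp only: lin_span_insert[OF insert(1,2)] mem_Collect_eq)
    then obtain t r where q: "q = (\<lambda>x. t *\<^sub>R b x + r x)" and r: "r \<in> lin_span C"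
      by (elim exE conjE) (rule that)
    have rX: "r \<in> X" using r SX by auto
    have \<nu>X: "\<nu> \<in> X" using \<nu>(1) SX by auto
    have \<eta>X: "\<eta> \<in> X" unfolding \<eta>_def using dX \<nu>X by (rule lincomb)
    have "a \<eta> q = t * a \<eta> b + a \<eta> r"
      unfolding q by (rule form_lincomb_right[OF bX rX \<eta>X])
    also have "a \<eta> b = F b"
      using form_lincomb[OF dX \<nu>X bX, of k] dd Fd \<nu>d k by (simp add: \<eta>_def)
    also have "a \<eta> r = F r"
      using form_lincomb[OF dX \<nu>X rX, of k] orth[OF r] \<nu>(2)[OF r] by (simp add: \<eta>_def)
    finally show ?thesis using insert.prems(2)[OF bX rX] q by simp
  qed
  ultimately show ?case by blast
qed

end

section \<open>Finite element spaces\<close>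

lemma finite_element_space_lincomb:
  assumes "finite_element_space \<Omega> X" "p \<in> X" "q \<in> X"
  shows "(\<lambda>x. t *\<^sub>R p x + q x) \<in> X"
proof -
  obtain B where "X = lin_span B" using assms(1) by (auto simp: finite_element_space_def lin_span_def)
  with assms(2,3) lin_span_lincomb show ?thesis by blast
qed

lemma finite_element_space_zero:
  assumes "finite_element_space \<Omega> X" shows "(\<lambda>x. 0) \<in> X"
proof -
  obtain B where B: "X = lin_span B" using assms(1) by (auto simp: finite_element_space_def lin_span_def)
  show ?thesis unfolding B by (rule lin_spanI[where c = "\<lambda>_. 0"]) simp
qed

text \<open>Each cell is bounded, so a polynomial is bounded on it, and there are finitely many cells.\<close>

lemma finite_element_space_bounded:
  fixes f :: "'a::euclidean_space \<Rightarrow> 'b::euclidean_space"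
  assumes fe: "finite_element_space \<Omega> X" and f: "f \<in> X" and \<Omega>: "bounded \<Omega>" "open \<Omega>"
  shows "\<exists>M. AE x in lebesgue_on \<Omega>. norm (f x) \<le> M"
proof -
  obtain \<T> where T: "mesh \<Omega> \<T>" "piecewise_polynomial \<T> f"
    using fe f by (auto simp: finite_element_space_def)
  have "\<exists>M. \<forall>x\<in>K. norm (f x) \<le> M" if K: "K \<in> \<T>" for K
  proof -
    obtain p where p: "polynomial_function p" "\<forall>x\<in>K. f x = p x"
      using T(2) K by (auto simp: piecewise_polynomial_def)
    have "bounded K" using T(1) K \<Omega> by (auto simp: mesh_def intro: bounded_subset)
    then have "compact (p ` closure K)"
      using p(1) by (intro compact_continuous_image continuous_on_polymonial_function) auto
    then obtain M where "\<forall>y\<in>p ` closure K. norm y \<le> M" using compact_imp_bounded bounded_iff by blast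
    then show ?thesis using p(2) closure_subset by (metis image_eqI subsetD)
  qed
  then obtain M where M: "\<And>K x. K \<in> \<T> \<Longrightarrow> x \<in> K \<Longrightarrow> norm (f x) \<le> M K" by metis
  have "AE x in lebesgue_on \<Omega>. norm (f x) \<le> (\<Sum>K\<in>\<T>. \<bar>M K\<bar>)"
  proof (rule AE_lebesgue_on_negligible)
    show "\<Omega> \<in> sets lebesgue" using \<Omega> by simp
    show "negligible (\<Omega> - \<Union>\<T>)" using T by (simp add: mesh_def)
    fix x assume "x \<in> \<Omega> - (\<Omega> - \<Union>\<T>)"
    then obtain K where K: "K \<in> \<T>" "x \<in> K" by auto
    have "norm (f x) \<le> \<bar>M K\<bar>" using M[OF K] by simp
    also have "\<dots> \<le> (\<Sum>K\<in>\<T>. \<bar>M K\<bar>)"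
      using T(1) K by (intro member_le_sum) (auto simp: mesh_def)
    finally show "norm (f x) \<le> (\<Sum>K\<in>\<T>. \<bar>M K\<bar>)" .
  qed
  then show ?thesis ..
qed

section \<open>Convex potentials and quadratic bounds\<close>

lemma convex_deriv_tangent:
  fixes \<Psi> :: "real \<Rightarrow> real"
  assumes "convex_on UNIV \<Psi>" "\<And>a. \<Psi> differentiable at a"
  shows "deriv \<Psi> a * (b - a) \<le> \<Psi> b - \<Psi> a"
  by (rule convex_on_imp_above_tangent[OF assms(1)])
     (use assms(2) in \<open>auto simp: DERIV_deriv_iff_real_differentiable\<close>)

lemma convex_deriv_mono:
  fixes \<Psi> :: "real \<Rightarrow> real"
  assumes "convex_on UNIV \<Psi>" "\<And>a. \<Psi> differentiable at a"
  shows "mono (deriv \<Psi>)"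
proof
  fix a b :: real assume ab: "a \<le> b"
  have "deriv \<Psi> a * (b - a) \<le> deriv \<Psi> b * (b - a)"
    using convex_deriv_tangent[OF assms, of a b] convex_deriv_tangent[OF assms, of b a]
    by (simp add: algebra_simps)
  then show "deriv \<Psi> a \<le> deriv \<Psi> b" using ab by (cases "a = b") (auto simp: mult_le_cancel_right)
qed

text \<open>By the mean value theorem the remainder is \<open>(\<Psi>' z - \<Psi>' a) (b - a)\<close> for some \<open>z\<close> between \<open>a\<close> and
  \<open>b\<close>. As \<open>z - a\<close> and \<open>b - a\<close> have the same sign, the one-sided bound applies.\<close>

lemma deriv_one_sided_Lipschitz_imp_quadratic_bound:
  fixes \<Psi> :: "real \<Rightarrow> real"
  assumes diff: "\<And>a. \<Psi> differentiable at a"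
    and lip: "\<And>a b. (deriv \<Psi> a - deriv \<Psi> b) * (a - b) \<le> L * (a - b)\<^sup>2"
  shows "\<Psi> b - \<Psi> a - deriv \<Psi> a * (b - a) \<le> \<bar>L\<bar> * (b - a)\<^sup>2"
proof (cases "a = b")
  case False
  have D: "\<And>x. DERIV \<Psi> x :> deriv \<Psi> x" using diff by (simp add: DERIV_deriv_iff_real_differentiable)
  obtain z where z: "\<Psi> b - \<Psi> a = (b - a) * deriv \<Psi> z" "z \<noteq> a" "\<bar>z - a\<bar> \<le> \<bar>b - a\<bar>" "(z - a) * (b - a) \<ge> 0"
  proof (cases "a < b")
    case True
    then obtain z where z: "a < z" "z < b" "\<Psi> b - \<Psi> a = (b - a) * deriv \<Psi> z" using MVT2[of a b \<Psi> "deriv \<Psi>"] D by metis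
    moreover have "0 \<le> (z - a) * (b - a)" using z by (intro mult_nonneg_nonneg) auto
    ultimately show thesis by (intro that[of z]) auto
  next
    case False
    then have "b < a" using \<open>a \<noteq> b\<close> by simp
    then obtain z where z: "b < z" "z < a" "\<Psi> a - \<Psi> b = (a - b) * deriv \<Psi> z" using MVT2[of b a \<Psi> "deriv \<Psi>"] D by metis
    have "\<Psi> b - \<Psi> a = (b - a) * deriv \<Psi> z" using z(3) by (simp add: algebra_simps)
    moreover have "0 \<le> (z - a) * (b - a)" using z by (intro mult_nonpos_nonpos) auto
    ultimately show thesis using z by (intro that[of z]) auto
  qed
  have *: "(deriv \<Psi> z - deriv \<Psi> a) * (z - a) \<le> \<bar>L\<bar> * (z - a)\<^sup>2"
    using lip[of z a] mult_right_mono[OF abs_ge_self[of L], of "(z - a)\<^sup>2"] by simp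
  have le: "(deriv \<Psi> z - deriv \<Psi> a) * sgn (z - a) \<le> \<bar>L\<bar> * \<bar>z - a\<bar>"
  proof (cases "z > a")
    case True then show ?thesis using * by (simp add: power2_eq_square mult_le_cancel_right)
  next
    case False
    then have "\<bar>L\<bar> * (z - a) \<le> deriv \<Psi> z - deriv \<Psi> a"
      using * z(2) by (simp add: power2_eq_square mult_le_cancel_right flip: mult.assoc)
    then show ?thesis using False z(2) by (simp add: right_diff_distrib)
  qed
  have sg: "b - a = sgn (z - a) * \<bar>b - a\<bar>"
    using z(2,4) by (cases "z > a") (auto simp: zero_le_mult_iff)
  have "\<Psi> b - \<Psi> a - deriv \<Psi> a * (b - a) = (deriv \<Psi> z - deriv \<Psi> a) * (b - a)"
    using z(1) by (simp add: algebra_simps)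
  also have "\<dots> = (deriv \<Psi> z - deriv \<Psi> a) * sgn (z - a) * \<bar>b - a\<bar>"
    by (subst sg) simp
  also have "\<dots> \<le> \<bar>L\<bar> * \<bar>z - a\<bar> * \<bar>b - a\<bar>" by (rule mult_right_mono[OF le]) simp
  also have "\<dots> \<le> \<bar>L\<bar> * \<bar>b - a\<bar> * \<bar>b - a\<bar>"
    using z(3) by (intro mult_right_mono mult_left_mono) auto
  finally show ?thesis by (simp add: power2_eq_square mult.assoc)
qed simp

lemma quadratic_nonneg_imp_linear_zero:
  fixes D K :: real
  assumes "\<And>t. 0 \<le> t * D + t\<^sup>2 * K" shows "D = 0"
proof (rule ccontr)
  assume D: "D \<noteq> 0"
  \<comment> \<open>A step against the slope, so short that \<open>t\<^sup>2 \<bar>K\<bar> < \<bar>t D\<bar>\<close>.\<close>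
  define t where "t = - D / (\<bar>K\<bar> + 1)"
  have "t * D + t\<^sup>2 * K \<le> t * D + t\<^sup>2 * \<bar>K\<bar>" by (simp add: mult_left_mono)
  also have "\<dots> = - (D\<^sup>2 / (\<bar>K\<bar> + 1)\<^sup>2)"
    by (simp add: t_def divide_simps power2_eq_square) (simp add: algebra_simps)
  also have "\<dots> < 0" using D by simp
  finally show False using assms[of t] by simp
qed

section \<open>The mobility form and the discrete dual norm\<close>

text \<open>The setting in which the discrete dual norm can be computed.\<close>

locale phase_space =
  fixes \<Omega> :: "(real ^ 'd) set" and Q :: "(real ^ 'd \<Rightarrow> real) set" and m :: real
  assumes open_domain: "open \<Omega>" and bounded_domain: "bounded \<Omega>"
    and connected_domain: "connected \<Omega>" and domain_nonempty: "\<Omega> \<noteq> {}"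
    and Q_fe: "finite_element_space \<Omega> Q" and Q_H1: "Q \<subseteq> H1_space \<Omega>"
    and Q_const: "\<And>c. \<exists>q\<in>Q. \<forall>x\<in>\<Omega>. q x = c"
    and m_pos: "m > 0"
begin

abbreviation M where "M \<equiv> lebesgue_on \<Omega>"

definition mobility_form :: "(real ^ 'd \<Rightarrow> real) \<Rightarrow> (real ^ 'd \<Rightarrow> real) \<Rightarrow> real" where
  "mobility_form p q = l2_inner \<Omega> (\<lambda>x. m *\<^sub>R weak_grad \<Omega> p x) (weak_grad \<Omega> q)"

lemma domain_lmeasurable: "\<Omega> \<in> lmeasurable"
  using open_domain bounded_domain by (simp add: lmeasurable_open)

sublocale finite_measure M
  using domain_lmeasurable by (rule finite_measure_lebesgue_on)

lemma volume_pos: "measure lebesgue \<Omega> > 0"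
  using open_not_negligible[OF open_domain domain_nonempty] domain_lmeasurable
  by (metis negligible_iff_measure measure_nonneg order_less_le)

lemma integral_const: "(\<integral>x. c \<partial>M) = c * measure lebesgue \<Omega>"
  by (simp add: measure_restrict_space domain_lmeasurable fmeasurableD)

lemma Q_lincomb: "p \<in> Q \<Longrightarrow> q \<in> Q \<Longrightarrow> (\<lambda>x. t * p x + q x) \<in> Q"
  using finite_element_space_lincomb[OF Q_fe, of p q t] by simp

lemma Q_L2: "q \<in> Q \<Longrightarrow> q \<in> L2_space \<Omega>"
  using Q_H1 H1_L2 by blast

lemma grad_Q_L2: "q \<in> Q \<Longrightarrow> weak_grad \<Omega> q \<in> L2_space \<Omega>"
  using Q_H1 weak_grad_L2 by blast

lemma L2_integrable: "f \<in> L2_space \<Omega> \<Longrightarrow> integrable M f"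
  by (rule L2_imp_integrable[OF bounded_domain open_domain])

lemma grad_lincomb:
  assumes "p \<in> Q" "q \<in> Q"
  shows "AE x in M. weak_grad \<Omega> (\<lambda>x. t * p x + q x) x = t *\<^sub>R weak_grad \<Omega> p x + weak_grad \<Omega> q x"
  using assms Q_H1 by (intro weak_grad_lincomb[OF open_domain bounded_domain]) auto

lemma l2_inner_grad_lincomb:
  assumes "p \<in> Q" "q \<in> Q" "g \<in> L2_space \<Omega>"
  shows "l2_inner \<Omega> (weak_grad \<Omega> (\<lambda>x. t * p x + q x)) g
       = t * l2_inner \<Omega> (weak_grad \<Omega> p) g + l2_inner \<Omega> (weak_grad \<Omega> q) g"
proof -
  have "l2_inner \<Omega> (weak_grad \<Omega> (\<lambda>x. t * p x + q x)) g
      = l2_inner \<Omega> (\<lambda>x. t *\<^sub>R weak_grad \<Omega> p x + weak_grad \<Omega> q x) g"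
    using assms by (intro l2_inner_cong_AE grad_lincomb grad_Q_L2 Q_lincomb L2_space_lincomb) auto
  then show ?thesis using assms by (simp add: l2_inner_lincomb_left grad_Q_L2)
qed

lemma mobility_form_eq: "mobility_form p q = m * l2_inner \<Omega> (weak_grad \<Omega> p) (weak_grad \<Omega> q)"
  by (simp add: mobility_form_def l2_inner_def)

sublocale semi_inner_space Q mobility_form
proof
  show "(\<lambda>x. 0) \<in> Q" by (rule finite_element_space_zero[OF Q_fe])
  fix p q r t assume "p \<in> Q" "q \<in> Q"
  then show "(\<lambda>x. t *\<^sub>R p x + q x) \<in> Q" using Q_lincomb by simp
  assume "r \<in> Q"
  then show "mobility_form (\<lambda>x. t *\<^sub>R p x + q x) r = t * mobility_form p r + mobility_form q r"
    using l2_inner_grad_lincomb[OF \<open>p \<in> Q\<close> \<open>q \<in> Q\<close> grad_Q_L2] by (simp add: mobility_form_eq algebra_simps)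
qed (use m_pos in \<open>auto simp: mobility_form_eq l2_inner_commute l2_inner_self_nonneg\<close>)

text \<open>Membership in \<open>Q\<close> is a statement about functions on the whole space, so the constant \<open>1\<close> itself
  need not belong to \<open>Q\<close>; only a function that agrees with it on \<open>\<Omega>\<close> does.\<close>

definition one :: "real ^ 'd \<Rightarrow> real" where
  "one = (SOME q. q \<in> Q \<and> (\<forall>x\<in>\<Omega>. q x = 1))"

lemma one: "one \<in> Q" "x \<in> \<Omega> \<Longrightarrow> one x = 1"
  using someI_ex[of "\<lambda>q. q \<in> Q \<and> (\<forall>x\<in>\<Omega>. q x = 1)"] Q_const[of 1] unfolding one_def by blast+

lemma grad_AE_const:
  assumes "q \<in> Q" "AE x in M. q x = c"
  shows "AE x in M. weak_grad \<Omega> q x = 0"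
proof (rule weak_gradient_unique[OF open_domain bounded_domain])
  show "has_weak_gradient \<Omega> q (weak_grad \<Omega> q)"
    using weak_grad_has_weak_gradient assms(1) Q_H1 by blast
  show "has_weak_gradient \<Omega> q (\<lambda>_. 0)"
    by (rule has_weak_gradient_const[OF open_domain bounded_domain Q_L2[OF assms(1)] assms(2)])
qed

lemma l2_inner_grad_AE_const:
  assumes "q \<in> Q" "AE x in M. q x = c"
  shows "l2_inner \<Omega> g (weak_grad \<Omega> q) = 0"
proof -
  have "AE x in M. g x \<bullet> weak_grad \<Omega> q x = 0" using grad_AE_const[OF assms] by eventually_elim simp
  then show ?thesis unfolding l2_inner_def by (rule integral_eq_zero_AE)
qed

lemma mobility_form_AE_const: "q \<in> Q \<Longrightarrow> AE x in M. q x = c \<Longrightarrow> mobility_form p q = 0"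
  by (simp add: mobility_form_def l2_inner_grad_AE_const)

lemma mobility_form_one: "mobility_form p one = 0"
  by (rule mobility_form_AE_const[OF one(1), of 1]) (auto intro!: AE_I2 one)

lemma l2_inner_one: "l2_inner \<Omega> g one = (\<integral>x. g x \<partial>M)"
  unfolding l2_inner_def by (rule Bochner_Integration.integral_cong) (auto simp: one)

text \<open>A function with \<open>(m \<nabla>q, \<nabla>q) = 0\<close> has zero weak gradient, and \<open>\<Omega>\<close> is connected.\<close>

lemma mobility_form_kernel_constant:
  assumes q: "q \<in> Q" and 0: "mobility_form q q = 0"
  obtains c where "AE x in M. q x = c"
proof -
  have "l2_inner \<Omega> (weak_grad \<Omega> q) (weak_grad \<Omega> q) = 0" using 0 m_pos by (simp add: mobility_form_eq)
  then have g0: "AE x in M. weak_grad \<Omega> q x = 0" using l2_inner_self_eq_0 grad_Q_L2[OF q] by blast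
  have w: "has_weak_gradient \<Omega> q (weak_grad \<Omega> q)" using weak_grad_has_weak_gradient q Q_H1 by blast
  have zero: "(\<integral>x. q x *\<^sub>R D x \<partial>M) = 0" if "test_function \<Omega> \<phi>" "\<And>x. GDERIV \<phi> x :> D x" for \<phi> D
  proof -
    have "(\<integral>x. q x *\<^sub>R D x \<partial>M) = - (\<integral>x. \<phi> x *\<^sub>R weak_grad \<Omega> q x \<partial>M)"
      using w that by (simp add: has_weak_gradient_def)
    also have "(\<integral>x. \<phi> x *\<^sub>R weak_grad \<Omega> q x \<partial>M) = 0"
      by (rule integral_eq_zero_AE) (use g0 in eventually_elim, simp)
    finally show ?thesis by simp
  qed
  show thesis
    by (rule zero_weak_gradient_imp_constant[OF open_domain connected_domain L2_integrable[OF Q_L2[OF q]] zero])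
       (auto intro: that)
qed

lemma l2_inner_const_right:
  assumes "g \<in> L2_space \<Omega>" "q \<in> L2_space \<Omega>" "AE x in M. q x = c"
  shows "l2_inner \<Omega> g q = c * (\<integral>x. g x \<partial>M)"
proof -
  have "l2_inner \<Omega> g q = (\<integral>x. c * g x \<partial>M)"
    unfolding l2_inner_def
  proof (rule integral_cong_AE)
    show "AE x in M. g x \<bullet> q x = c * g x" using assms(3) by eventually_elim simp
    show "(\<lambda>x. g x \<bullet> q x) \<in> borel_measurable M" using L2_inner_integrable[OF assms(1,2)] by auto
    show "(\<lambda>x. c * g x) \<in> borel_measurable M" using L2_integrable[OF assms(1)] by auto
  qed
  then show ?thesis by simp
qed

text \<open>A source with mean zero annihilates the kernel of the mobility form, so it has a representative,
  even with respect to all of \<open>Q\<close> instead of the mean-zero functions.\<close>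

lemma discrete_inverse_laplacian:
  assumes g: "g \<in> L2_space \<Omega>" and mean: "(\<integral>x. g x \<partial>M) = 0"
  obtains \<nu> where "\<nu> \<in> Q" "\<And>q. q \<in> Q \<Longrightarrow> mobility_form \<nu> q = l2_inner \<Omega> g q"
proof -
  obtain B where B: "finite B" "Q = lin_span B"
    using Q_fe by (auto simp: finite_element_space_def lin_span_def)
  have "\<exists>\<nu>\<in>lin_span B. \<forall>q\<in>lin_span B. mobility_form \<nu> q = l2_inner \<Omega> g q"
  proof (rule riesz_representation)
    show "finite B" "B \<subseteq> Q" using B lin_span_superset by auto
    show "l2_inner \<Omega> g (\<lambda>x. t *\<^sub>R p x + q x) = t * l2_inner \<Omega> g p + l2_inner \<Omega> g q"
      if "p \<in> Q" "q \<in> Q" for p q t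
      using that g Q_L2 by (intro l2_inner_lincomb_right) auto
    show "l2_inner \<Omega> g p = 0" if "p \<in> Q" "mobility_form p p = 0" for p
    proof -
      obtain c where "AE x in M. p x = c" using mobility_form_kernel_constant[OF \<open>p \<in> Q\<close> \<open>mobility_form p p = 0\<close>] by metis
      then show ?thesis using l2_inner_const_right[OF g Q_L2[OF \<open>p \<in> Q\<close>]] mean by simp
    qed
  qed
  then show thesis using that B(2) by blast
qed

lemma mean_zero_part:
  assumes q: "q \<in> Q"
  obtains c where "(\<lambda>x. - c * one x + q x) \<in> mean_zero_subspace \<Omega> Q"
proof -
  define c where "c = (\<integral>x. q x \<partial>M) / measure lebesgue \<Omega>"
  have "(\<integral>x. - c * one x + q x \<partial>M) = - c * (\<integral>x. one x \<partial>M) + (\<integral>x. q x \<partial>M)"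
    using L2_integrable[OF Q_L2[OF q]] L2_integrable[OF Q_L2[OF one(1)]] by simp
  also have "(\<integral>x. one x \<partial>M) = (\<integral>x. 1 \<partial>M)"
    by (rule Bochner_Integration.integral_cong) (auto simp: one)
  also have "\<dots> = measure lebesgue \<Omega>" using integral_const[of 1] by simp
  finally have "(\<integral>x. - c * one x + q x \<partial>M) = 0"
    using volume_pos by (simp add: c_def)
  with q one(1) show thesis
    using Q_lincomb[of one q "- c"] by (intro that[of c]) (simp add: mean_zero_subspace_def)
qed

lemma hm_norm_eq: "hm_norm \<Omega> m q = sqrt (mobility_form q q)"
proof -
  have "l2_inner \<Omega> (\<lambda>x. sqrt m *\<^sub>R weak_grad \<Omega> q x) (\<lambda>x. sqrt m *\<^sub>R weak_grad \<Omega> q x)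
      = (\<integral>x. m * (weak_grad \<Omega> q x \<bullet> weak_grad \<Omega> q x) \<partial>M)"
    using m_pos by (simp add: l2_inner_def flip: mult.assoc)
  then show ?thesis by (simp add: hm_norm_def l2_norm_def mobility_form_eq l2_inner_def)
qed

text \<open>After subtracting its mean, \<open>\<nu>\<close> is itself a competitor in the supremum; it attains the bound given
  by the Cauchy-Schwarz inequality. If \<open>(m \<nabla>\<nu>, \<nabla>\<nu>) = 0\<close>, the supremum is the element \<open>0\<close> that the
  definition adds.\<close>

lemma dual_norm_eq:
  assumes \<nu>: "\<nu> \<in> Q" "\<And>q. q \<in> Q \<Longrightarrow> mobility_form \<nu> q = F q"
  shows "(dual_norm \<Omega> Q m F)\<^sup>2 = mobility_form \<nu> \<nu>"
proof -
  obtain c where c: "(\<lambda>x. - c * one x + \<nu> x) \<in> mean_zero_subspace \<Omega> Q"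
    using mean_zero_part[OF \<nu>(1)] by metis
  define \<nu>0 where "\<nu>0 = (\<lambda>x. - c * one x + \<nu> x)"
  have \<nu>0: "\<nu>0 \<in> Q" "\<nu>0 \<in> mean_zero_subspace \<Omega> Q"
    using c by (auto simp: \<nu>0_def mean_zero_subspace_def)
  have eq: "mobility_form \<nu>0 q = F q" if "q \<in> Q" for q
    using form_lincomb[OF one(1) \<nu>(1) that, of "- c"] mobility_form_one[of q] form_commute[OF one(1) that] \<nu>(2)[OF that]
    by (simp add: \<nu>0_def)
  have self: "mobility_form \<nu>0 \<nu>0 = mobility_form \<nu> \<nu>"
    using eq[OF \<nu>0(1)] eq[OF \<nu>(1)] \<nu>(2)[OF \<nu>(1)] \<nu>(2)[OF \<nu>0(1)] form_commute[OF \<nu>(1) \<nu>0(1)] by simp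
  let ?A = "insert 0 {F q / hm_norm \<Omega> m q | q.
      q \<in> mean_zero_subspace \<Omega> Q \<and> \<not> (AE x in M. q x = 0)}"
  have "Sup ?A = sqrt (mobility_form \<nu>0 \<nu>0)"
  proof (rule cSup_eq_maximum)
    show "sqrt (mobility_form \<nu>0 \<nu>0) \<in> ?A"
    proof (cases "mobility_form \<nu>0 \<nu>0 = 0")
      case False
      have "\<not> (AE x in M. \<nu>0 x = 0)"
      proof
        assume "AE x in M. \<nu>0 x = 0"
        from mobility_form_AE_const[OF \<nu>0(1) this] False show False by simp
      qed
      moreover have "F \<nu>0 / hm_norm \<Omega> m \<nu>0 = sqrt (mobility_form \<nu>0 \<nu>0)"
        using eq[OF \<nu>0(1)] form_nonneg[OF \<nu>0(1)] by (simp add: hm_norm_eq real_div_sqrt)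
      ultimately show ?thesis using \<nu>0(2) by (metis (mono_tags, lifting) insert_iff mem_Collect_eq)
    qed simp
    fix y assume "y \<in> ?A"
    then consider "y = 0" | q where "q \<in> Q" "y = F q / hm_norm \<Omega> m q"
      by (auto simp: mean_zero_subspace_def)
    then show "y \<le> sqrt (mobility_form \<nu>0 \<nu>0)"
    proof cases
      case 1 then show ?thesis using form_nonneg[OF \<nu>0(1)] by simp
    next
      case 2
      have "F q \<le> sqrt ((mobility_form \<nu>0 q)\<^sup>2)" using eq[OF 2(1)] by simp
      also have "\<dots> \<le> sqrt (mobility_form \<nu>0 \<nu>0 * mobility_form q q)"
        using Cauchy_Schwarz[OF \<nu>0(1) 2(1)] by (rule real_sqrt_le_mono)
      finally show ?thesis
        using 2 form_nonneg[OF 2(1)] form_nonneg[OF \<nu>0(1)]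
        by (cases "mobility_form q q = 0") (auto simp: hm_norm_eq real_sqrt_mult divide_le_eq)
    qed
  qed
  then have "dual_norm \<Omega> Q m F = sqrt (mobility_form \<nu> \<nu>)" by (simp add: dual_norm_def self)
  then show ?thesis using form_nonneg[OF \<nu>(1)] by simp
qed

lemma Q_measurable: "q \<in> Q \<Longrightarrow> q \<in> borel_measurable M"
  using L2_integrable[OF Q_L2] by blast

lemma Q_bounded: assumes "q \<in> Q" obtains B where "AE x in M. \<bar>q x\<bar> \<le> B"
  using finite_element_space_bounded[OF Q_fe assms bounded_domain open_domain] by auto

text \<open>Used for the derivatives of the convex potentials, where monotonicity supplies both
  measurability and local boundedness.\<close>

lemma mono_comp_Q:
  fixes g :: "real \<Rightarrow> real"
  assumes "mono g" "q \<in> Q"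
  shows "(\<lambda>x. g (q x)) \<in> borel_measurable M" "\<exists>B. AE x in M. \<bar>g (q x)\<bar> \<le> B"
proof -
  show "(\<lambda>x. g (q x)) \<in> borel_measurable M"
    using measurable_comp[OF Q_measurable[OF assms(2)] borel_measurable_mono[OF assms(1)]]
    by (simp add: comp_def)
  obtain B where B: "AE x in M. \<bar>q x\<bar> \<le> B" using Q_bounded[OF assms(2)] by metis
  have "AE x in M. \<bar>g (q x)\<bar> \<le> \<bar>g B\<bar> + \<bar>g (- B)\<bar>"
    using B
  proof eventually_elim
    case (elim x)
    then have "g (- B) \<le> g (q x)" "g (q x) \<le> g B" using monoD[OF assms(1)] by auto
    then show ?case by linarith
  qed
  then show "\<exists>B. AE x in M. \<bar>g (q x)\<bar> \<le> B" ..
qed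

lemma continuous_comp_Q:
  assumes "continuous_on UNIV g" "q \<in> Q"
  shows "(\<lambda>x. g (q x)) \<in> borel_measurable M" "\<exists>B::real. AE x in M. \<bar>g (q x)\<bar> \<le> B"
proof -
  show "(\<lambda>x. g (q x)) \<in> borel_measurable M"
    using measurable_comp[OF Q_measurable[OF assms(2)] borel_measurable_continuous_onI[OF assms(1)]]
    by (simp add: comp_def)
  obtain B where B: "AE x in M. \<bar>q x\<bar> \<le> B" using Q_bounded[OF assms(2)] by metis
  have "compact (g ` {- B..B})"
    using assms(1) by (intro compact_continuous_image) (auto elim: continuous_on_subset)
  then obtain C where "\<forall>y\<in>g ` {- B..B}. norm y \<le> C" using compact_imp_bounded bounded_iff by blast
  then have C: "\<bar>g y\<bar> \<le> C" if "\<bar>y\<bar> \<le> B" for y using that by (simp add: abs_le_iff)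
  from B have "AE x in M. \<bar>g (q x)\<bar> \<le> C" by eventually_elim (rule C)
  then show "\<exists>B. AE x in M. \<bar>g (q x)\<bar> \<le> B" ..
qed

lemma bounded_integrable:
  assumes "g \<in> borel_measurable M" "\<exists>B. AE x in M. \<bar>g x\<bar> \<le> (B::real)"
  shows "integrable M g"
  using assms integrable_bounded_mult[of M "\<lambda>_. 1" g] by auto

lemma bounded_L2:
  assumes "g \<in> borel_measurable M" "\<exists>B. AE x in M. \<bar>g x\<bar> \<le> (B::real)"
  shows "g \<in> L2_space \<Omega>"
proof -
  have "(\<lambda>_. 1::real) \<in> L2_space \<Omega>" by (simp add: L2_space_def)
  from L2_bounded_scaleR[OF assms(1) _ this] assms(2) show ?thesis by auto
qed

text \<open>The explicit elastic energy density is only integrable, being quadratic in the strain; pairing it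
  with \<open>q\<close> is possible because finite element functions are bounded.\<close>

lemma integrable_mult_Q:
  assumes h: "integrable M h" and q: "q \<in> Q" shows "integrable M (\<lambda>x. h x * q x)"
proof -
  obtain B where "AE x in M. \<bar>q x\<bar> \<le> B" using Q_bounded[OF q] by metis
  then show ?thesis by (rule integrable_bounded_mult[OF h Q_measurable[OF q]])
qed

lemma l2_inner_Q_lincomb:
  assumes "integrable M h" "p \<in> Q" "q \<in> Q"
  shows "l2_inner \<Omega> h (\<lambda>x. t * p x + q x) = t * l2_inner \<Omega> h p + l2_inner \<Omega> h q"
proof -
  have "l2_inner \<Omega> h (\<lambda>x. t * p x + q x) = (\<integral>x. t * (h x * p x) + h x * q x \<partial>M)"
    by (simp add: l2_inner_def algebra_simps)
  then show ?thesis using assms by (simp add: l2_inner_def integrable_mult_Q)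
qed

end

section \<open>Strain, stress and the convex energy\<close>

text \<open>Data of one time step. From the elasticity tensor the expansion of the energy uses that it induces an
  inner product; from \<open>\<Psi>\<^sub>c\<close> and \<open>\<Psi>\<^sub>e\<close>, that they are convex and that \<open>\<Psi>\<^sub>c'\<close> is one-sided Lipschitz.\<close>

locale fe_step = phase_space \<Omega> Q m
  for \<Omega> :: "(real ^ 'd) set" and Q :: "(real ^ 'd \<Rightarrow> real) set" and m :: real +
  fixes V :: "(real ^ 'd \<Rightarrow> real ^ 'd) set"
    and \<gamma> l \<tau> \<xi> :: real
    and R :: "real ^ 'd \<Rightarrow> real" and f :: "real ^ 'd \<Rightarrow> real ^ 'd"
    and \<Psi>\<^sub>c \<Psi>\<^sub>e :: "real \<Rightarrow> real" and L :: real
    and Cm Cp :: "'d tensor4" and \<pi> :: "real \<Rightarrow> real"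
    and \<phi>\<^sub>0 :: "real ^ 'd \<Rightarrow> real" and u\<^sub>0 :: "real ^ 'd \<Rightarrow> real ^ 'd"
  assumes V_fe: "finite_element_space \<Omega> V" and V_conf: "V \<subseteq> H1_0_fields \<Omega>"
    and params: "\<gamma> > 0" "l > 0" "\<tau> > 0"
    and R: "R \<in> L2_space \<Omega>" and f: "f \<in> L2_space \<Omega>"
    and Psi_c: "convex_on UNIV \<Psi>\<^sub>c" "\<And>a. \<Psi>\<^sub>c differentiable at a"
    and Psi_e: "convex_on UNIV \<Psi>\<^sub>e" "\<And>a. \<Psi>\<^sub>e differentiable at a"
    and Psi_c_lip: "\<And>a b. (deriv \<Psi>\<^sub>c a - deriv \<Psi>\<^sub>c b) * (a - b) \<le> L * (a - b)\<^sup>2"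
    and pi_C1: "\<And>a. \<pi> differentiable at a" "continuous_on UNIV (deriv \<pi>)"
    and C_inner: "\<And>s. s \<in> Linf_space \<Omega> \<Longrightarrow> inner_product_L2_sym \<Omega>
        (\<lambda>e w. l2_inner \<Omega> (\<lambda>x. blinfun_apply (elasticity_tensor Cm Cp \<pi> (s x)) (e x)) w)"
    and prev: "\<phi>\<^sub>0 \<in> Q" "u\<^sub>0 \<in> V"
begin

abbreviation strain where "strain \<equiv> elastic_strain \<Omega> \<xi>"

definition stress :: "(real ^ 'd \<Rightarrow> real ^ 'd ^ 'd) \<Rightarrow> real ^ 'd \<Rightarrow> real ^ 'd ^ 'd" where
  "stress e x = blinfun_apply (elasticity_tensor Cm Cp \<pi> (\<phi>\<^sub>0 x)) (e x)"

abbreviation explicit_source where "explicit_source \<equiv> elastic_expl \<Omega> \<xi> Cm Cp \<pi> \<phi>\<^sub>0 u\<^sub>0"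

lemma V_lincomb: "v \<in> V \<Longrightarrow> w \<in> V \<Longrightarrow> (\<lambda>x. t *\<^sub>R v x + w x) \<in> V"
  by (rule finite_element_space_lincomb[OF V_fe])

lemma V_component_H1: "v \<in> V \<Longrightarrow> (\<lambda>x. v x $ i) \<in> H1_space \<Omega>"
  using V_conf by (auto simp: H1_0_fields_def H1_0_space_def)

lemma jacobian_L2: assumes "v \<in> V" shows "weak_jacobian \<Omega> v \<in> L2_space \<Omega>"
proof (rule L2_vec)
  fix i
  have "(\<lambda>x. weak_jacobian \<Omega> v x $ i) = weak_grad \<Omega> (\<lambda>y. v y $ i)"
    by (simp add: weak_jacobian_def)
  then show "(\<lambda>x. weak_jacobian \<Omega> v x $ i) \<in> L2_space \<Omega>"
    using weak_grad_L2[OF V_component_H1[OF assms]] by simp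
qed

lemma jacobian_lincomb:
  assumes "v \<in> V" "w \<in> V"
  shows "AE x in M. weak_jacobian \<Omega> (\<lambda>x. t *\<^sub>R v x + w x) x = t *\<^sub>R weak_jacobian \<Omega> v x + weak_jacobian \<Omega> w x"
proof -
  have "AE x in M. weak_grad \<Omega> (\<lambda>y. t * v y $ i + w y $ i) x
      = t *\<^sub>R weak_grad \<Omega> (\<lambda>y. v y $ i) x + weak_grad \<Omega> (\<lambda>y. w y $ i) x" for i
    by (rule weak_grad_lincomb[OF open_domain bounded_domain]) (use assms V_component_H1 in auto)
  then have "AE x in M. \<forall>i. weak_grad \<Omega> (\<lambda>y. t * v y $ i + w y $ i) x
      = t *\<^sub>R weak_grad \<Omega> (\<lambda>y. v y $ i) x + weak_grad \<Omega> (\<lambda>y. w y $ i) x"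
    by (simp add: eventually_all_finite)
  then show ?thesis
    by eventually_elim (simp add: weak_jacobian_def vec_eq_iff)
qed

lemma sym_grad_L2: assumes "v \<in> V" shows "sym_grad \<Omega> v \<in> L2_space \<Omega>"
proof -
  have "(\<lambda>x. (1/2) *\<^sub>R weak_jacobian \<Omega> v x + (1/2) *\<^sub>R transpose (weak_jacobian \<Omega> v x)) \<in> L2_space \<Omega>"
    using jacobian_L2[OF assms] L2_bounded_linear[OF bounded_linear_transpose jacobian_L2[OF assms]]
    by (intro L2_space_lincomb L2_bounded_linear[OF bounded_linear_scaleR_right])
  moreover have "(\<lambda>x. (1/2) *\<^sub>R weak_jacobian \<Omega> v x + (1/2) *\<^sub>R transpose (weak_jacobian \<Omega> v x)) = sym_grad \<Omega> v"
    by (auto simp: sym_grad_def scaleR_add_right)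
  ultimately show ?thesis by simp
qed

lemma sym_grad_lincomb:
  assumes "v \<in> V" "w \<in> V"
  shows "AE x in M. sym_grad \<Omega> (\<lambda>x. t *\<^sub>R v x + w x) x = t *\<^sub>R sym_grad \<Omega> v x + sym_grad \<Omega> w x"
  using jacobian_lincomb[OF assms, of t]
proof eventually_elim
  case (elim x)
  have "transpose (a + b) = transpose a + transpose b" for a b :: "real ^ 'd ^ 'd"
    by (simp add: transpose_def vec_eq_iff)
  then show ?case unfolding sym_grad_def elim by (simp add: transpose_scalar algebra_simps)
qed

lemma sym_grad_sym: "transpose (sym_grad \<Omega> v x) = sym_grad \<Omega> v x"
  by (simp add: sym_grad_def transpose_def vec_eq_iff add.commute)

text \<open>The volumetric part, which turns the strain into a linear combination of square-integrable fields.\<close>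

definition pressure_tensor :: "(real ^ 'd \<Rightarrow> real) \<Rightarrow> real ^ 'd \<Rightarrow> real ^ 'd ^ 'd" where
  "pressure_tensor s x = s x *\<^sub>R mat 1"

lemma strain_eq: "strain s w = (\<lambda>x. (- \<xi>) *\<^sub>R pressure_tensor s x + sym_grad \<Omega> w x)"
  by (auto simp: elastic_strain_def pressure_tensor_def)

lemma pressure_tensor_L2: "s \<in> Q \<Longrightarrow> pressure_tensor s \<in> L2_space \<Omega>"
  unfolding pressure_tensor_def
  by (rule L2_bounded_linear[OF bounded_linear_scaleR_left Q_L2])

lemma strain_L2: "s \<in> Q \<Longrightarrow> w \<in> V \<Longrightarrow> strain s w \<in> L2_space \<Omega>"
  unfolding strain_eq by (intro L2_space_lincomb pressure_tensor_L2 sym_grad_L2)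

lemma strain_sym: "s \<in> Q \<Longrightarrow> w \<in> V \<Longrightarrow> strain s w \<in> L2_sym_tensors \<Omega>"
proof -
  have "transpose (strain s w x) = strain s w x" for x
  proof -
    have "transpose (strain s w x) = transpose (sym_grad \<Omega> w x) - transpose ((\<xi> * s x) *\<^sub>R mat 1)"
      unfolding elastic_strain_def by (simp add: transpose_def vec_eq_iff)
    then show ?thesis by (simp add: sym_grad_sym transpose_scalar elastic_strain_def)
  qed
  then show "s \<in> Q \<Longrightarrow> w \<in> V \<Longrightarrow> ?thesis" by (simp add: L2_sym_tensors_def strain_L2)
qed

lemma strain_lincomb:
  assumes "s \<in> Q" "q \<in> Q" "w \<in> V" "v \<in> V"
  shows "AE x in M. strain (\<lambda>x. t * q x + s x) (\<lambda>x. t *\<^sub>R v x + w x) x = t *\<^sub>R strain q v x + strain s w x"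
  using sym_grad_lincomb[OF assms(4,3), of t]
  by eventually_elim (simp add: elastic_strain_def algebra_simps)

lemma phi0_Linf: "\<phi>\<^sub>0 \<in> Linf_space \<Omega>"
  using Q_measurable[OF prev(1)] finite_element_space_bounded[OF Q_fe prev(1) bounded_domain open_domain]
  by (auto simp: Linf_space_def)

lemma stress_L2: assumes "e \<in> L2_space \<Omega>" shows "stress e \<in> L2_space \<Omega>"
proof -
  have "continuous_on UNIV \<pi>"
    using pi_C1(1) by (intro continuous_at_imp_continuous_on) (auto intro: differentiable_imp_continuous_within)
  from continuous_comp_Q[OF this prev(1)]
  obtain B where "(\<lambda>x. \<pi> (\<phi>\<^sub>0 x)) \<in> borel_measurable M" "AE x in M. \<bar>\<pi> (\<phi>\<^sub>0 x)\<bar> \<le> B" by blast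
  then have "(\<lambda>x. \<pi> (\<phi>\<^sub>0 x) *\<^sub>R blinfun_apply (Cp - Cm) (e x)) \<in> L2_space \<Omega>"
    by (rule L2_bounded_scaleR) (rule L2_bounded_linear[OF blinfun.bounded_linear_right assms])
  then have "(\<lambda>x. 1 *\<^sub>R blinfun_apply Cm (e x) + \<pi> (\<phi>\<^sub>0 x) *\<^sub>R blinfun_apply (Cp - Cm) (e x)) \<in> L2_space \<Omega>"
    by (intro L2_space_lincomb L2_bounded_linear[OF blinfun.bounded_linear_right assms])
  moreover have "stress e = (\<lambda>x. 1 *\<^sub>R blinfun_apply Cm (e x) + \<pi> (\<phi>\<^sub>0 x) *\<^sub>R blinfun_apply (Cp - Cm) (e x))"
    by (auto simp: stress_def elasticity_tensor_def blinfun.add_left blinfun.scaleR_left)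
  ultimately show ?thesis by simp
qed

definition elastic_form where "elastic_form e w = l2_inner \<Omega> (stress e) w"

lemma elastic_form_sym:
  "e \<in> L2_sym_tensors \<Omega> \<Longrightarrow> w \<in> L2_sym_tensors \<Omega> \<Longrightarrow> elastic_form e w = elastic_form w e"
  and elastic_form_nonneg: "e \<in> L2_sym_tensors \<Omega> \<Longrightarrow> 0 \<le> elastic_form e e"
proof -
  have "inner_product_L2_sym \<Omega> elastic_form"
    using C_inner[OF phi0_Linf] by (simp add: elastic_form_def[abs_def] stress_def[abs_def])
  then show "e \<in> L2_sym_tensors \<Omega> \<Longrightarrow> w \<in> L2_sym_tensors \<Omega> \<Longrightarrow> elastic_form e w = elastic_form w e"
    and "e \<in> L2_sym_tensors \<Omega> \<Longrightarrow> 0 \<le> elastic_form e e"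
    unfolding inner_product_L2_sym_def by blast+
qed

lemma stress_lincomb: "stress (\<lambda>x. t *\<^sub>R e x + w x) = (\<lambda>x. t *\<^sub>R stress e x + stress w x)"
  by (auto simp: stress_def blinfun.add_right blinfun.scaleR_right)

text \<open>Strains are linear only up to null sets, so the identity is first transferred to the linear
  combination of the strains; the mixed terms agree by symmetry of the elasticity tensor.\<close>

lemma elastic_form_strain_lincomb:
  fixes t :: real
  assumes "s \<in> Q" "q \<in> Q" "w \<in> V" "v \<in> V"
  defines "e \<equiv> strain (\<lambda>x. t * q x + s x) (\<lambda>x. t *\<^sub>R v x + w x)"
  shows "elastic_form e e = elastic_form (strain s w) (strain s w)
    + 2 * t * elastic_form (strain s w) (strain q v) + t\<^sup>2 * elastic_form (strain q v) (strain q v)"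
proof -
  let ?e = "\<lambda>x. t *\<^sub>R strain q v x + strain s w x"
  have L2: "strain s w \<in> L2_space \<Omega>" "strain q v \<in> L2_space \<Omega>" "e \<in> L2_space \<Omega>" "?e \<in> L2_space \<Omega>"
    using assms by (auto intro: strain_L2 L2_space_lincomb Q_lincomb V_lincomb)
  have AE: "AE x in M. e x = ?e x"
    unfolding e_def by (rule strain_lincomb[OF assms(1-4)])
  have "elastic_form e e = elastic_form ?e ?e"
    unfolding elastic_form_def
  proof (rule l2_inner_cong_AE)
    show "AE x in M. stress e x = stress ?e x" using AE by eventually_elim (simp add: stress_def)
  qed (use L2 AE stress_L2 in auto)
  also have "\<dots> = t * elastic_form (strain q v) ?e + elastic_form (strain s w) ?e"
    unfolding elastic_form_def stress_lincomb using L2 by (intro l2_inner_lincomb_left stress_L2)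
  also have "\<dots> = t * (t * elastic_form (strain q v) (strain q v) + elastic_form (strain q v) (strain s w))
     + (t * elastic_form (strain s w) (strain q v) + elastic_form (strain s w) (strain s w))"
    unfolding elastic_form_def using L2 by (simp only: l2_inner_lincomb_right stress_L2)
  also have "elastic_form (strain q v) (strain s w) = elastic_form (strain s w) (strain q v)"
    using assms by (intro elastic_form_sym strain_sym) auto
  finally show ?thesis by (simp add: power2_eq_square algebra_simps)
qed

lemma explicit_source_integrable: "integrable M explicit_source"
proof -
  let ?e = "strain \<phi>\<^sub>0 u\<^sub>0"
  have e: "?e \<in> L2_space \<Omega>" by (rule strain_L2[OF prev])
  obtain B where B: "(\<lambda>x. deriv \<pi> (\<phi>\<^sub>0 x)) \<in> borel_measurable M" "AE x in M. \<bar>deriv \<pi> (\<phi>\<^sub>0 x)\<bar> \<le> B"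
    using continuous_comp_Q[OF pi_C1(2) prev(1)] by blast
  have "integrable M (\<lambda>x. ?e x \<bullet> blinfun_apply (Cp - Cm) (?e x))"
    by (rule L2_inner_integrable[OF e L2_bounded_linear[OF blinfun.bounded_linear_right e]])
  from integrable_bounded_mult[OF this B]
  have "integrable M (\<lambda>x. 1/2 * ((?e x \<bullet> blinfun_apply (Cp - Cm) (?e x)) * deriv \<pi> (\<phi>\<^sub>0 x)))" by simp
  moreover have "explicit_source = (\<lambda>x. 1/2 * ((?e x \<bullet> blinfun_apply (Cp - Cm) (?e x)) * deriv \<pi> (\<phi>\<^sub>0 x)))"
    by (auto simp: elastic_expl_def elasticity_tensor_deriv_def blinfun.scaleR_left)
  ultimately show ?thesis by simp
qed

lemma Psi_c_continuous: "continuous_on UNIV \<Psi>\<^sub>c"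
  using Psi_c(2) by (intro continuous_at_imp_continuous_on) (auto intro: differentiable_imp_continuous_within)

lemma Psi_c_integrable: "s \<in> Q \<Longrightarrow> integrable M (\<lambda>x. \<Psi>\<^sub>c (s x))"
  by (rule bounded_integrable) (rule continuous_comp_Q[OF Psi_c_continuous], assumption)+

lemma deriv_Psi_c_L2: "s \<in> Q \<Longrightarrow> (\<lambda>x. deriv \<Psi>\<^sub>c (s x)) \<in> L2_space \<Omega>"
  by (rule bounded_L2) (rule mono_comp_Q[OF convex_deriv_mono[OF Psi_c]], assumption)+

lemma deriv_Psi_e_L2: "s \<in> Q \<Longrightarrow> (\<lambda>x. deriv \<Psi>\<^sub>e (s x)) \<in> L2_space \<Omega>"
  by (rule bounded_L2) (rule mono_comp_Q[OF convex_deriv_mono[OF Psi_e]], assumption)+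

lemma convex_energy_eq:
  assumes "s \<in> Q" "w \<in> V"
  shows "convex_energy \<Omega> \<gamma> l \<xi> \<Psi>\<^sub>c Cm Cp \<pi> s w \<phi>\<^sub>0 = \<gamma> / l * (\<integral>x. \<Psi>\<^sub>c (s x) \<partial>M)
    + \<gamma> * l / 2 * l2_inner \<Omega> (weak_grad \<Omega> s) (weak_grad \<Omega> s) + 1/2 * elastic_form (strain s w) (strain s w)"
proof -
  note int = Psi_c_integrable[OF assms(1)] L2_inner_integrable[OF grad_Q_L2 grad_Q_L2, OF assms(1,1)]
    L2_inner_integrable[OF stress_L2 strain_L2, OF strain_L2, OF assms assms]
  have "convex_energy \<Omega> \<gamma> l \<xi> \<Psi>\<^sub>c Cm Cp \<pi> s w \<phi>\<^sub>0 =
      (\<integral>x. \<gamma> / l * \<Psi>\<^sub>c (s x) + \<gamma> * l / 2 * (weak_grad \<Omega> s x \<bullet> weak_grad \<Omega> s x)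
        + 1/2 * (stress (strain s w) x \<bullet> strain s w x) \<partial>M)"
    unfolding convex_energy_def stress_def
    by (intro Bochner_Integration.integral_cong) (auto simp: power2_norm_eq_inner inner_commute)
  then show ?thesis using int by (simp add: l2_inner_def elastic_form_def)
qed

section \<open>Weak forms of the discrete equations\<close>

text \<open>The argument of the dual norm in the step functional.\<close>

definition source :: "(real ^ 'd \<Rightarrow> real) \<Rightarrow> real ^ 'd \<Rightarrow> real" where
  "source s x = s x - \<phi>\<^sub>0 x - \<tau> * R x"

lemma source_eq: "source s = (\<lambda>x. (- \<tau>) *\<^sub>R R x + ((-1) *\<^sub>R \<phi>\<^sub>0 x + s x))"
  by (auto simp: source_def)

lemma source_L2: "s \<in> Q \<Longrightarrow> source s \<in> L2_space \<Omega>"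
  unfolding source_eq by (intro L2_space_lincomb R Q_L2 prev)

lemma source_lincomb: "source (\<lambda>x. t * q x + s x) = (\<lambda>x. t *\<^sub>R q x + source s x)"
  by (auto simp: source_def)

text \<open>The mass constraint is the solvability condition of the Neumann problem for the source.\<close>

lemma admissible_iff:
  "s \<in> admissible_phases \<Omega> Q \<tau> R \<phi>\<^sub>0 \<longleftrightarrow> s \<in> Q \<and> (\<integral>x. source s x \<partial>M) = 0"
proof (cases "s \<in> Q")
  case True
  note int = L2_integrable[OF Q_L2[OF True]] L2_integrable[OF Q_L2[OF prev(1)]] L2_integrable[OF R]
  have "(\<integral>x. source s x \<partial>M) = \<tau> * ((\<integral>x. (s x - \<phi>\<^sub>0 x) / \<tau> \<partial>M) - (\<integral>x. R x \<partial>M))"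
    unfolding source_def using int params by (simp add: field_simps)
  then show ?thesis using True params by (auto simp: admissible_phases_def)
qed (simp add: admissible_phases_def)

text \<open>The first discrete equation says that \<open>- \<tau> \<mu>\<close> represents the source in the mobility form.\<close>

lemma phase_equation_iff:
  assumes "s \<in> Q" "p \<in> Q"
  shows "l2_inner \<Omega> (\<lambda>x. (s x - \<phi>\<^sub>0 x) / \<tau>) p
            + l2_inner \<Omega> (\<lambda>x. m *\<^sub>R weak_grad \<Omega> \<mu> x) (weak_grad \<Omega> p)
            - l2_inner \<Omega> R p = 0 \<longleftrightarrow> l2_inner \<Omega> (source s) p = - \<tau> * mobility_form \<mu> p"
proof -
  have d: "(\<lambda>x. (s x - \<phi>\<^sub>0 x) / \<tau>) \<in> L2_space \<Omega>"
  proof -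
    have "(\<lambda>x. (1 / \<tau>) *\<^sub>R s x + (- 1 / \<tau>) *\<^sub>R \<phi>\<^sub>0 x) \<in> L2_space \<Omega>"
      using assms prev by (intro L2_space_lincomb L2_bounded_linear[OF bounded_linear_scaleR_right] Q_L2)
    then show ?thesis by (simp add: diff_divide_distrib)
  qed
  have "source s = (\<lambda>x. \<tau> *\<^sub>R ((s x - \<phi>\<^sub>0 x) / \<tau>) + (- \<tau>) *\<^sub>R R x)"
    using params by (auto simp: source_def)
  then have "l2_inner \<Omega> (source s) p = l2_inner \<Omega> (\<lambda>x. \<tau> *\<^sub>R ((s x - \<phi>\<^sub>0 x) / \<tau>) + (- \<tau>) *\<^sub>R R x) p"
    by (simp only:)
  also have "\<dots> = \<tau> * l2_inner \<Omega> (\<lambda>x. (s x - \<phi>\<^sub>0 x) / \<tau>) p + l2_inner \<Omega> (\<lambda>x. (- \<tau>) *\<^sub>R R x) p"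
    by (rule l2_inner_lincomb_left[OF d L2_bounded_linear[OF bounded_linear_scaleR_right R] Q_L2[OF assms(2)]])
  also have "l2_inner \<Omega> (\<lambda>x. (- \<tau>) *\<^sub>R R x) p = - \<tau> * l2_inner \<Omega> R p"
    by (simp add: l2_inner_def mult.assoc)
  finally have "l2_inner \<Omega> (source s) p = - \<tau> * mobility_form \<mu> p \<longleftrightarrow>
     \<tau> * (l2_inner \<Omega> (\<lambda>x. (s x - \<phi>\<^sub>0 x) / \<tau>) p + mobility_form \<mu> p - l2_inner \<Omega> R p) = 0"
    by (auto simp: algebra_simps)
  then show ?thesis using params by (simp add: mobility_form_def)
qed

text \<open>The chemical equation is \<open>l2_inner \<Omega> \<mu> q = chemical_form \<phi> u q\<close> for all \<open>q\<close>.\<close>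

definition chemical_form where
  "chemical_form \<phi> u q = \<gamma> * l * l2_inner \<Omega> (weak_grad \<Omega> \<phi>) (weak_grad \<Omega> q)
     + \<gamma> / l * l2_inner \<Omega> (\<lambda>x. deriv \<Psi>\<^sub>c (\<phi> x) - deriv \<Psi>\<^sub>e (\<phi>\<^sub>0 x)) q
     + l2_inner \<Omega> (elastic_semi_impl \<Omega> \<xi> Cm Cp \<pi> \<phi> u \<phi>\<^sub>0 u\<^sub>0) q"

text \<open>The momentum balance is \<open>momentum_form \<phi> u v = 0\<close> for all \<open>v\<close>.\<close>

definition momentum_form where
  "momentum_form \<phi> u v = elastic_form (strain \<phi> u) (sym_grad \<Omega> v) - l2_inner \<Omega> f v"

lemma V_L2: "v \<in> V \<Longrightarrow> v \<in> L2_space \<Omega>"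
  using H1_L2[OF V_component_H1] by (rule L2_vec)

lemma trace_stress_integrable:
  assumes "e \<in> L2_space \<Omega>" shows "integrable M (\<lambda>x. mat 1 \<bullet> stress e x)"
proof -
  have "(\<lambda>_. mat 1 :: real ^ 'd ^ 'd) \<in> L2_space \<Omega>" by (simp add: L2_space_def)
  then show ?thesis using stress_L2[OF assms] by (rule L2_inner_integrable)
qed

lemma semi_impl_eq: "elastic_semi_impl \<Omega> \<xi> Cm Cp \<pi> \<phi> u \<phi>\<^sub>0 u\<^sub>0 = (\<lambda>x. explicit_source x - \<xi> * (mat 1 \<bullet> stress (strain \<phi> u) x))"
  by (auto simp: elastic_semi_impl_def stress_def)

lemma semi_impl_integrable:
  assumes "\<phi> \<in> Q" "u \<in> V" shows "integrable M (elastic_semi_impl \<Omega> \<xi> Cm Cp \<pi> \<phi> u \<phi>\<^sub>0 u\<^sub>0)"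
  unfolding semi_impl_eq using explicit_source_integrable trace_stress_integrable[OF strain_L2[OF assms]] by simp

lemma chemical_form_lincomb:
  assumes "\<phi> \<in> Q" "u \<in> V" "p \<in> Q" "q \<in> Q"
  shows "chemical_form \<phi> u (\<lambda>x. t * p x + q x) = t * chemical_form \<phi> u p + chemical_form \<phi> u q"
proof -
  have "integrable M (\<lambda>x. deriv \<Psi>\<^sub>c (\<phi> x) - deriv \<Psi>\<^sub>e (\<phi>\<^sub>0 x))"
    using L2_integrable[OF deriv_Psi_c_L2[OF assms(1)]] L2_integrable[OF deriv_Psi_e_L2[OF prev(1)]] by simp
  from l2_inner_Q_lincomb[OF this assms(3,4)] l2_inner_Q_lincomb[OF semi_impl_integrable[OF assms(1,2)] assms(3,4)]
    l2_inner_grad_lincomb[OF assms(3,4) grad_Q_L2[OF assms(1)]]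
  show ?thesis by (simp add: chemical_form_def l2_inner_commute[of \<Omega> "weak_grad \<Omega> \<phi>"] algebra_simps)
qed

text \<open>The mixed term \<open>C \<epsilon>(\<phi>, u) : \<epsilon>(q, v)\<close> splits into its momentum part, tested with the symmetric gradient
  of \<open>v\<close>, and its volumetric part, which is the implicit half of \<open>elastic_semi_impl\<close>.\<close>

lemma first_variation_eq:
  assumes "\<phi> \<in> Q" "u \<in> V" "q \<in> Q" "v \<in> V"
  shows "\<gamma> / l * l2_inner \<Omega> (\<lambda>x. deriv \<Psi>\<^sub>c (\<phi> x)) q + \<gamma> * l * l2_inner \<Omega> (weak_grad \<Omega> \<phi>) (weak_grad \<Omega> q)
     + elastic_form (strain \<phi> u) (strain q v) + l2_inner \<Omega> explicit_source q
     - \<gamma> / l * l2_inner \<Omega> (\<lambda>x. deriv \<Psi>\<^sub>e (\<phi>\<^sub>0 x)) q - l2_inner \<Omega> f v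
    = chemical_form \<phi> u q + momentum_form \<phi> u v"
proof -
  let ?\<sigma> = "stress (strain \<phi> u)"
  have \<sigma>: "?\<sigma> \<in> L2_space \<Omega>" using assms by (intro stress_L2 strain_L2)
  have e1: "elastic_form (strain \<phi> u) (strain q v)
      = - \<xi> * l2_inner \<Omega> ?\<sigma> (pressure_tensor q) + elastic_form (strain \<phi> u) (sym_grad \<Omega> v)"
    unfolding elastic_form_def strain_eq[of q v] using assms \<sigma>
    by (intro l2_inner_lincomb_right pressure_tensor_L2 sym_grad_L2)
  have e2: "l2_inner \<Omega> ?\<sigma> (pressure_tensor q) = l2_inner \<Omega> (\<lambda>x. mat 1 \<bullet> ?\<sigma> x) q"
    by (simp add: l2_inner_def pressure_tensor_def inner_commute mult.commute)
  have e3: "l2_inner \<Omega> (elastic_semi_impl \<Omega> \<xi> Cm Cp \<pi> \<phi> u \<phi>\<^sub>0 u\<^sub>0) q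
      = l2_inner \<Omega> explicit_source q - \<xi> * l2_inner \<Omega> (\<lambda>x. mat 1 \<bullet> ?\<sigma> x) q"
  proof -
    have "l2_inner \<Omega> (elastic_semi_impl \<Omega> \<xi> Cm Cp \<pi> \<phi> u \<phi>\<^sub>0 u\<^sub>0) q
      = (\<integral>x. explicit_source x * q x - \<xi> * ((mat 1 \<bullet> ?\<sigma> x) * q x) \<partial>M)"
      by (simp add: semi_impl_eq l2_inner_def algebra_simps)
    then show ?thesis
      using integrable_mult_Q[OF explicit_source_integrable assms(3)]
        integrable_mult_Q[OF trace_stress_integrable[OF strain_L2[OF assms(1,2)]] assms(3)]
      by (simp add: l2_inner_def)
  qed
  have e4: "l2_inner \<Omega> (\<lambda>x. deriv \<Psi>\<^sub>c (\<phi> x) - deriv \<Psi>\<^sub>e (\<phi>\<^sub>0 x)) q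
      = l2_inner \<Omega> (\<lambda>x. deriv \<Psi>\<^sub>c (\<phi> x)) q - l2_inner \<Omega> (\<lambda>x. deriv \<Psi>\<^sub>e (\<phi>\<^sub>0 x)) q"
    using l2_inner_lincomb_left[OF deriv_Psi_e_L2[OF prev(1)] deriv_Psi_c_L2[OF assms(1)] Q_L2[OF assms(3)], of "- 1"]
    by simp
  show ?thesis
    unfolding chemical_form_def momentum_form_def e1 e2 e3 e4 by (simp add: algebra_simps)
qed

section \<open>First variation of the step functional\<close>

abbreviation energy where
  "energy \<equiv> step_functional \<Omega> Q \<gamma> l \<tau> m \<xi> \<Psi>\<^sub>c \<Psi>\<^sub>e Cm Cp \<pi> R f \<phi>\<^sub>0 u\<^sub>0"

text \<open>Integrated form of the tangent inequality of \<open>\<Psi>\<^sub>c\<close> and of its quadratic upper bound.\<close>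

lemma potential_remainder:
  assumes "\<phi> \<in> Q" "q \<in> Q"
  defines "r t \<equiv> (\<integral>x. \<Psi>\<^sub>c (t * q x + \<phi> x) \<partial>M) - (\<integral>x. \<Psi>\<^sub>c (\<phi> x) \<partial>M) - t * l2_inner \<Omega> (\<lambda>x. deriv \<Psi>\<^sub>c (\<phi> x)) q"
  shows "0 \<le> r t" "r t \<le> t\<^sup>2 * (\<bar>L\<bar> * l2_inner \<Omega> q q)"
proof -
  let ?r = "\<lambda>x. \<Psi>\<^sub>c (t * q x + \<phi> x) - \<Psi>\<^sub>c (\<phi> x) - t * (deriv \<Psi>\<^sub>c (\<phi> x) \<bullet> q x)"
  have int: "integrable M (\<lambda>x. \<Psi>\<^sub>c (t * q x + \<phi> x))" "integrable M (\<lambda>x. \<Psi>\<^sub>c (\<phi> x))"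
    "integrable M (\<lambda>x. deriv \<Psi>\<^sub>c (\<phi> x) \<bullet> q x)" "integrable M (\<lambda>x. q x \<bullet> q x)"
    using Psi_c_integrable[OF Q_lincomb[OF assms(2,1)]] Psi_c_integrable[OF assms(1)]
      L2_inner_integrable[OF deriv_Psi_c_L2[OF assms(1)] Q_L2[OF assms(2)]]
      L2_inner_integrable[OF Q_L2 Q_L2, OF assms(2,2)] by blast+
  have r: "r t = (\<integral>x. ?r x \<partial>M)"
    using int by (simp add: r_def l2_inner_def)
  show "0 \<le> r t"
    unfolding r
  proof (rule integral_nonneg_AE, rule AE_I2)
    fix x show "0 \<le> ?r x"
      using convex_deriv_tangent[OF Psi_c, of "\<phi> x" "t * q x + \<phi> x"] by (simp add: algebra_simps)
  qed
  have "r t \<le> (\<integral>x. t\<^sup>2 * (\<bar>L\<bar> * (q x \<bullet> q x)) \<partial>M)"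
    unfolding r
  proof (rule integral_mono)
    fix x show "?r x \<le> t\<^sup>2 * (\<bar>L\<bar> * (q x \<bullet> q x))"
      using deriv_one_sided_Lipschitz_imp_quadratic_bound[OF Psi_c(2) Psi_c_lip, of "t * q x + \<phi> x" "\<phi> x"]
      by (simp add: power_mult_distrib power2_eq_square algebra_simps)
  qed (use int in auto)
  then show "r t \<le> t\<^sup>2 * (\<bar>L\<bar> * l2_inner \<Omega> q q)" by (simp add: l2_inner_def)
qed

text \<open>All terms except the potential are exactly quadratic in \<open>t\<close>. The dual norm is so because the
  representative of \<open>source (\<phi> + t q)\<close> is \<open>\<nu> + t \<eta>\<close>, where \<open>\<eta>\<close> represents \<open>q\<close>, and the cross term
  \<open>mobility_form \<eta> \<nu>\<close> equals \<open>(q, \<nu>)\<close>. The lower bound drops the nonnegative second-order terms.\<close>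

lemma energy_expansion:
  assumes \<phi>: "\<phi> \<in> Q" and u: "u \<in> V" and q: "q \<in> Q" and v: "v \<in> V" and mean: "(\<integral>x. q x \<partial>M) = 0"
    and \<nu>: "\<nu> \<in> Q" "\<And>p. p \<in> Q \<Longrightarrow> mobility_form \<nu> p = l2_inner \<Omega> (source \<phi>) p"
  defines "D \<equiv> l2_inner \<Omega> q \<nu> / \<tau> + chemical_form \<phi> u q + momentum_form \<phi> u v"
  shows "\<exists>K. \<forall>t.
    t * D \<le> energy (\<lambda>x. t * q x + \<phi> x) (\<lambda>x. t *\<^sub>R v x + u x) - energy \<phi> u \<and>
    energy (\<lambda>x. t * q x + \<phi> x) (\<lambda>x. t *\<^sub>R v x + u x) - energy \<phi> u \<le> t * D + t\<^sup>2 * K"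
proof -
  obtain \<eta> where \<eta>: "\<eta> \<in> Q" "\<And>p. p \<in> Q \<Longrightarrow> mobility_form \<eta> p = l2_inner \<Omega> q p"
    using discrete_inverse_laplacian[OF Q_L2[OF q] mean] by metis
  define K0 where "K0 = mobility_form \<eta> \<eta> / (2 * \<tau>) + \<gamma> * l / 2 * l2_inner \<Omega> (weak_grad \<Omega> q) (weak_grad \<Omega> q)
    + 1/2 * elastic_form (strain q v) (strain q v)"
  define r where "r t = (\<integral>x. \<Psi>\<^sub>c (t * q x + \<phi> x) \<partial>M) - (\<integral>x. \<Psi>\<^sub>c (\<phi> x) \<partial>M) - t * l2_inner \<Omega> (\<lambda>x. deriv \<Psi>\<^sub>c (\<phi> x)) q" for t
  have exp: "energy (\<lambda>x. t * q x + \<phi> x) (\<lambda>x. t *\<^sub>R v x + u x) - energy \<phi> u = t * D + t\<^sup>2 * K0 + \<gamma> / l * r t" for t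
  proof -
    let ?s = "\<lambda>x. t * q x + \<phi> x" and ?w = "\<lambda>x. t *\<^sub>R v x + u x"
    have s: "?s \<in> Q" and w: "?w \<in> V" using Q_lincomb[OF q \<phi>] V_lincomb[OF v u] by auto
    have dual0: "(dual_norm \<Omega> Q m (l2_inner \<Omega> (\<lambda>x. \<phi> x - \<phi>\<^sub>0 x - \<tau> * R x)))\<^sup>2 = mobility_form \<nu> \<nu>"
      unfolding source_def[symmetric] by (rule dual_norm_eq[OF \<nu>])
    have dual: "(dual_norm \<Omega> Q m (l2_inner \<Omega> (\<lambda>x. ?s x - \<phi>\<^sub>0 x - \<tau> * R x)))\<^sup>2
        = t\<^sup>2 * mobility_form \<eta> \<eta> + 2 * t * l2_inner \<Omega> q \<nu> + mobility_form \<nu> \<nu>"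
    proof -
      have "mobility_form (\<lambda>x. t *\<^sub>R \<eta> x + \<nu> x) p = l2_inner \<Omega> (source ?s) p" if "p \<in> Q" for p
        using form_lincomb[OF \<eta>(1) \<nu>(1) that, of t] \<eta>(2)[OF that] \<nu>(2)[OF that]
          l2_inner_lincomb_left[OF Q_L2[OF q] source_L2[OF \<phi>] Q_L2[OF that], of t]
        by (simp add: source_lincomb)
      from dual_norm_eq[OF lincomb[OF \<eta>(1) \<nu>(1)] this]
      have "(dual_norm \<Omega> Q m (l2_inner \<Omega> (source ?s)))\<^sup>2 = t\<^sup>2 * mobility_form \<eta> \<eta> + 2 * t * l2_inner \<Omega> q \<nu> + mobility_form \<nu> \<nu>"
        using form_lincomb_self[OF \<eta>(1) \<nu>(1), of t] \<eta>(2)[OF \<nu>(1)] by simp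
      then show ?thesis by (simp add: source_def[abs_def])
    qed
    have grad: "l2_inner \<Omega> (weak_grad \<Omega> ?s) (weak_grad \<Omega> ?s) = t\<^sup>2 * l2_inner \<Omega> (weak_grad \<Omega> q) (weak_grad \<Omega> q)
        + 2 * t * l2_inner \<Omega> (weak_grad \<Omega> \<phi>) (weak_grad \<Omega> q) + l2_inner \<Omega> (weak_grad \<Omega> \<phi>) (weak_grad \<Omega> \<phi>)"
      (is "_ = ?rhs")
    proof -
      have "m * l2_inner \<Omega> (weak_grad \<Omega> ?s) (weak_grad \<Omega> ?s) = m * ?rhs"
        using form_lincomb_self[OF q \<phi>, of t]
        unfolding mobility_form_eq l2_inner_commute[of \<Omega> "weak_grad \<Omega> q" "weak_grad \<Omega> \<phi>"]
        by (simp add: algebra_simps)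
      then show ?thesis using m_pos by simp
    qed
    have lin: "l2_inner \<Omega> explicit_source ?s = t * l2_inner \<Omega> explicit_source q + l2_inner \<Omega> explicit_source \<phi>"
      "l2_inner \<Omega> (\<lambda>x. deriv \<Psi>\<^sub>e (\<phi>\<^sub>0 x)) ?s = t * l2_inner \<Omega> (\<lambda>x. deriv \<Psi>\<^sub>e (\<phi>\<^sub>0 x)) q + l2_inner \<Omega> (\<lambda>x. deriv \<Psi>\<^sub>e (\<phi>\<^sub>0 x)) \<phi>"
      "l2_inner \<Omega> f ?w = t * l2_inner \<Omega> f v + l2_inner \<Omega> f u"
      using l2_inner_Q_lincomb[OF explicit_source_integrable q \<phi>] l2_inner_Q_lincomb[OF L2_integrable[OF deriv_Psi_e_L2[OF prev(1)]] q \<phi>]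
        l2_inner_lincomb_right[OF V_L2[OF v] V_L2[OF u] f] by auto
    have psi: "(\<integral>x. \<Psi>\<^sub>c (?s x) \<partial>M) = r t + (\<integral>x. \<Psi>\<^sub>c (\<phi> x) \<partial>M) + t * l2_inner \<Omega> (\<lambda>x. deriv \<Psi>\<^sub>c (\<phi> x)) q"
      by (simp add: r_def)
    have D: "D = l2_inner \<Omega> q \<nu> / \<tau> + (\<gamma> / l * l2_inner \<Omega> (\<lambda>x. deriv \<Psi>\<^sub>c (\<phi> x)) q + \<gamma> * l * l2_inner \<Omega> (weak_grad \<Omega> \<phi>) (weak_grad \<Omega> q)
     + elastic_form (strain \<phi> u) (strain q v) + l2_inner \<Omega> explicit_source q
     - \<gamma> / l * l2_inner \<Omega> (\<lambda>x. deriv \<Psi>\<^sub>e (\<phi>\<^sub>0 x)) q - l2_inner \<Omega> f v)"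
      using first_variation_eq[OF \<phi> u q v] by (simp add: D_def)
    show ?thesis
      unfolding step_functional_def dual0 dual convex_energy_eq[OF s w] convex_energy_eq[OF \<phi> u] grad lin psi D K0_def
        elastic_form_strain_lincomb[OF \<phi> q u v]
      by (simp add: add_divide_distrib distrib_left distrib_right right_diff_distrib left_diff_distrib)
         (simp add: mult_ac)
  qed
  have nonneg: "0 \<le> K0"
    unfolding K0_def using params form_nonneg[OF \<eta>(1)] elastic_form_nonneg[OF strain_sym[OF q v]]
    by (simp add: l2_inner_self_nonneg)
  have \<gamma>l: "0 \<le> \<gamma> / l" using params by simp
  show ?thesis
  proof (intro exI[of _ "K0 + \<gamma> / l * (\<bar>L\<bar> * l2_inner \<Omega> q q)"] allI conjI)
    fix t
    have "0 \<le> \<gamma> / l * r t"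
      using \<gamma>l potential_remainder(1)[OF \<phi> q, of t] unfolding r_def by (rule mult_nonneg_nonneg)
    then show "t * D \<le> energy (\<lambda>x. t * q x + \<phi> x) (\<lambda>x. t *\<^sub>R v x + u x) - energy \<phi> u"
      using exp[of t] nonneg by (simp add: mult_nonneg_nonneg)
    have "\<gamma> / l * r t \<le> \<gamma> / l * (t\<^sup>2 * (\<bar>L\<bar> * l2_inner \<Omega> q q))"
      using potential_remainder(2)[OF \<phi> q, of t] \<gamma>l unfolding r_def by (rule mult_left_mono)
    then show "energy (\<lambda>x. t * q x + \<phi> x) (\<lambda>x. t *\<^sub>R v x + u x) - energy \<phi> u
        \<le> t * D + t\<^sup>2 * (K0 + \<gamma> / l * (\<bar>L\<bar> * l2_inner \<Omega> q q))"
      unfolding exp by (simp add: algebra_simps)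
  qed
qed

text \<open>With \<open>\<nu> = - \<tau> \<mu>\<close> the three equations say that the slope \<open>D\<close> vanishes in every direction, and
  the lower bound of the expansion at \<open>t = 1\<close> compares with an arbitrary competitor.\<close>

lemma weak_solution_imp_minimizer:
  assumes \<phi>: "\<phi> \<in> Q" and \<mu>: "\<mu> \<in> Q" and u: "u \<in> V"
    and phase: "\<And>p. p \<in> Q \<Longrightarrow> l2_inner \<Omega> (source \<phi>) p = - \<tau> * mobility_form \<mu> p"
    and chemical: "\<And>q. q \<in> Q \<Longrightarrow> l2_inner \<Omega> \<mu> q = chemical_form \<phi> u q"
    and momentum: "\<And>v. v \<in> V \<Longrightarrow> momentum_form \<phi> u v = 0"
  shows "\<phi> \<in> admissible_phases \<Omega> Q \<tau> R \<phi>\<^sub>0"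
    and "\<And>s w. s \<in> admissible_phases \<Omega> Q \<tau> R \<phi>\<^sub>0 \<Longrightarrow> w \<in> V \<Longrightarrow> energy \<phi> u \<le> energy s w"
proof -
  have mass: "(\<integral>x. source \<phi> x \<partial>M) = 0"
    using phase[OF one(1)] by (simp add: l2_inner_one mobility_form_one)
  then show "\<phi> \<in> admissible_phases \<Omega> Q \<tau> R \<phi>\<^sub>0" using \<phi> by (simp add: admissible_iff)
  fix s w assume s: "s \<in> admissible_phases \<Omega> Q \<tau> R \<phi>\<^sub>0" and w: "w \<in> V"
  have sQ: "s \<in> Q" and smass: "(\<integral>x. source s x \<partial>M) = 0" using s by (auto simp: admissible_iff)
  define q where "q = (\<lambda>x. (-1) * \<phi> x + s x)"
  define v where "v = (\<lambda>x. (-1) *\<^sub>R u x + w x)"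
  define \<nu> where "\<nu> = (\<lambda>x. (- \<tau>) * \<mu> x + 0)"
  have q: "q \<in> Q" and v: "v \<in> V" unfolding q_def v_def by (rule Q_lincomb[OF \<phi> sQ], rule V_lincomb[OF u w])
  have mean: "(\<integral>x. q x \<partial>M) = 0"
  proof -
    have "(\<integral>x. q x \<partial>M) = (\<integral>x. source s x - source \<phi> x \<partial>M)" by (simp add: q_def source_def)
    then show ?thesis
      using L2_integrable[OF source_L2[OF sQ]] L2_integrable[OF source_L2[OF \<phi>]] mass smass by simp
  qed
  have \<nu>: "\<nu> \<in> Q" unfolding \<nu>_def by (rule Q_lincomb[OF \<mu> zero])
  have mobility_form\<nu>: "mobility_form \<nu> p = l2_inner \<Omega> (source \<phi>) p" if "p \<in> Q" for p
  proof -
    have "mobility_form (\<lambda>x. 0) p = 0" using form_lincomb[OF zero zero that, of 1] by simp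
    then show ?thesis using form_lincomb[OF \<mu> zero that, of "- \<tau>"] phase[OF that] by (simp add: \<nu>_def)
  qed
  obtain K where "\<And>t. t * (l2_inner \<Omega> q \<nu> / \<tau> + chemical_form \<phi> u q + momentum_form \<phi> u v)
      \<le> energy (\<lambda>x. t * q x + \<phi> x) (\<lambda>x. t *\<^sub>R v x + u x) - energy \<phi> u"
    using energy_expansion[OF \<phi> u q v mean \<nu> mobility_form\<nu>] by blast
  from this[of 1] have "l2_inner \<Omega> q \<nu> / \<tau> + chemical_form \<phi> u q + momentum_form \<phi> u v
      \<le> energy s w - energy \<phi> u"
    by (simp add: q_def v_def)
  moreover have "l2_inner \<Omega> q \<nu> / \<tau> = - l2_inner \<Omega> \<mu> q"
    using params by (simp add: l2_inner_def \<nu>_def mult.commute mult.left_commute)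
  ultimately show "energy \<phi> u \<le> energy s w" using chemical[OF q] momentum[OF v] by simp
qed

text \<open>The upper bound of the expansion forces the slope to vanish in all directions with mean-zero \<open>q\<close>. Taking
  \<open>q = 0\<close> isolates the momentum balance; the rest gives the chemical equation on mean-zero test
  functions with \<open>\<mu> = - \<nu> / \<tau>\<close>, and adding a constant to \<open>\<mu>\<close> extends it to all of \<open>Q\<close> without
  changing the phase equation.\<close>

lemma minimizer_imp_weak_solution:
  assumes adm: "\<phi> \<in> admissible_phases \<Omega> Q \<tau> R \<phi>\<^sub>0" and u: "u \<in> V"
    and min: "\<And>s w. s \<in> admissible_phases \<Omega> Q \<tau> R \<phi>\<^sub>0 \<Longrightarrow> w \<in> V \<Longrightarrow> energy \<phi> u \<le> energy s w"
  obtains \<mu> where "\<mu> \<in> Q" "\<And>p. p \<in> Q \<Longrightarrow> l2_inner \<Omega> (source \<phi>) p = - \<tau> * mobility_form \<mu> p"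
    "\<And>q. q \<in> Q \<Longrightarrow> l2_inner \<Omega> \<mu> q = chemical_form \<phi> u q"
    "\<And>v. v \<in> V \<Longrightarrow> momentum_form \<phi> u v = 0"
proof -
  have \<phi>: "\<phi> \<in> Q" and mass: "(\<integral>x. source \<phi> x \<partial>M) = 0" using adm by (auto simp: admissible_iff)
  obtain \<nu> where \<nu>: "\<nu> \<in> Q" "\<And>p. p \<in> Q \<Longrightarrow> mobility_form \<nu> p = l2_inner \<Omega> (source \<phi>) p"
    using discrete_inverse_laplacian[OF source_L2[OF \<phi>] mass] by metis
  have stationary: "l2_inner \<Omega> q \<nu> / \<tau> + chemical_form \<phi> u q + momentum_form \<phi> u v = 0"
    if q: "q \<in> Q" and v: "v \<in> V" and mean: "(\<integral>x. q x \<partial>M) = 0" for q v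
  proof -
    obtain K where K: "\<And>t. energy (\<lambda>x. t * q x + \<phi> x) (\<lambda>x. t *\<^sub>R v x + u x) - energy \<phi> u
       \<le> t * (l2_inner \<Omega> q \<nu> / \<tau> + chemical_form \<phi> u q + momentum_form \<phi> u v) + t\<^sup>2 * K"
      using energy_expansion[OF \<phi> u q v mean \<nu>] by blast
    show ?thesis
    proof (rule quadratic_nonneg_imp_linear_zero)
      fix t
      have "(\<integral>x. source (\<lambda>x. t * q x + \<phi> x) x \<partial>M) = 0"
        using L2_integrable[OF Q_L2[OF q]] L2_integrable[OF source_L2[OF \<phi>]] mass mean
        by (simp add: source_lincomb)
      then have "(\<lambda>x. t * q x + \<phi> x) \<in> admissible_phases \<Omega> Q \<tau> R \<phi>\<^sub>0"
        using Q_lincomb[OF q \<phi>] by (simp add: admissible_iff)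
      from min[OF this V_lincomb[OF v u], of t]
      show "0 \<le> t * (l2_inner \<Omega> q \<nu> / \<tau> + chemical_form \<phi> u q + momentum_form \<phi> u v) + t\<^sup>2 * K"
        using K[of t] by linarith
    qed
  qed
  have chem0: "chemical_form \<phi> u (\<lambda>x. 0) = 0"
    using chemical_form_lincomb[OF \<phi> u zero zero, of 1] by simp
  have momentum: "momentum_form \<phi> u v = 0" if "v \<in> V" for v
    using stationary[OF zero that] chem0 by (simp add: l2_inner_def)
  have V0: "(\<lambda>x. 0) \<in> V" by (rule finite_element_space_zero[OF V_fe])
  have chem: "chemical_form \<phi> u q = - l2_inner \<Omega> q \<nu> / \<tau>" if "q \<in> Q" "(\<integral>x. q x \<partial>M) = 0" for q
    using stationary[OF that(1) V0 that(2)] momentum[OF V0] by simp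
  \<comment> \<open>The constant for which the chemical equation holds with test function \<open>one\<close>.\<close>
  define c where "c = (chemical_form \<phi> u one + (\<integral>x. \<nu> x \<partial>M) / \<tau>) / measure lebesgue \<Omega>"
  define \<mu> where "\<mu> = (\<lambda>x. (- 1 / \<tau>) * \<nu> x + (c * one x + 0))"
  have c1: "(\<lambda>x. c * one x + 0) \<in> Q" by (rule Q_lincomb[OF one(1) zero])
  have \<mu>: "\<mu> \<in> Q" unfolding \<mu>_def by (rule Q_lincomb[OF \<nu>(1) c1])
  have one_one: "(\<integral>x. one x \<partial>M) = measure lebesgue \<Omega>"
  proof -
    have "(\<integral>x. one x \<partial>M) = (\<integral>x. 1 \<partial>M)" by (rule Bochner_Integration.integral_cong) (auto simp: one)
    then show ?thesis using integral_const[of 1] by simp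
  qed
  have inner_\<mu>: "l2_inner \<Omega> \<mu> q = - l2_inner \<Omega> q \<nu> / \<tau> + c * (\<integral>x. q x \<partial>M)" if q: "q \<in> Q" for q
  proof -
    have "l2_inner \<Omega> \<mu> q = (- 1 / \<tau>) * l2_inner \<Omega> \<nu> q + l2_inner \<Omega> (\<lambda>x. c * one x + 0) q"
      unfolding \<mu>_def using l2_inner_lincomb_left[OF Q_L2[OF \<nu>(1)] Q_L2[OF c1] Q_L2[OF q], of "- 1 / \<tau>"]
      by (simp only: real_scaleR_def)
    also have "l2_inner \<Omega> (\<lambda>x. c * one x + 0) q = (\<integral>x. c * (q x * one x) \<partial>M)"
      by (simp add: l2_inner_def mult_ac)
    also have "\<dots> = c * l2_inner \<Omega> q one" by (simp add: l2_inner_def)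
    finally show ?thesis by (simp add: l2_inner_one l2_inner_commute[of \<Omega> \<nu>])
  qed
  show thesis
  proof (rule that[OF \<mu> _ _ momentum])
    fix p assume p: "p \<in> Q"
    have "AE x in M. c * one x + 0 = c" by (rule AE_I2) (simp add: one)
    then have "mobility_form (\<lambda>x. c * one x + 0) p = 0"
      using form_commute[OF c1 p] mobility_form_AE_const[OF c1] by metis
    then have "mobility_form \<mu> p = (- 1 / \<tau>) * mobility_form \<nu> p"
      unfolding \<mu>_def using form_lincomb[OF \<nu>(1) c1 p, of "- 1 / \<tau>"] by simp
    then show "l2_inner \<Omega> (source \<phi>) p = - \<tau> * mobility_form \<mu> p" using \<nu>(2)[OF p] params by simp
  next
    fix q assume q: "q \<in> Q"
    obtain k where k: "(\<lambda>x. - k * one x + q x) \<in> mean_zero_subspace \<Omega> Q"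
      using mean_zero_part[OF q] by metis
    define q0 where "q0 = (\<lambda>x. - k * one x + q x)"
    have q0: "q0 \<in> Q" "(\<integral>x. q0 x \<partial>M) = 0" using k by (auto simp: q0_def mean_zero_subspace_def)
    have split: "q = (\<lambda>x. k * one x + q0 x)" by (simp add: q0_def)
    have one': "l2_inner \<Omega> \<mu> one = chemical_form \<phi> u one"
      using inner_\<mu>[OF one(1)] volume_pos by (simp add: one_one c_def l2_inner_commute[of \<Omega> one] l2_inner_one)
    have "l2_inner \<Omega> \<mu> q = k * l2_inner \<Omega> \<mu> one + l2_inner \<Omega> \<mu> q0"
      by (subst split) (rule l2_inner_Q_lincomb[OF L2_integrable[OF Q_L2[OF \<mu>]] one(1) q0(1)])
    also have "\<dots> = k * chemical_form \<phi> u one + chemical_form \<phi> u q0"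
      using one' inner_\<mu>[OF q0(1)] chem[OF q0] q0(2) by simp
    also have "\<dots> = chemical_form \<phi> u q"
      by (subst split) (rule chemical_form_lincomb[OF \<phi> u one(1) q0(1), symmetric])
    finally show "l2_inner \<Omega> \<mu> q = chemical_form \<phi> u q" .
  qed
qed

end
section \<open>Equivalence of the discrete problem and the minimization problem\<close>

theorem proposition2:
  fixes \<Omega> :: "(real ^ 'd) set"
    and Q :: "(real ^ 'd \<Rightarrow> real) set" and V :: "(real ^ 'd \<Rightarrow> real ^ 'd) set"
    and \<gamma> l \<tau> m \<xi> :: real
    and R :: "real ^ 'd \<Rightarrow> real" and f :: "real ^ 'd \<Rightarrow> real ^ 'd"
    and \<Psi> \<Psi>\<^sub>c \<Psi>\<^sub>e :: "real \<Rightarrow> real" and L :: real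
    and Cm Cp :: "'d tensor4" and \<pi> :: "real \<Rightarrow> real" and c\<^sub>C C\<^sub>C :: real
    and \<phi>\<^sub>0 \<phi> :: "real ^ 'd \<Rightarrow> real" and u\<^sub>0 u :: "real ^ 'd \<Rightarrow> real ^ 'd"
  assumes domain: "bounded_lipschitz_domain \<Omega>"
    and Q_fe: "finite_element_space \<Omega> Q" and Q_conf: "Q \<subseteq> H1_space \<Omega>"
    and Q_const: "\<And>c. \<exists>q\<in>Q. \<forall>x\<in>\<Omega>. q x = c"
    and V_fe: "finite_element_space \<Omega> V" and V_conf: "V \<subseteq> H1_0_fields \<Omega>"
    and params: "\<gamma> > 0" "l > 0" "\<tau> > 0" "m > 0"
    and R: "R \<in> L2_space \<Omega>" and f: "f \<in> L2_space \<Omega>"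
    and Psi_split: "\<And>a. \<Psi> a = \<Psi>\<^sub>c a - \<Psi>\<^sub>e a"
    and Psi_c: "convex_on UNIV \<Psi>\<^sub>c" "\<And>a. \<Psi>\<^sub>c differentiable at a"
    and Psi_e: "convex_on UNIV \<Psi>\<^sub>e" "\<And>a. \<Psi>\<^sub>e differentiable at a"
    and Psi_c_lip: "\<And>a b. (deriv \<Psi>\<^sub>c a - deriv \<Psi>\<^sub>c b) * (a - b) \<le> L * (a - b)\<^sup>2"
    and pi_C1: "\<And>a. \<pi> differentiable at a" "continuous_on UNIV (deriv \<pi>)"
    and C_const: "c\<^sub>C > 0" "C\<^sub>C > 0"
    and C_bounds: "\<And>s e. s \<in> Linf_space \<Omega> \<Longrightarrow> e \<in> L2_sym_tensors \<Omega> \<Longrightarrow>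
        c\<^sub>C * (l2_norm \<Omega> e)\<^sup>2
          \<le> l2_inner \<Omega> (\<lambda>x. blinfun_apply (elasticity_tensor Cm Cp \<pi> (s x)) (e x)) e \<and>
        l2_inner \<Omega> (\<lambda>x. blinfun_apply (elasticity_tensor Cm Cp \<pi> (s x)) (e x)) e
          \<le> C\<^sub>C * (l2_norm \<Omega> e)\<^sup>2"
    and C_inner: "\<And>s. s \<in> Linf_space \<Omega> \<Longrightarrow> inner_product_L2_sym \<Omega>
        (\<lambda>e w. l2_inner \<Omega> (\<lambda>x. blinfun_apply (elasticity_tensor Cm Cp \<pi> (s x)) (e x)) w)"
    and prev: "\<phi>\<^sub>0 \<in> Q" "u\<^sub>0 \<in> V"
  shows
    "is_arg_min (\<lambda>(s, w). step_functional \<Omega> Q \<gamma> l \<tau> m \<xi> \<Psi>\<^sub>c \<Psi>\<^sub>e Cm Cp \<pi> R f \<phi>\<^sub>0 u\<^sub>0 s w)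
       (\<lambda>(s, w). s \<in> admissible_phases \<Omega> Q \<tau> R \<phi>\<^sub>0 \<and> w \<in> V) (\<phi>, u)
     \<longleftrightarrow>
     (\<exists>\<mu>. \<phi> \<in> Q \<and> \<mu> \<in> Q \<and> u \<in> V \<and>
       (\<forall>q\<^sub>\<phi>\<in>Q. \<forall>q\<^sub>\<mu>\<in>Q. \<forall>v\<in>V.
          l2_inner \<Omega> (\<lambda>x. (\<phi> x - \<phi>\<^sub>0 x) / \<tau>) q\<^sub>\<phi>
            + l2_inner \<Omega> (\<lambda>x. m *\<^sub>R weak_grad \<Omega> \<mu> x) (weak_grad \<Omega> q\<^sub>\<phi>)
            - l2_inner \<Omega> R q\<^sub>\<phi> = 0 \<and>
          l2_inner \<Omega> \<mu> q\<^sub>\<mu>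
            - \<gamma> * l * l2_inner \<Omega> (weak_grad \<Omega> \<phi>) (weak_grad \<Omega> q\<^sub>\<mu>)
            - \<gamma> / l * l2_inner \<Omega> (\<lambda>x. deriv \<Psi>\<^sub>c (\<phi> x) - deriv \<Psi>\<^sub>e (\<phi>\<^sub>0 x)) q\<^sub>\<mu>
            - l2_inner \<Omega> (elastic_semi_impl \<Omega> \<xi> Cm Cp \<pi> \<phi> u \<phi>\<^sub>0 u\<^sub>0) q\<^sub>\<mu> = 0 \<and>
          l2_inner \<Omega> (\<lambda>x. blinfun_apply (elasticity_tensor Cm Cp \<pi> (\<phi>\<^sub>0 x))
                               (elastic_strain \<Omega> \<xi> \<phi> u x)) (sym_grad \<Omega> v)
            - l2_inner \<Omega> f v = 0))"
proof -
  interpret fe_step \<Omega> Q m V \<gamma> l \<tau> \<xi> R f \<Psi>\<^sub>c \<Psi>\<^sub>e L Cm Cp \<pi> \<phi>\<^sub>0 u\<^sub>0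
  proof
    show "open \<Omega>" "bounded \<Omega>" "connected \<Omega>" "\<Omega> \<noteq> {}"
      using domain by (auto simp: bounded_lipschitz_domain_def)
  qed (fact assms)+
  let ?E = "\<lambda>(s, w). energy s w"
  let ?P = "\<lambda>(s, w). s \<in> admissible_phases \<Omega> Q \<tau> R \<phi>\<^sub>0 \<and> w \<in> V"
  have min_iff: "is_arg_min ?E ?P (\<phi>, u) \<longleftrightarrow> \<phi> \<in> admissible_phases \<Omega> Q \<tau> R \<phi>\<^sub>0 \<and> u \<in> V \<and>
      (\<forall>s w. s \<in> admissible_phases \<Omega> Q \<tau> R \<phi>\<^sub>0 \<longrightarrow> w \<in> V \<longrightarrow> energy \<phi> u \<le> energy s w)"
    by (auto simp: is_arg_min_linorder)
  have chem_iff: "l2_inner \<Omega> \<mu> q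
            - \<gamma> * l * l2_inner \<Omega> (weak_grad \<Omega> \<phi>) (weak_grad \<Omega> q)
            - \<gamma> / l * l2_inner \<Omega> (\<lambda>x. deriv \<Psi>\<^sub>c (\<phi> x) - deriv \<Psi>\<^sub>e (\<phi>\<^sub>0 x)) q
            - l2_inner \<Omega> (elastic_semi_impl \<Omega> \<xi> Cm Cp \<pi> \<phi> u \<phi>\<^sub>0 u\<^sub>0) q = 0
     \<longleftrightarrow> l2_inner \<Omega> \<mu> q = chemical_form \<phi> u q" for \<mu> q
    unfolding chemical_form_def by linarith
  have mom_eq: "l2_inner \<Omega> (\<lambda>x. blinfun_apply (elasticity_tensor Cm Cp \<pi> (\<phi>\<^sub>0 x))
                               (elastic_strain \<Omega> \<xi> \<phi> u x)) (sym_grad \<Omega> v)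
            - l2_inner \<Omega> f v = momentum_form \<phi> u v" for v
    by (simp add: momentum_form_def elastic_form_def stress_def[abs_def])
  have V0: "(\<lambda>x. 0) \<in> V" by (rule finite_element_space_zero[OF V_fe])
  show ?thesis
    unfolding min_iff chem_iff mom_eq
  proof (intro iffI; elim conjE exE)
    assume "\<phi> \<in> admissible_phases \<Omega> Q \<tau> R \<phi>\<^sub>0" and u: "u \<in> V"
      and "\<forall>s w. s \<in> admissible_phases \<Omega> Q \<tau> R \<phi>\<^sub>0 \<longrightarrow> w \<in> V \<longrightarrow> energy \<phi> u \<le> energy s w"
    then obtain \<mu> where \<mu>: "\<mu> \<in> Q" "\<And>p. p \<in> Q \<Longrightarrow> l2_inner \<Omega> (source \<phi>) p = - \<tau> * mobility_form \<mu> p"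
      "\<And>q. q \<in> Q \<Longrightarrow> l2_inner \<Omega> \<mu> q = chemical_form \<phi> u q"
      "\<And>v. v \<in> V \<Longrightarrow> momentum_form \<phi> u v = 0"
      using minimizer_imp_weak_solution[of \<phi> u] by metis
    have \<phi>: "\<phi> \<in> Q" using \<open>\<phi> \<in> admissible_phases \<Omega> Q \<tau> R \<phi>\<^sub>0\<close> by (simp add: admissible_iff)
    show "\<exists>\<mu>. \<phi> \<in> Q \<and> \<mu> \<in> Q \<and> u \<in> V \<and>
       (\<forall>q\<^sub>\<phi>\<in>Q. \<forall>q\<^sub>\<mu>\<in>Q. \<forall>v\<in>V.
          l2_inner \<Omega> (\<lambda>x. (\<phi> x - \<phi>\<^sub>0 x) / \<tau>) q\<^sub>\<phi>
            + l2_inner \<Omega> (\<lambda>x. m *\<^sub>R weak_grad \<Omega> \<mu> x) (weak_grad \<Omega> q\<^sub>\<phi>)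
            - l2_inner \<Omega> R q\<^sub>\<phi> = 0 \<and>
          l2_inner \<Omega> \<mu> q\<^sub>\<mu> = chemical_form \<phi> u q\<^sub>\<mu> \<and> momentum_form \<phi> u v = 0)"
      using \<phi> u \<mu> by (intro exI[of _ \<mu>] conjI ballI phase_equation_iff[THEN iffD2])
  next
    fix \<mu>
    assume \<phi>: "\<phi> \<in> Q" and \<mu>: "\<mu> \<in> Q" and u: "u \<in> V"
      and eqs: "\<forall>q\<^sub>\<phi>\<in>Q. \<forall>q\<^sub>\<mu>\<in>Q. \<forall>v\<in>V.
          l2_inner \<Omega> (\<lambda>x. (\<phi> x - \<phi>\<^sub>0 x) / \<tau>) q\<^sub>\<phi>
            + l2_inner \<Omega> (\<lambda>x. m *\<^sub>R weak_grad \<Omega> \<mu> x) (weak_grad \<Omega> q\<^sub>\<phi>)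
            - l2_inner \<Omega> R q\<^sub>\<phi> = 0 \<and>
          l2_inner \<Omega> \<mu> q\<^sub>\<mu> = chemical_form \<phi> u q\<^sub>\<mu> \<and> momentum_form \<phi> u v = 0"
    have "l2_inner \<Omega> (source \<phi>) p = - \<tau> * mobility_form \<mu> p" if "p \<in> Q" for p
      using eqs that zero V0 phase_equation_iff[OF \<phi> that, of \<mu>] by blast
    moreover have "l2_inner \<Omega> \<mu> q = chemical_form \<phi> u q" if "q \<in> Q" for q
      using eqs that V0 by blast
    moreover have "momentum_form \<phi> u v = 0" if "v \<in> V" for v
      using eqs that zero by blast
    ultimately show "\<phi> \<in> admissible_phases \<Omega> Q \<tau> R \<phi>\<^sub>0 \<and> u \<in> V \<and>
      (\<forall>s w. s \<in> admissible_phases \<Omega> Q \<tau> R \<phi>\<^sub>0 \<longrightarrow> w \<in> V \<longrightarrow> energy \<phi> u \<le> energy s w)"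
      using weak_solution_imp_minimizer[OF \<phi> \<mu> u] u by blast
  qed
qed

end
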